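(* There is an absolute constant $C>0$ such that the following holds. Let $d\ge1$, let $D\in\{2d,2d+1\}$, $U=D+1$, and let $\Sigma\subset\mathbb R^{U}$ be the cone of coefficient vectors, in the monomial basis $\mathbf q(z)=(1,z,\dots,z^D)^{\mathrm T}$, of univariate polynomials of degree at most $D$ nonnegative on $[-1,1]$ (represented as weighted sums of squares as in the context). Let $\mathbf 1$ be the coefficient vector of the constant one polynomial. Then: 1. $k_1^{\mathbf 1}:=\min\{\mathbf 1^{\mathrm T}\mathbf v\mid\mathbf v\in\Sigma^*,\ \|\mathbf v\|_\infty=1\}\ge1$. 2. There exist finitely many points $z_1,\dots,z_s\in[-1,1]$, unisolvent for the polynomials of degree at most $D$, and $\alpha_1,\dots,\alpha_s>0$ such that $\mathbf M=\sum_{i=1}^s\alpha_i\,\mathbf q(z_i)\mathbf q(z_i)^{\mathrm T}$ satisfies $\operatorname{cond}(\mathbf M)\le C\,(1+\sqrt2)^{4U}/\sqrt U$. 3. For every $\mathbf t\in\Sigma^\circ$ and $\varepsilon>0$ with $\mathbf t-\varepsilon\mathbf 1$ on the boundary of $\Sigma$, there exists an integer dual certificate $\overline{\mathbf y}\in(\Sigma^* )^\circ$ of $\mathbf t$ with $$\|\overline{\mathbf y}\|_\infty\le C\,d^{5/4}(1+\sqrt2)^{4d+4}\,\frac{\|\mathbf t\|_2}{\varepsilon}$$ and $$\log\|\overline{\mathbf y}\|_\infty\le C\bigl(1+d+\log\|\mathbf t\|_2+\log(1/\varepsilon)\bigr).$$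
   Context: $\mathcal V_k$ denotes univariate real polynomials of degree at most $k$; $\Sigma_{2k}$ the sums of squares of elements of $\mathcal V_k$. If $D=2d$: weights $w_1=1$, $w_2=1-z^2$, degrees $(d_1,d_2)=(d,d-1)$; if $D=2d+1$: weights $w_1=1-z$, $w_2=1+z$, degrees $(d_1,d_2)=(d,d)$. In both cases $\Sigma=\{w_1\sigma_1+w_2\sigma_2:\sigma_i\in\Sigma_{2d_i}\}$, which is exactly the cone of polynomials in $\mathcal V_D$ nonnegative on $[-1,1]$. Polynomials in $\mathcal V_D$ are identified with coefficient vectors in the basis $\mathbf q$. $\Sigma^*=\{\mathbf y\in\mathbb R^U:\mathbf x^{\mathrm T}\mathbf y\ge0\ \forall\mathbf x\in\Sigma\}$. Fix any ordered bases $\mathbf p_i$ of $\mathcal V_{d_i}$; $\Lambda_i$ is the unique linear map from $\mathbb R^U$ to symmetric matrices with $\Lambda_i(\mathbf q(z))=w_i(z)\mathbf p_i(z)\mathbf p_i(z)^{\mathrm T}$ for all $z$, and $\Lambda=\Lambda_1\oplus\Lambda_2$. Then $\Sigma^*=\{\mathbf x:\Lambda(\mathbf x)\succcurlyeq0\}$ and $(\Sigma^* )^\circ=\{\mathbf x:\Lambda(\mathbf x)\succ0\}$; $^\circ$ denotes interior. Let $f(\mathbf x)=-\ln\det\Lambda(\mathbf x)$ on $(\Sigma^* )^\circ$, with (positive definite) Hessian $H$. A vector $\mathbf x\in(\Sigma^* )^\circ$ is a dual certificate of $\mathbf s\in\Sigma$ if $H(\mathbf x)^{-1}\mathbf s\in\Sigma^*$.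 $\operatorname{cond}(\mathbf M)=\lambda_{\max}(\mathbf M)/\lambda_{\min}(\mathbf M)$. A point set is unisolvent for a space of polynomials if every polynomial in it is uniquely determined by its values on the set. *)

theory Defs
  imports
    "HOL-Analysis.Analysis"
    "HOL-Computational_Algebra.Polynomial"
    "Jordan_Normal_Form.Char_Poly"
begin

no_notation vec_nth (infixl \<open>$\<close> 90)
no_notation inner (infix \<open>\<bullet>\<close> 70)
hide_const (open) Finite_Cartesian_Product.vec Finite_Cartesian_Product.mat Determinants.det

section \<open>Vectors of a given dimension\<close>

definition l2_norm :: "real vec \<Rightarrow> real" where
  "l2_norm v = L2_set (\<lambda>i. v $ i) {..<dim_vec v}"

definition linf_norm :: "real vec \<Rightarrow> real" where
  "linf_norm v = Max ((\<lambda>i. \<bar>v $ i\<bar>) ` {..<dim_vec v})"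

definition vec_dist :: "nat \<Rightarrow> real vec \<Rightarrow> real vec \<Rightarrow> real" where
  "vec_dist n x y = L2_set (\<lambda>i. x $ i - y $ i) {..<n}"

lemma Metric_space_vec: "Metric_space (carrier_vec n) (vec_dist n)"
proof
  show "0 \<le> vec_dist n x y" for x y
    by (simp add: vec_dist_def)
  show "vec_dist n x y = vec_dist n y x" for x y
    by (simp add: vec_dist_def L2_set_def power2_commute)
  show "vec_dist n x y = 0 \<longleftrightarrow> x = y" if "x \<in> carrier_vec n" "y \<in> carrier_vec n" for x y
    using that by (auto simp: vec_dist_def L2_set_eq_0_iff)
  show "vec_dist n x z \<le> vec_dist n x y + vec_dist n y z" for x y z
  proof -
    have "vec_dist n x z = L2_set (\<lambda>i. (x $ i - y $ i) + (y $ i - z $ i)) {..<n}"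
      by (simp add: vec_dist_def)
    also have "\<dots> \<le> vec_dist n x y + vec_dist n y z"
      unfolding vec_dist_def by (rule L2_set_triangle_ineq)
    finally show ?thesis .
  qed
qed

definition vec_topology :: "nat \<Rightarrow> real vec topology" where
  "vec_topology n = Metric_space.mtopology (carrier_vec n) (vec_dist n)"

lemma topspace_vec_topology: "topspace (vec_topology n) = carrier_vec n"
  unfolding vec_topology_def by (rule Metric_space.topspace_mtopology[OF Metric_space_vec])

definition outer :: "real vec \<Rightarrow> real vec \<Rightarrow> real mat" where
  "outer v w = mat (dim_vec v) (dim_vec w) (\<lambda>(i,j). v $ i * w $ j)"

text \<open>For a symmetric matrix all eigenvalues are real, so ranging over the real ones loses nothing.\<close>

definition cond_num :: "real mat \<Rightarrow> real" where
  "cond_num M = Max {k. eigenvalue M k} / Min {k. eigenvalue M k}"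

definition partial_deriv :: "nat \<Rightarrow> (real vec \<Rightarrow> real) \<Rightarrow> nat \<Rightarrow> real vec \<Rightarrow> real" where
  "partial_deriv n g i x = deriv (\<lambda>t. g (x + t \<cdot>\<^sub>v unit_vec n i)) 0"

definition hessian :: "nat \<Rightarrow> (real vec \<Rightarrow> real) \<Rightarrow> real vec \<Rightarrow> real mat" where
  "hessian n g x = mat n n (\<lambda>(i,j). partial_deriv n (partial_deriv n g j) i x)"

section \<open>Weighted sums of squares on [-1,1]\<close>

definition coeff_vec :: "nat \<Rightarrow> real poly \<Rightarrow> real vec" where
  "coeff_vec D p = vec (D + 1) (coeff p)"

definition monom_vec :: "nat \<Rightarrow> real \<Rightarrow> real vec" where
  "monom_vec D z = vec (D + 1) (\<lambda>i. z ^ i)"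

text \<open>\<open>sos k\<close> is the set of sums of squares of polynomials of degree at most \<open>k\<close>.\<close>

definition sos :: "nat \<Rightarrow> real poly set" where
  "sos k = {p. \<exists>qs. (\<forall>q\<in>set qs. degree q \<le> k) \<and> p = (\<Sum>q\<leftarrow>qs. q\<^sup>2)}"

definition weight1 :: "nat \<Rightarrow> real poly" where
  "weight1 D = (if even D then 1 else [:1, -1:])"

definition weight2 :: "nat \<Rightarrow> real poly" where
  "weight2 D = (if even D then [:1, 0, -1:] else [:1, 1:])"

definition deg1 :: "nat \<Rightarrow> nat" where
  "deg1 D = D div 2"

definition deg2 :: "nat \<Rightarrow> nat" where
  "deg2 D = (if even D then D div 2 - 1 else D div 2)"

definition wsos_cone :: "nat \<Rightarrow> real vec set" where
  "wsos_cone D = {coeff_vec D (weight1 D * \<sigma>1 + weight2 D * \<sigma>2) | \<sigma>1 \<sigma>2.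
     \<sigma>1 \<in> sos (deg1 D) \<and> \<sigma>2 \<in> sos (deg2 D)}"

definition dual_cone :: "nat \<Rightarrow> real vec set" where
  "dual_cone D = {y \<in> carrier_vec (D + 1). \<forall>x\<in>wsos_cone D. 0 \<le> x \<bullet> y}"

definition unisolvent :: "nat \<Rightarrow> real set \<Rightarrow> bool" where
  "unisolvent D Z \<longleftrightarrow> (\<forall>p q :: real poly. degree p \<le> D \<and> degree q \<le> D \<and>
     (\<forall>z\<in>Z. poly p z = poly q z) \<longrightarrow> p = q)"

section \<open>The operator Lambda\<close>

lemma vector_space_smult: "Vector_Spaces.vector_space (Polynomial.smult :: real \<Rightarrow> real poly \<Rightarrow> real poly)"
  by unfold_locales (auto simp: smult_add_right smult_add_left)

definition poly_basis :: "nat \<Rightarrow> real poly list \<Rightarrow> bool" where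
  "poly_basis k ps \<longleftrightarrow> distinct ps \<and> \<not> Modules.module.dependent Polynomial.smult (set ps) \<and>
     Modules.module.span Polynomial.smult (set ps) = {p. degree p \<le> k}"

definition eval_vec :: "real poly list \<Rightarrow> real \<Rightarrow> real vec" where
  "eval_vec ps z = vec_of_list (map (\<lambda>p. poly p z) ps)"

text \<open>\<open>is_Lambda D w ps L\<close>: the map \<open>L\<close> is linear from \<open>\<real>\<^sup>D\<^sup>+\<^sup>1\<close> to symmetric matrices and
  \<open>L (q z) = w z * p z * (p z)\<^sup>T\<close> for all \<open>z\<close>. Extensionality is there only because HOL functions
  are total: it fixes the values outside the carrier.\<close>

definition is_Lambda ::
  "nat \<Rightarrow> real poly \<Rightarrow> real poly list \<Rightarrow> (real vec \<Rightarrow> real mat) \<Rightarrow> bool" where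
  "is_Lambda D w ps L \<longleftrightarrow>
     L \<in> extensional (carrier_vec (D + 1)) \<and>
     (\<forall>x\<in>carrier_vec (D + 1). L x \<in> carrier_mat (length ps) (length ps) \<and>
        transpose_mat (L x) = L x) \<and>
     (\<forall>x\<in>carrier_vec (D + 1). \<forall>y\<in>carrier_vec (D + 1). L (x + y) = L x + L y) \<and>
     (\<forall>c. \<forall>x\<in>carrier_vec (D + 1). L (c \<cdot>\<^sub>v x) = c \<cdot>\<^sub>m L x) \<and>
     (\<forall>z. L (monom_vec D z) = poly w z \<cdot>\<^sub>m outer (eval_vec ps z) (eval_vec ps z))"

definition Lambda_map :: "nat \<Rightarrow> real poly \<Rightarrow> real poly list \<Rightarrow> real vec \<Rightarrow> real mat" where
  "Lambda_map D w ps = (THE L. is_Lambda D w ps L)"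

definition Lambda_explicit :: "nat \<Rightarrow> real poly \<Rightarrow> real poly list \<Rightarrow> real vec \<Rightarrow> real mat" where
  "Lambda_explicit D w ps = restrict (\<lambda>x. mat (length ps) (length ps)
     (\<lambda>(j,k). \<Sum>l\<le>D. coeff (w * ps ! j * ps ! k) l * x $ l)) (carrier_vec (D + 1))"

lemma dim_eval_vec [simp]: "dim_vec (eval_vec ps z) = length ps"
  by (simp add: eval_vec_def)

lemma eval_vec_index [simp]: "j < length ps \<Longrightarrow> eval_vec ps z $ j = poly (ps ! j) z"
  by (simp add: eval_vec_def vec_of_list_index)

lemma monom_vec_carrier [simp]: "monom_vec D z \<in> carrier_vec (D + 1)"
  by (simp add: monom_vec_def)

lemma is_Lambda_explicit:
  assumes "\<And>j k. j < length ps \<Longrightarrow> k < length ps \<Longrightarrow> degree (w * ps ! j * ps ! k) \<le> D"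
  shows "is_Lambda D w ps (Lambda_explicit D w ps)"
proof -
  have pm: "(\<Sum>l\<le>D. coeff (w * ps ! j * ps ! k) l * z ^ l) = poly w z * (poly (ps ! j) z * poly (ps ! k) z)"
    if "j < length ps" "k < length ps" for j k z
  proof -
    let ?r = "w * ps ! j * ps ! k"
    have "(\<Sum>l\<le>D. coeff ?r l * z ^ l) = (\<Sum>l\<le>degree ?r. coeff ?r l * z ^ l)"
      using assms[OF that] by (intro sum.mono_neutral_right) (auto simp: coeff_eq_0)
    thus ?thesis
      by (simp add: poly_altdef[symmetric] mult.assoc)
  qed
  have sym: "w * ps ! j * ps ! k = w * ps ! k * ps ! j" for j k
    by (simp add: mult_ac)
  have mono: "Lambda_explicit D w ps (monom_vec D z)
      = poly w z \<cdot>\<^sub>m outer (eval_vec ps z) (eval_vec ps z)" for z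
  proof (rule eq_matI)
    fix j k
    assume "j < dim_row (poly w z \<cdot>\<^sub>m outer (eval_vec ps z) (eval_vec ps z))"
      "k < dim_col (poly w z \<cdot>\<^sub>m outer (eval_vec ps z) (eval_vec ps z))"
    hence jk: "j < length ps" "k < length ps"
      by (auto simp: outer_def)
    have "Lambda_explicit D w ps (monom_vec D z) $$ (j, k)
        = (\<Sum>l\<le>D. coeff (w * ps ! j * ps ! k) l * z ^ l)"
      unfolding Lambda_explicit_def restrict_apply'[OF monom_vec_carrier]
      using jk by (auto simp: monom_vec_def intro!: sum.cong)
    also have "\<dots> = (poly w z \<cdot>\<^sub>m outer (eval_vec ps z) (eval_vec ps z)) $$ (j, k)"
      unfolding pm[OF jk] using jk by (simp add: outer_def)
    finally show "Lambda_explicit D w ps (monom_vec D z) $$ (j, k)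
      = (poly w z \<cdot>\<^sub>m outer (eval_vec ps z) (eval_vec ps z)) $$ (j, k)" .
  qed (use monom_vec_carrier[of D z] in \<open>auto simp: Lambda_explicit_def outer_def\<close>)
  show ?thesis
    unfolding is_Lambda_def
  proof (intro conjI ballI allI)
    show "Lambda_explicit D w ps \<in> extensional (carrier_vec (D + 1))"
      by (simp add: Lambda_explicit_def)
    show "Lambda_explicit D w ps x \<in> carrier_mat (length ps) (length ps)"
      if "x \<in> carrier_vec (D + 1)" for x
      using that by (simp add: Lambda_explicit_def)
    show "transpose_mat (Lambda_explicit D w ps x) = Lambda_explicit D w ps x"
      if "x \<in> carrier_vec (D + 1)" for x
      using that by (intro eq_matI) (auto simp: Lambda_explicit_def mult_ac)
    show "Lambda_explicit D w ps (x + y) = Lambda_explicit D w ps x + Lambda_explicit D w ps y"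
      if "x \<in> carrier_vec (D + 1)" "y \<in> carrier_vec (D + 1)" for x y
      using that by (intro eq_matI)
        (auto simp: Lambda_explicit_def algebra_simps sum.distrib[symmetric] intro!: sum.cong)
    show "Lambda_explicit D w ps (c \<cdot>\<^sub>v x) = c \<cdot>\<^sub>m Lambda_explicit D w ps x"
      if "x \<in> carrier_vec (D + 1)" for c x
      using that by (intro eq_matI)
        (auto simp: Lambda_explicit_def sum_distrib_left algebra_simps intro!: sum.cong)
  qed (rule mono)
qed

lemma is_Lambda_index:
  assumes L: "is_Lambda D w ps L" and x: "x \<in> carrier_vec (D + 1)"
    and jk: "j < length ps" "k < length ps"
  shows "L x $$ (j, k) = (\<Sum>l\<le>D. L (unit_vec (D + 1) l) $$ (j, k) * x $ l)"
proof -
  have part: "L (vec (D + 1) (\<lambda>i. if i < m then x $ i else 0)) $$ (j, k)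
      = (\<Sum>l<m. L (unit_vec (D + 1) l) $$ (j, k) * x $ l)" if "m \<le> D + 1" for m
    using that
  proof (induction m)
    case 0
    have "L (vec (D + 1) (\<lambda>i. if i < 0 then x $ i else 0)) = L (0 \<cdot>\<^sub>v x)"
      using x by (intro arg_cong[where f = L]) auto
    also have "\<dots> = 0 \<cdot>\<^sub>m L x"
      using L x by (simp add: is_Lambda_def)
    finally show ?case
      using L x jk by (auto simp: is_Lambda_def)
  next
    case (Suc m)
    let ?v = "vec (D + 1) (\<lambda>i. if i < m then x $ i else 0)"
    have eq: "vec (D + 1) (\<lambda>i. if i < Suc m then x $ i else 0)
        = ?v + x $ m \<cdot>\<^sub>v unit_vec (D + 1) m"
      using Suc.prems by (intro eq_vecI) (auto simp: less_Suc_eq unit_vec_def)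
    have add: "L (a + b) = L a + L b"
      if "a \<in> carrier_vec (D + 1)" "b \<in> carrier_vec (D + 1)" for a b
      using L that unfolding is_Lambda_def by blast
    have scale: "L (c \<cdot>\<^sub>v a) = c \<cdot>\<^sub>m L a" if "a \<in> carrier_vec (D + 1)" for a c
      using L that unfolding is_Lambda_def by blast
    have "L (?v + x $ m \<cdot>\<^sub>v unit_vec (D + 1) m)
        = L ?v + x $ m \<cdot>\<^sub>m L (unit_vec (D + 1) m)"
      by (subst add) (simp_all add: scale)
    moreover have "L ?v \<in> carrier_mat (length ps) (length ps)"
      "L (unit_vec (D + 1) m) \<in> carrier_mat (length ps) (length ps)"
      using L unfolding is_Lambda_def by (blast intro: unit_vec_carrier vec_carrier)+
    ultimately show ?case
      unfolding eq using Suc jk by simp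
  qed
  have "x = vec (D + 1) (\<lambda>i. if i < D + 1 then x $ i else 0)"
    using x by auto
  thus ?thesis
    using part[of "D + 1"] by (simp add: lessThan_Suc_atMost)
qed

lemma is_Lambda_unique:
  assumes L: "is_Lambda D w ps L" and L': "is_Lambda D w ps L'"
  shows "L = L'"
proof (rule extensionalityI[where A = "carrier_vec (D + 1)"])
  show "L \<in> extensional (carrier_vec (D + 1))" "L' \<in> extensional (carrier_vec (D + 1))"
    using L L' by (auto simp: is_Lambda_def)
  fix x :: "real vec" assume x: "x \<in> carrier_vec (D + 1)"
  show "L x = L' x"
  proof (rule eq_matI)
    have c: "L x \<in> carrier_mat (length ps) (length ps)" "L' x \<in> carrier_mat (length ps) (length ps)"
      using L L' x by (auto simp: is_Lambda_def)
    thus "dim_row (L x) = dim_row (L' x)" "dim_col (L x) = dim_col (L' x)" by auto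
    fix j k assume "j < dim_row (L' x)" "k < dim_col (L' x)"
    hence jk: "j < length ps" "k < length ps" using c by auto
    let ?a = "\<lambda>l. L (unit_vec (D + 1) l) $$ (j, k)"
    let ?b = "\<lambda>l. L' (unit_vec (D + 1) l) $$ (j, k)"
    have "(\<Sum>l\<le>D. ?a l * z ^ l) = (\<Sum>l\<le>D. ?b l * z ^ l)" for z
    proof -
      have "(\<Sum>l\<le>D. ?a l * z ^ l) = L (monom_vec D z) $$ (j, k)"
        using is_Lambda_index[OF L monom_vec_carrier jk, of z]
        by (auto simp: monom_vec_def intro!: sum.cong)
      also have "\<dots> = L' (monom_vec D z) $$ (j, k)"
        using L L' by (simp add: is_Lambda_def)
      also have "\<dots> = (\<Sum>l\<le>D. ?b l * z ^ l)"
        using is_Lambda_index[OF L' monom_vec_carrier jk, of z]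
        by (auto simp: monom_vec_def intro!: sum.cong)
      finally show ?thesis .
    qed
    hence "\<forall>l\<le>D. ?a l = ?b l"
      using polyfun_eq_coeffs[of ?a D ?b] by blast
    thus "L x $$ (j, k) = L' x $$ (j, k)"
      by (simp add: is_Lambda_index[OF L x jk] is_Lambda_index[OF L' x jk])
  qed
qed

lemma poly_basis_degree:
  assumes "poly_basis k ps" "j < length ps"
  shows "degree (ps ! j) \<le> k"
proof -
  interpret Vector_Spaces.vector_space "Polynomial.smult :: real \<Rightarrow> real poly \<Rightarrow> real poly"
    by (rule vector_space_smult)
  show ?thesis
    using assms span_base[of "ps ! j" "set ps"] by (auto simp: poly_basis_def)
qed

lemma Lambda_map_eq_explicit:
  assumes "poly_basis k ps" "degree w + 2 * k \<le> D"
  shows "Lambda_map D w ps = Lambda_explicit D w ps"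
proof -
  have "degree (w * ps ! i * ps ! j) \<le> D" if "i < length ps" "j < length ps" for i j
    using poly_basis_degree[OF assms(1) that(1)] poly_basis_degree[OF assms(1) that(2)]
      degree_mult_le[of w "ps ! i"] degree_mult_le[of "w * ps ! i" "ps ! j"] assms(2)
    by linarith
  from is_Lambda_explicit[OF this] show ?thesis
    unfolding Lambda_map_def by (intro the_equality is_Lambda_unique) auto
qed

lemma degree_weights:
  "degree (weight1 D) + 2 * deg1 D \<le> D"
  "D > 0 \<Longrightarrow> degree (weight2 D) + 2 * deg2 D \<le> D"
  by (auto simp: weight1_def weight2_def deg1_def deg2_def elim!: evenE oddE)

definition Lambda :: "nat \<Rightarrow> real poly list \<Rightarrow> real poly list \<Rightarrow> real vec \<Rightarrow> real mat" where
  "Lambda D ps1 ps2 x =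
     diag_block_mat [Lambda_map D (weight1 D) ps1 x, Lambda_map D (weight2 D) ps2 x]"

section \<open>Dual certificates\<close>

definition barrier :: "nat \<Rightarrow> real poly list \<Rightarrow> real poly list \<Rightarrow> real vec \<Rightarrow> real" where
  "barrier D ps1 ps2 x = - ln (det (Lambda D ps1 ps2 x))"

definition dual_certificate ::
  "nat \<Rightarrow> real poly list \<Rightarrow> real poly list \<Rightarrow> real vec \<Rightarrow> real vec \<Rightarrow> bool" where
  "dual_certificate D ps1 ps2 x s \<longleftrightarrow>
     s \<in> wsos_cone D \<and> x \<in> vec_topology (D + 1) interior_of dual_cone D \<and>
     (let H = hessian (D + 1) (barrier D ps1 ps2) x in
        \<exists>B\<in>carrier_mat (D + 1) (D + 1). inverts_mat H B \<and> inverts_mat B H \<and>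
          B *\<^sub>v s \<in> dual_cone D)"

end

theory Submission
  imports Defs "HOL-Real_Asymp.Real_Asymp"
begin

text \<open>
  On \<open>\<Sigma>\<^sup>*\<close> the weighted sums of squares \<open>1 \<plusminus> z\<^sup>i\<close> give \<open>\<bar>v\<^sub>i\<bar> \<le> v\<^sub>0\<close>, so evaluation at \<open>0\<close> attains the
  minimum of part 1.

  Lagrange interpolation at the \<open>D + 1\<close> equispaced points of \<open>[-1, 1]\<close> bounds the coefficient sum of
  a polynomial of degree at most \<open>D\<close> by \<open>(2e)\<^sup>D\<close> times the sum of its absolute values at these points.
  Since \<open>2e < (1 + sqrt 2)\<^sup>2\<close>, all polynomial factors are absorbed by the constant; Chebyshev nodes are
  not needed. With unit weights at these points this gives part 2.

  For part 3 let \<open>x\<close> maximize \<open>det \<Lambda>\<close> on the slice \<open>t\<^sup>T x = c U\<close> of \<open>\<Sigma>\<^sup>*\<close>; then \<open>x\<close> is a gradient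
  certificate of \<open>t / c\<close>, and \<open>t - \<epsilon> 1 \<in> \<Sigma>\<close> forces \<open>x\<^sub>0 \<le> c U / \<epsilon>\<close>. Every point at distance less than
  \<open>1\<close> from \<open>x\<close> in the local norm is a dual certificate, by one application of Cauchy--Schwarz to the
  trace form \<open>tr (S A S B)\<close>. If \<open>\<mu>\<close> denotes the sum of the point evaluations at the nodes, the
  interpolation bound gives \<open>\<kappa> \<mu> \<plusminus> u \<in> \<Sigma>\<^sup>*\<close> for every rounding error \<open>u\<close>, with \<open>\<kappa> = (2e)\<^sup>D\<close>,
  so the local norm of \<open>u\<close> is at most \<open>\<kappa> (t\<^sup>T \<mu>) / c\<close>, and \<open>c = 2 \<kappa> (t\<^sup>T \<mu>)\<close> makes
  rounding \<open>x\<close> harmless.\<close>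

hide_const (open) Module.smult

section \<open>Positive semidefinite matrices and the trace form\<close>

text \<open>The Hessian of the barrier at \<open>y\<close> is the pull-back under \<open>L\<close>
  of the form \<open>tr (S A S B)\<close>, where \<open>S\<close> is the inverse of
  \<open>L y\<close>. Certificates are therefore handled as statements about matrices, membership in
  the dual cone being positive semidefiniteness of \<open>L\<close>. At the exact maximizer
  \<open>x\<close> the gradient identity gives \<open>H(x) x = t / c\<close>, so \<open>c x\<close>
  is the required inverse image of \<open>t\<close> and lies in the dual cone at no cost. The
  obstacle is that rounding moves the point and with it the Hessian that has to be inverted. The
  level \<open>c\<close> is a free parameter, since cones do not see scaling: a larger
  \<open>c\<close> stretches \<open>x\<close> while the rounding error stays in a fixed box, so the
  local norm of the error decays like \<open>1 / c\<close>, and the size of the certificate grows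
  linearly in \<open>c\<close>. It remains to find one dual vector that dominates the whole box. Any
  bound of coefficients by values at finitely many points of [-1, 1] yields one, and the same bound
  controls the smallest eigenvalue of the matrix in part 2; hence a single interpolation estimate
  serves both parts.\<close>

definition mtrace :: "real mat \<Rightarrow> real" where
  "mtrace A = (\<Sum>i<dim_row A. A $$ (i, i))"

lemma mult_mat_index:
  fixes A B :: "real mat"
  assumes "A \<in> carrier_mat n m" "B \<in> carrier_mat m k" "i < n" "j < k"
  shows "(A * B) $$ (i, j) = (\<Sum>l<m. A $$ (i, l) * B $$ (l, j))"
  using assms by (auto simp: scalar_prod_def atLeast0LessThan intro!: sum.cong)

lemma mtrace_comm:
  assumes "A \<in> carrier_mat n m" "B \<in> carrier_mat m n"
  shows "mtrace (A * B) = mtrace (B * A)"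
proof -
  have "mtrace (A * B) = (\<Sum>i<n. \<Sum>l<m. A $$ (i, l) * B $$ (l, i))"
    unfolding mtrace_def using assms by (auto simp del: index_mult_mat(1) simp: mult_mat_index[OF assms])
  also have "\<dots> = (\<Sum>l<m. \<Sum>i<n. B $$ (l, i) * A $$ (i, l))"
    by (subst sum.swap) (simp add: mult.commute)
  also have "\<dots> = mtrace (B * A)"
    unfolding mtrace_def using assms
    by (auto simp del: index_mult_mat(1) simp: mult_mat_index[OF assms(2,1)])
  finally show ?thesis .
qed

lemma mtrace_add:
  "A \<in> carrier_mat n n \<Longrightarrow> B \<in> carrier_mat n n \<Longrightarrow> mtrace (A + B) = mtrace A + mtrace B"
  by (auto simp: mtrace_def sum.distrib)

lemma mtrace_diff:
  "A \<in> carrier_mat n n \<Longrightarrow> B \<in> carrier_mat n n \<Longrightarrow> mtrace (A - B) = mtrace A - mtrace B"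
  by (auto simp: mtrace_def sum_subtractf)

lemma mtrace_smult: "A \<in> carrier_mat n n \<Longrightarrow> mtrace (c \<cdot>\<^sub>m A) = c * mtrace A"
  by (auto simp: mtrace_def sum_distrib_left)

lemma mtrace_one: "mtrace (1\<^sub>m n) = real n"
  by (simp add: mtrace_def)

definition symm :: "nat \<Rightarrow> real mat \<Rightarrow> bool" where
  "symm n A \<longleftrightarrow> A \<in> carrier_mat n n \<and> A\<^sup>T = A"

definition psd :: "nat \<Rightarrow> real mat \<Rightarrow> bool" where
  "psd n A \<longleftrightarrow> symm n A \<and> (\<forall>v\<in>carrier_vec n. 0 \<le> v \<bullet> (A *\<^sub>v v))"

definition pd :: "nat \<Rightarrow> real mat \<Rightarrow> bool" where
  "pd n A \<longleftrightarrow> symm n A \<and> (\<forall>v\<in>carrier_vec n. v \<noteq> 0\<^sub>v n \<longrightarrow> 0 < v \<bullet> (A *\<^sub>v v))"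

lemma symm_carrier: "symm n A \<Longrightarrow> A \<in> carrier_mat n n"
  by (simp add: symm_def)

lemma psd_symm: "psd n A \<Longrightarrow> symm n A"
  by (simp add: psd_def)

lemma psd_carrier: "psd n A \<Longrightarrow> A \<in> carrier_mat n n"
  by (simp add: psd_def symm_def)

lemma pd_imp_psd: "pd n A \<Longrightarrow> psd n A"
  unfolding pd_def psd_def
proof (intro conjI ballI)
  fix v :: "real vec"
  assume A: "symm n A \<and> (\<forall>v\<in>carrier_vec n. v \<noteq> 0\<^sub>v n \<longrightarrow> 0 < v \<bullet> (A *\<^sub>v v))"
    and v: "v \<in> carrier_vec n"
  show "0 \<le> v \<bullet> (A *\<^sub>v v)"
    using A v by (cases "v = 0\<^sub>v n") (auto simp: symm_def intro: less_imp_le)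
qed auto

lemma pd_carrier: "pd n A \<Longrightarrow> A \<in> carrier_mat n n"
  by (simp add: pd_def symm_def)

lemma symm_dims: "symm n A \<Longrightarrow> dim_row A = n \<and> dim_col A = n"
  by (auto simp: symm_def)

lemma symm_index: "symm n A \<Longrightarrow> i < n \<Longrightarrow> j < n \<Longrightarrow> A $$ (i, j) = A $$ (j, i)"
  by (metis symm_def carrier_matD index_transpose_mat(1))

lemma symmI:
  "A \<in> carrier_mat n n \<Longrightarrow> (\<And>i j. i < n \<Longrightarrow> j < n \<Longrightarrow> A $$ (i, j) = A $$ (j, i)) \<Longrightarrow> symm n A"
  by (auto simp: symm_def)

lemma symm_add: "symm n A \<Longrightarrow> symm n B \<Longrightarrow> symm n (A + B)"
  by (rule symmI) (simp_all add: symm_carrier symm_dims symm_index[of n])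

lemma symm_diff: "symm n A \<Longrightarrow> symm n B \<Longrightarrow> symm n (A - B)"
  by (rule symmI) (simp_all add: symm_carrier symm_dims minus_carrier_mat symm_index[of n])

lemma symm_smult: "symm n A \<Longrightarrow> symm n (c \<cdot>\<^sub>m A)"
  by (rule symmI) (simp_all add: symm_carrier symm_dims symm_index[of n])

lemma symm_congr:
  assumes "symm n A" "symm n S"
  shows "symm n (A * S * A)"
proof -
  note c = symm_carrier[OF assms(1)] symm_carrier[OF assms(2)]
  have "(A * S * A)\<^sup>T = A\<^sup>T * (S\<^sup>T * A\<^sup>T)"
    using c by (simp add: transpose_mult[of _ n n _ n])
  thus ?thesis
    using c assms unfolding symm_def
    by (simp add: assoc_mult_mat[of _ n n _ n _ n] mult_carrier_mat[of _ n n])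
qed

lemma quad_form_sum:
  fixes A :: "real mat"
  assumes "A \<in> carrier_mat n n" "v \<in> carrier_vec n" "w \<in> carrier_vec n"
  shows "v \<bullet> (A *\<^sub>v w) = (\<Sum>i<n. \<Sum>j<n. v $ i * w $ j * A $$ (i, j))"
proof -
  have "v \<bullet> (A *\<^sub>v w) = (\<Sum>i<n. v $ i * (\<Sum>j<n. A $$ (i, j) * w $ j))"
    using assms by (auto simp: scalar_prod_def atLeast0LessThan intro!: sum.cong)
  also have "\<dots> = (\<Sum>i<n. \<Sum>j<n. v $ i * w $ j * A $$ (i, j))"
    unfolding sum_distrib_left by (intro sum.cong refl) (simp add: mult_ac)
  finally show ?thesis .
qed

lemma symm_form_comm:
  assumes "symm n A" "v \<in> carrier_vec n" "w \<in> carrier_vec n"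
  shows "v \<bullet> (A *\<^sub>v w) = w \<bullet> (A *\<^sub>v v)"
proof -
  have "v \<bullet> (A *\<^sub>v w) = (A\<^sup>T *\<^sub>v v) \<bullet> w"
    using transpose_vec_mult_scalar[OF symm_carrier[OF assms(1)] assms(3,2)] by simp
  also have "\<dots> = w \<bullet> (A *\<^sub>v v)"
    using assms by (subst comm_scalar_prod[of _ n]) (auto simp: symm_def)
  finally show ?thesis .
qed

section \<open>Cauchy-Schwarz and Gram factorization for positive semidefinite matrices\<close>

text \<open>The sign of \<open>c\<close> is not given: \<open>c = 0\<close> forces
  \<open>b = 0\<close>, a negative \<open>c\<close> is contradictory, and for \<open>c > 0\<close>
  the claim is the value at the minimizer \<open>- b / c\<close>.\<close>

lemma discriminant_nonneg:
  fixes a b c :: real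
  assumes "\<And>s. 0 \<le> a + 2 * s * b + s\<^sup>2 * c"
  shows "b\<^sup>2 \<le> a * c"
proof (cases "c = 0")
  case True
  have "b = 0"
  proof (rule ccontr)
    assume b: "b \<noteq> 0"
    have "0 \<le> a + 2 * (- (a + 1) / (2 * b)) * b" using assms[of "- (a + 1) / (2 * b)"] True by simp
    also have "\<dots> = - 1" using b by (simp add: field_simps)
    finally show False by simp
  qed
  thus ?thesis using True by simp
next
  case False
  have a: "0 \<le> a" using assms[of 0] by simp
  have "0 \<le> c"
  proof (rule ccontr)
    assume "\<not> 0 \<le> c"
    hence c: "c < 0" by simp
    \<comment> \<open>Adding the hypothesis at \<open>r + 1\<close> and at \<open>- (r + 1)\<close>
      cancels \<open>b\<close>. Since \<open>(r + 1)^2\<close> exceeds \<open>r\<close> and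
      \<open>c < 0\<close>, the sum is at most \<open>2 a + 2 r c = - 2\<close>.\<close>
    define r where "r = (a + 1) / - c"
    have r: "r > 0" using a c by (simp add: r_def divide_pos_neg)
    have rc: "r * c = - (a + 1)" using c by (simp add: r_def field_simps)
    have "(r + 1)\<^sup>2 * c \<le> r * c"
      using r c by (intro mult_right_mono_neg) (auto simp: power2_eq_square algebra_simps)
    moreover have "0 \<le> a + 2 * (r + 1) * b + (r + 1)\<^sup>2 * c"
      by (rule assms)
    moreover have "0 \<le> a + 2 * - (r + 1) * b + (r + 1)\<^sup>2 * c"
      using assms[of "- (r + 1)"] unfolding power2_minus .
    ultimately show False using rc by (simp add: algebra_simps)
  qed
  hence c: "c > 0" using False by simp
  have "0 \<le> a + 2 * (- b / c) * b + (- b / c)\<^sup>2 * c" by (rule assms)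
  also have "\<dots> = a - b\<^sup>2 / c" using c by (simp add: power2_eq_square field_simps)
  finally show ?thesis using c by (simp add: field_simps)
qed

lemma psd_cauchy_schwarz:
  assumes A: "psd n A" and v: "v \<in> carrier_vec n" and w: "w \<in> carrier_vec n"
  shows "(v \<bullet> (A *\<^sub>v w))\<^sup>2 \<le> (v \<bullet> (A *\<^sub>v v)) * (w \<bullet> (A *\<^sub>v w))"
proof (rule discriminant_nonneg)
  fix s :: real
  note c = psd_carrier[OF A]
  have "0 \<le> (v + s \<cdot>\<^sub>v w) \<bullet> (A *\<^sub>v (v + s \<cdot>\<^sub>v w))"
    using A v w by (simp add: psd_def)
  also have "\<dots> = v \<bullet> (A *\<^sub>v v) + s * (v \<bullet> (A *\<^sub>v w)) + (s * (w \<bullet> (A *\<^sub>v v)) + s * (s * (w \<bullet> (A *\<^sub>v w))))"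
    using c v w
    by (simp add: mult_add_distrib_mat_vec[of _ n n] mult_mat_vec[of _ n n]
        add_scalar_prod_distrib[of _ n] scalar_prod_add_distrib[of _ n] distrib_left)
  also have "\<dots> = v \<bullet> (A *\<^sub>v v) + 2 * s * (v \<bullet> (A *\<^sub>v w)) + s\<^sup>2 * (w \<bullet> (A *\<^sub>v w))"
    using symm_form_comm[OF psd_symm[OF A] v w] by (simp add: power2_eq_square algebra_simps)
  finally show "0 \<le> v \<bullet> (A *\<^sub>v v) + 2 * s * (v \<bullet> (A *\<^sub>v w)) + s\<^sup>2 * (w \<bullet> (A *\<^sub>v w))" .
qed

text \<open>Cholesky factorization by induction: the last column divided by \<open>sqrt a\<close> is
  split off, and the Schur complement \<open>g\<close> satisfies the hypotheses again. Functions of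
  two indices make the restriction to smaller \<open>n\<close> free. For \<open>a = 0\<close> the
  last column vanishes (\<open>fin0\<close>), and since division by 0 yields 0 the same formulas
  cover this case.\<close>

lemma gram_factorization:
  fixes f :: "nat \<Rightarrow> nat \<Rightarrow> real"
  assumes "\<And>i j. i < n \<Longrightarrow> j < n \<Longrightarrow> f i j = f j i"
    and "\<And>c. 0 \<le> (\<Sum>i<n. \<Sum>j<n. c i * c j * f i j)"
  shows "\<exists>R. \<forall>i<n. \<forall>j<n. f i j = (\<Sum>k<n. R k i * R k j)"
  using assms
proof (induction n arbitrary: f)
  case 0
  thus ?case by simp
next
  case (Suc n)
  define a where "a = f n n"
  have sym: "f i j = f j i" if "i \<le> n" "j \<le> n" for i j
    using Suc.prems(1) that by simp
  \<comment> \<open>The form on \<open>n + 1\<close> coordinates, as a quadratic polynomial in the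
    last coordinate \<open>s\<close>.\<close>
  have full: "0 \<le> (\<Sum>i<n. \<Sum>j<n. c i * c j * f i j) + 2 * s * (\<Sum>i<n. c i * f i n) + s\<^sup>2 * a" for c s
  proof -
    let ?c = "c(n := s)"
    have "0 \<le> (\<Sum>i<Suc n. \<Sum>j<Suc n. ?c i * ?c j * f i j)" by (rule Suc.prems(2))
    also have "\<dots> = (\<Sum>i<n. \<Sum>j<n. c i * c j * f i j) + (\<Sum>i<n. c i * s * f i n)
        + ((\<Sum>j<n. s * c j * f n j) + s * s * a)"
      by (simp add: sum.distrib a_def)
    also have "(\<Sum>j<n. s * c j * f n j) = (\<Sum>j<n. c j * s * f j n)"
      by (intro sum.cong) (auto simp: sym mult_ac)
    finally show ?thesis
      by (simp add: sum_distrib_left mult_ac power2_eq_square)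
  qed
  have a0: "a \<ge> 0" using full[of "\<lambda>_. 0" 1] by simp
  have fin0: "f i n = 0" if "a = 0" "i < n" for i
  proof -
    let ?c = "\<lambda>k. if k = i then 1 else 0 :: real"
    have "(\<Sum>k<n. ?c k * f k n)\<^sup>2 \<le> (\<Sum>i<n. \<Sum>j<n. ?c i * ?c j * f i j) * a"
      by (rule discriminant_nonneg) (rule full)
    moreover have "(\<Sum>k<n. ?c k * f k n) = (\<Sum>k<n. if k = i then f k n else 0)"
      by (intro sum.cong) auto
    ultimately show ?thesis using that by simp
  qed
  define g where "g i j = f i j - f i n * f j n / a" for i j
  have "\<exists>R. \<forall>i<n. \<forall>j<n. g i j = (\<Sum>k<n. R k i * R k j)"
  proof (rule Suc.IH)
    show "g i j = g j i" if "i < n" "j < n" for i j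
      using sym that by (simp add: g_def mult.commute)
    fix c :: "nat \<Rightarrow> real"
    define b where "b = (\<Sum>i<n. c i * f i n)"
    have "(\<Sum>i<n. \<Sum>j<n. c i * c j * g i j)
        = (\<Sum>i<n. \<Sum>j<n. c i * c j * f i j) - (\<Sum>i<n. \<Sum>j<n. (c i * f i n) * (c j * f j n)) / a"
      by (simp add: g_def algebra_simps sum_subtractf sum_divide_distrib)
    also have "(\<Sum>i<n. \<Sum>j<n. (c i * f i n) * (c j * f j n)) = b * b"
      by (simp add: b_def sum_product)
    \<comment> \<open>\<open>- b / a\<close> is the last coordinate that minimizes the full form, so
      the Schur complement is a value of the full form.\<close>
    also have "(\<Sum>i<n. \<Sum>j<n. c i * c j * f i j) - b * b / a
        = (\<Sum>i<n. \<Sum>j<n. c i * c j * f i j) + 2 * (- b / a) * b + (- b / a)\<^sup>2 * a"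
      using a0 by (cases "a = 0") (simp_all add: power2_eq_square field_simps)
    also have "\<dots> \<ge> 0" unfolding b_def by (rule full)
    finally show "0 \<le> (\<Sum>i<n. \<Sum>j<n. c i * c j * g i j)" .
  qed
  then obtain R where R: "\<And>i j. i < n \<Longrightarrow> j < n \<Longrightarrow> g i j = (\<Sum>k<n. R k i * R k j)"
    by blast
  define R' where "R' k i = (if k = n then f i n / sqrt a else if i = n then 0 else R k i)" for k i
  have "f i j = (\<Sum>k<Suc n. R' k i * R' k j)" if "i < Suc n" "j < Suc n" for i j
  proof -
    have last: "R' n i * R' n j = f i n * f j n / a" using a0 by (simp add: R'_def)
    consider "i < n" "j < n" | "i = n" | "j = n" using \<open>i < Suc n\<close> \<open>j < Suc n\<close> by linarith
    thus ?thesis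
    proof cases
      case 1
      have "(\<Sum>k<n. R' k i * R' k j) = g i j"
        using 1 by (auto simp: R'_def R intro!: sum.cong)
      thus ?thesis using last by (simp add: g_def)
    next
      case 2
      have "(\<Sum>k<n. R' k i * R' k j) = 0" using 2 by (simp add: R'_def)
      thus ?thesis using last 2 fin0[of j] sym[of n j] \<open>j < Suc n\<close>
        by (cases "a = 0"; cases "j = n") (auto simp: a_def)
    next
      case 3
      have "(\<Sum>k<n. R' k i * R' k j) = 0" using 3 by (simp add: R'_def)
      thus ?thesis using last 3 fin0[of i] \<open>i < Suc n\<close>
        by (cases "a = 0"; cases "i = n") (auto simp: a_def)
    qed
  qed
  thus ?case by blast
qed

lemma psd_factorization:
  assumes "psd n A"
  obtains V where "V \<in> carrier_mat n n" "A = V * V\<^sup>T"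
proof -
  note c = psd_carrier[OF assms]
  have "\<exists>R. \<forall>i<n. \<forall>j<n. A $$ (i, j) = (\<Sum>k<n. R k i * R k j)"
  proof (rule gram_factorization)
    show "A $$ (i, j) = A $$ (j, i)" if "i < n" "j < n" for i j
      using symm_index[OF psd_symm[OF assms]] that by blast
    fix f :: "nat \<Rightarrow> real"
    have "0 \<le> vec n f \<bullet> (A *\<^sub>v vec n f)"
      using assms by (simp add: psd_def)
    thus "0 \<le> (\<Sum>i<n. \<Sum>j<n. f i * f j * A $$ (i, j))"
      unfolding quad_form_sum[OF c vec_carrier vec_carrier] by simp
  qed
  then obtain R where R: "\<And>i j. i < n \<Longrightarrow> j < n \<Longrightarrow> A $$ (i, j) = (\<Sum>k<n. R k i * R k j)"
    by blast
  define V where "V = mat n n (\<lambda>(i, k). R k i)"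
  show ?thesis
  proof
    show V: "V \<in> carrier_mat n n" by (simp add: V_def)
    hence Vt: "V\<^sup>T \<in> carrier_mat n n" by simp
    show "A = V * V\<^sup>T"
    proof (rule eq_matI)
      fix i j assume "i < dim_row (V * V\<^sup>T)" "j < dim_col (V * V\<^sup>T)"
      hence ij: "i < n" "j < n" using V by auto
      show "A $$ (i, j) = (V * V\<^sup>T) $$ (i, j)"
        unfolding mult_mat_index[OF V Vt ij] R[OF ij]
        using ij by (auto simp: V_def intro!: sum.cong)
    qed (use c V in auto)
  qed
qed

lemma congr_index:
  fixes V B :: "real mat"
  assumes "V \<in> carrier_mat n n" "B \<in> carrier_mat n n" "k < n" "l < n"
  shows "(V\<^sup>T * (B * V)) $$ (k, l) = col V k \<bullet> (B *\<^sub>v col V l)"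
proof -
  have "col (B * V) l = B *\<^sub>v col V l"
    using assms by (intro eq_vecI) auto
  thus ?thesis using assms by simp
qed

lemma mtrace_factor:
  assumes "V \<in> carrier_mat n n" "B \<in> carrier_mat n n"
  shows "mtrace (V * V\<^sup>T * B) = (\<Sum>k<n. col V k \<bullet> (B *\<^sub>v col V k))"
proof -
  have "mtrace (V * V\<^sup>T * B) = mtrace (V * (V\<^sup>T * B))"
    using assms by (simp add: assoc_mult_mat[of _ n n _ n _ n])
  also have "\<dots> = mtrace (V\<^sup>T * (B * V))"
    using assms by (subst mtrace_comm[of _ n n]) (auto simp: assoc_mult_mat[of _ n n _ n _ n])
  also have "\<dots> = (\<Sum>k<n. col V k \<bullet> (B *\<^sub>v col V k))"
    unfolding mtrace_def using assms congr_index[OF assms]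
    by (auto simp del: index_mult_mat(1) intro!: sum.cong)
  finally show ?thesis .
qed

lemma mtrace_psd_nonneg:
  assumes "psd n S" "psd n B"
  shows "0 \<le> mtrace (S * B)"
proof -
  obtain V where V: "V \<in> carrier_mat n n" "S = V * V\<^sup>T"
    using psd_factorization[OF assms(1)] .
  show ?thesis
    unfolding V(2) mtrace_factor[OF V(1) psd_carrier[OF assms(2)]]
    using assms(2) V(1) by (intro sum_nonneg) (auto simp: psd_def)
qed

lemma psd_congr:
  assumes S: "psd n S" and A: "symm n A"
  shows "psd n (A * S * A)"
  unfolding psd_def
proof (intro conjI ballI)
  note c = psd_carrier[OF S] symm_carrier[OF A]
  show "symm n (A * S * A)" using symm_congr A psd_symm[OF S] by blast
  fix v :: "real vec" assume v: "v \<in> carrier_vec n"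
  have "v \<bullet> (A * S * A *\<^sub>v v) = v \<bullet> (A *\<^sub>v (S *\<^sub>v (A *\<^sub>v v)))"
    using c v by (simp add: assoc_mult_mat_vec[of _ n n _ n])
  also have "\<dots> = (S *\<^sub>v (A *\<^sub>v v)) \<bullet> (A *\<^sub>v v)"
    using c v by (intro symm_form_comm[OF A]) auto
  also have "\<dots> = (A *\<^sub>v v) \<bullet> (S *\<^sub>v (A *\<^sub>v v))"
    using c v by (intro comm_scalar_prod[of _ n]) auto
  also have "\<dots> \<ge> 0" using S c v by (simp add: psd_def)
  finally show "0 \<le> v \<bullet> (A * S * A *\<^sub>v v)" .
qed

section \<open>The local inner product of the log-determinant barrier\<close>

text \<open>If \<open>S\<close> is the inverse of a positive definite \<open>X\<close>, this is the
  second derivative of \<open>- ln det\<close> at \<open>X\<close> in the directions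
  \<open>A\<close> and \<open>B\<close>.\<close>

definition sform :: "real mat \<Rightarrow> real mat \<Rightarrow> real mat \<Rightarrow> real" where
  "sform S A B = mtrace (S * A * (S * B))"

lemma sform_comm:
  assumes "S \<in> carrier_mat n n" "A \<in> carrier_mat n n" "B \<in> carrier_mat n n"
  shows "sform S A B = sform S B A"
  unfolding sform_def using assms by (intro mtrace_comm[of _ n n]) auto

lemma sform_add_right:
  assumes "S \<in> carrier_mat n n" "A \<in> carrier_mat n n" "B \<in> carrier_mat n n" "C \<in> carrier_mat n n"
  shows "sform S A (B + C) = sform S A B + sform S A C"
  unfolding sform_def using assms
  by (simp add: mult_add_distrib_mat[of _ n n _ n] mtrace_add[of _ n] mult_carrier_mat[of _ n n])

lemma sform_diff_right:
  assumes "S \<in> carrier_mat n n" "A \<in> carrier_mat n n" "B \<in> carrier_mat n n" "C \<in> carrier_mat n n"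
  shows "sform S A (B - C) = sform S A B - sform S A C"
  unfolding sform_def using assms
  by (simp add: mult_minus_distrib_mat[of _ n n _ n] mtrace_diff[of _ n] minus_carrier_mat mult_carrier_mat[of _ n n])

lemma sform_smult_right:
  assumes "S \<in> carrier_mat n n" "A \<in> carrier_mat n n" "B \<in> carrier_mat n n"
  shows "sform S A (c \<cdot>\<^sub>m B) = c * sform S A B"
  unfolding sform_def using assms
  by (simp add: mult_smult_distrib[of _ n n _ n] mtrace_smult[of _ n] mult_carrier_mat[of _ n n])

lemmas sform_linear_right = sform_add_right sform_diff_right sform_smult_right

text \<open>\<open>S P S\<close> is again positive semidefinite, which leaves the trace of a product
  of two positive semidefinite matrices.\<close>

lemma sform_psd_nonneg:
  assumes S: "psd n S" and P: "psd n P" and Q: "psd n Q"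
  shows "0 \<le> sform S P Q"
proof -
  note c = psd_carrier[OF S] psd_carrier[OF P] psd_carrier[OF Q]
  have "sform S P Q = mtrace (S * P * S * Q)"
    unfolding sform_def using c by (simp add: assoc_mult_mat[of _ n n _ n _ n])
  thus ?thesis
    using mtrace_psd_nonneg[OF psd_congr[OF P psd_symm[OF S]] Q] by simp
qed

lemma sform_self_nonneg:
  assumes S: "psd n S" and A: "symm n A"
  shows "0 \<le> sform S A A"
proof -
  note c = psd_carrier[OF S] symm_carrier[OF A]
  have "sform S A A = mtrace (S * (A * S * A))"
    unfolding sform_def using c by (simp add: assoc_mult_mat[of _ n n _ n _ n])
  thus ?thesis
    using mtrace_psd_nonneg[OF S psd_congr[OF S A]] by simp
qed

lemma sform_cauchy_schwarz:
  assumes S: "psd n S" and A: "symm n A" and B: "symm n B"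
  shows "(sform S A B)\<^sup>2 \<le> sform S A A * sform S B B"
proof (rule discriminant_nonneg)
  fix s :: real
  note c = psd_carrier[OF S] symm_carrier[OF A] symm_carrier[OF B]
  let ?C = "A + s \<cdot>\<^sub>m B"
  have C: "?C \<in> carrier_mat n n" using c by simp
  have r: "sform S X ?C = sform S X A + s * sform S X B" if "X \<in> carrier_mat n n" for X
    using c that by (simp add: sform_linear_right[of _ n])
  have "0 \<le> sform S ?C ?C"
    by (intro sform_self_nonneg[OF S] symm_add symm_smult A B)
  also have "\<dots> = sform S A ?C + s * sform S B ?C"
    by (simp only: r[OF C] sform_comm[OF c(1) C c(2)] sform_comm[OF c(1) C c(3)])
  also have "\<dots> = sform S A A + 2 * s * sform S A B + s\<^sup>2 * sform S B B"
    unfolding r[OF c(2)] r[OF c(3)] sform_comm[OF c(1,3,2)]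
    by (simp add: power2_eq_square algebra_simps)
  finally show "0 \<le> sform S A A + 2 * s * sform S A B + s\<^sup>2 * sform S B B" .
qed

text \<open>With \<open>S = V V^T\<close> and \<open>W = V^T E V\<close>, the left side is the
  squared Frobenius norm of \<open>W\<close> and the right side the square of its trace.
  Cauchy-Schwarz for \<open>E\<close> bounds the squared entry at \<open>(k, l)\<close> by the
  product of the diagonal entries at \<open>k\<close> and \<open>l\<close>, so no eigenvalues
  enter.\<close>

lemma sform_le_trace_square:
  assumes S: "psd n S" and E: "psd n E"
  shows "sform S E E \<le> (mtrace (S * E))\<^sup>2"
proof -
  note c = psd_carrier[OF S] psd_carrier[OF E]
  obtain V where V: "V \<in> carrier_mat n n" "S = V * V\<^sup>T"
    using psd_factorization[OF S] .
  let ?v = "\<lambda>k. col V k"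
  let ?W = "V\<^sup>T * (E * V)"
  have W: "?W \<in> carrier_mat n n" using V c by simp
  have vk: "?v k \<in> carrier_vec n" for k using V by auto
  have "sform S E E = mtrace (V * (V\<^sup>T * (E * (V * (V\<^sup>T * E)))))"
    unfolding sform_def V(2) using V(1) c by (simp add: assoc_mult_mat[of _ n n _ n _ n])
  also have "\<dots> = mtrace (?W * ?W)"
    using V(1) c by (subst mtrace_comm[of _ n n]) (auto simp: assoc_mult_mat[of _ n n _ n _ n])
  also have "\<dots> = (\<Sum>k<n. \<Sum>l<n. ?W $$ (k, l) * ?W $$ (l, k))"
    unfolding mtrace_def using W
    by (auto simp del: index_mult_mat(1) simp: mult_mat_index[OF W W] intro!: sum.cong)
  also have "\<dots> = (\<Sum>k<n. \<Sum>l<n. (?v k \<bullet> (E *\<^sub>v ?v l))\<^sup>2)"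
    using congr_index[OF V(1) c(2)] symm_form_comm[OF psd_symm[OF E] vk vk]
    by (auto simp del: index_mult_mat(1) simp: power2_eq_square intro!: sum.cong)
  also have "\<dots> \<le> (\<Sum>k<n. \<Sum>l<n. (?v k \<bullet> (E *\<^sub>v ?v k)) * (?v l \<bullet> (E *\<^sub>v ?v l)))"
    by (intro sum_mono psd_cauchy_schwarz[OF E vk vk])
  also have "\<dots> = (mtrace (S * E))\<^sup>2"
    unfolding V(2) mtrace_factor[OF V(1) c(2)] by (simp add: sum_product power2_eq_square)
  finally show ?thesis .
qed

text \<open>From \<open>0 \<le> \<langle>kE - A, kE + A\<rangle>\<close>, the form being nonnegative on pairs of positive semidefinite
  matrices.\<close>

lemma sform_le_of_sandwich:
  assumes S: "psd n S" and E: "psd n E" and A: "symm n A"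
    and lo: "psd n (k \<cdot>\<^sub>m E - A)" and hi: "psd n (k \<cdot>\<^sub>m E + A)"
  shows "sform S A A \<le> (k * mtrace (S * E))\<^sup>2"
proof -
  note c = psd_carrier[OF S] psd_carrier[OF E] symm_carrier[OF A]
  let ?P = "k \<cdot>\<^sub>m E - A" and ?Q = "k \<cdot>\<^sub>m E + A"
  have PQ: "?P \<in> carrier_mat n n" "?Q \<in> carrier_mat n n" "k \<cdot>\<^sub>m E \<in> carrier_mat n n"
    using c by (auto simp: minus_carrier_mat)
  have Pr: "sform S X ?P = k * sform S X E - sform S X A" if "X \<in> carrier_mat n n" for X
    using c PQ that by (simp add: sform_linear_right[of _ n])
  have Qr: "sform S X ?Q = k * sform S X E + sform S X A" if "X \<in> carrier_mat n n" for X
    using c PQ that by (simp add: sform_linear_right[of _ n])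
  have "0 \<le> sform S ?P ?Q" by (rule sform_psd_nonneg[OF S lo hi])
  also have "\<dots> = k * sform S E ?P + sform S A ?P"
    by (simp only: Qr[OF PQ(1)] sform_comm[OF c(1) PQ(1) c(2)] sform_comm[OF c(1) PQ(1) c(3)])
  also have "\<dots> = k\<^sup>2 * sform S E E - sform S A A"
    unfolding Pr[OF c(2)] Pr[OF c(3)] sform_comm[OF c(1,3,2)]
    by (simp add: power2_eq_square algebra_simps)
  finally have "sform S A A \<le> k\<^sup>2 * sform S E E" by simp
  also have "\<dots> \<le> k\<^sup>2 * (mtrace (S * E))\<^sup>2"
    by (intro mult_left_mono sform_le_trace_square[OF S E]) simp
  finally show ?thesis by (simp add: power_mult_distrib)
qed

section \<open>Determinants and inverses of positive definite matrices\<close>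

lemma pd_det_nonzero:
  assumes "pd n A"
  shows "det A \<noteq> 0"
proof
  assume "det A = 0"
  then obtain v where v: "v \<in> carrier_vec n" "v \<noteq> 0\<^sub>v n" "A *\<^sub>v v = 0\<^sub>v n"
    using det_0_iff_vec_prod_zero_field[OF pd_carrier[OF assms]] by blast
  have "0 < v \<bullet> (A *\<^sub>v v)" using assms v(1,2) by (simp add: pd_def)
  thus False using v by simp
qed

text \<open>The parameter space is arbitrary because two kinds occur: real parameters of a line, and
  functions \<open>nat => real\<close> in the compactness argument.\<close>

lemma continuous_on_det:
  fixes A :: "'a::topological_space \<Rightarrow> real mat"
  assumes "\<And>x. A x \<in> carrier_mat n n"
    and "\<And>i j. i < n \<Longrightarrow> j < n \<Longrightarrow> continuous_on S (\<lambda>x. A x $$ (i, j))"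
  shows "continuous_on S (\<lambda>x. det (A x))"
proof -
  have "p i < n" if "p permutes {0..<n}" "i < n" for p i
    using permutes_in_image[OF that(1), of i] that(2) by simp
  thus ?thesis
    unfolding det_def'[OF assms(1)]
    by (intro continuous_on_sum continuous_on_mult continuous_on_const continuous_on_prod assms(2)) auto
qed

lemma scalar_prod_self_pos:
  fixes v :: "real vec"
  assumes "v \<in> carrier_vec n" "v \<noteq> 0\<^sub>v n"
  shows "0 < v \<bullet> v"
proof -
  obtain i where "i < n" "v $ i \<noteq> 0"
    using assms by (metis carrier_vecD eq_vecI index_zero_vec)
  thus ?thesis
    unfolding scalar_prod_def using assms(1)
    by (intro sum_pos2[of _ i]) (auto simp: zero_less_mult_iff)
qed

text \<open>The segment from the identity to \<open>A\<close> consists of positive definite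
  matrices, on which \<open>det\<close> has no zero; as \<open>det\<close> starts at 1, the
  intermediate value theorem excludes a nonpositive end value.\<close>

lemma pd_det_pos:
  assumes A: "pd n A"
  shows "det A > 0"
proof (rule ccontr)
  assume "\<not> det A > 0"
  hence neg: "det A \<le> 0" by simp
  note c = pd_carrier[OF A]
  define M where "M s = (1 - s) \<cdot>\<^sub>m 1\<^sub>m n + s \<cdot>\<^sub>m A" for s :: real
  have Mc: "M s \<in> carrier_mat n n" for s using c by (simp add: M_def)
  have cont: "continuous_on {0..1} (\<lambda>s. det (M s))"
    using c by (intro continuous_on_det[OF Mc]) (auto simp: M_def intro!: continuous_intros)
  have M0: "M 0 = 1\<^sub>m n" and M1: "M 1 = A"
    using c by (auto simp: M_def intro!: eq_matI)
  have "\<exists>s. 0 \<le> s \<and> s \<le> 1 \<and> det (M s) = 0"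
    by (rule IVT2') (use cont neg M0 M1 in auto)
  then obtain s where s: "0 \<le> s" "s \<le> 1" "det (M s) = 0" by blast
  have "pd n (M s)"
    unfolding pd_def
  proof (intro conjI ballI impI)
    show "symm n (M s)"
      using A unfolding M_def pd_def by (intro symm_add symm_smult) (auto simp: symm_def)
    fix v :: "real vec" assume v: "v \<in> carrier_vec n" "v \<noteq> 0\<^sub>v n"
    have eq: "v \<bullet> (M s *\<^sub>v v) = (1 - s) * (v \<bullet> v) + s * (v \<bullet> (A *\<^sub>v v))"
    proof -
      have "(a \<cdot>\<^sub>m B) *\<^sub>v v = a \<cdot>\<^sub>v (B *\<^sub>v v)" if "B \<in> carrier_mat n n" for a and B :: "real mat"
        using that v by (intro eq_vecI) auto
      thus ?thesis
        using c v unfolding M_def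
        by (simp add: add_mult_distrib_mat_vec[of _ n n] scalar_prod_add_distrib[of _ n])
    qed
    have 1: "0 < v \<bullet> (A *\<^sub>v v)" using A v by (simp add: pd_def)
    have 2: "0 < v \<bullet> v"
      by (rule scalar_prod_self_pos[OF v])
    show "0 < v \<bullet> (M s *\<^sub>v v)"
      unfolding eq using 1 2 s by (cases "s = 0") (auto intro: add_nonneg_pos)
  qed
  from pd_det_nonzero[OF this] s(3) show False by simp
qed

text \<open>Cauchy-Schwarz against unit vectors shows that an isotropic vector of a positive
  semidefinite matrix lies in its kernel. This is how a maximizer of \<open>det\<close> is
  recognized as an interior point.\<close>

lemma psd_det_nonzero_imp_pd:
  assumes A: "psd n A" and det: "det A \<noteq> 0"
  shows "pd n A"
  unfolding pd_def
proof (intro conjI ballI impI)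
  show "symm n A" using A by (rule psd_symm)
  note c = psd_carrier[OF A]
  fix v :: "real vec" assume v: "v \<in> carrier_vec n" "v \<noteq> 0\<^sub>v n"
  have "A *\<^sub>v v = 0\<^sub>v n" if z: "v \<bullet> (A *\<^sub>v v) = 0"
  proof (rule eq_vecI)
    fix i assume i: "i < dim_vec (0\<^sub>v n :: real vec)"
    have "(unit_vec n i \<bullet> (A *\<^sub>v v))\<^sup>2 \<le> (unit_vec n i \<bullet> (A *\<^sub>v unit_vec n i)) * (v \<bullet> (A *\<^sub>v v))"
      by (rule psd_cauchy_schwarz[OF A]) (use v in auto)
    thus "(A *\<^sub>v v) $ i = 0\<^sub>v n $ i" using z i c v by simp
  qed (use c in auto)
  hence "v \<bullet> (A *\<^sub>v v) \<noteq> 0"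
    using det det_0_iff_vec_prod_zero_field[OF c] v by blast
  thus "0 < v \<bullet> (A *\<^sub>v v)" using A v unfolding psd_def by (metis order.order_iff_strict)
qed

text \<open>The adjugate formula exhibits the entries as quotients of determinants, so their
  continuity along a line follows from \<open>continuous_on_det\<close>.\<close>

definition minv :: "real mat \<Rightarrow> real mat" where
  "minv A = (1 / det A) \<cdot>\<^sub>m adj_mat A"

lemma minv:
  assumes "A \<in> carrier_mat n n" "det A \<noteq> 0"
  shows "minv A \<in> carrier_mat n n" "minv A * A = 1\<^sub>m n" "A * minv A = 1\<^sub>m n"
  unfolding minv_def using adj_mat[OF assms(1)] assms
  by (auto intro!: eq_matI simp: mult_smult_assoc_mat[of _ n n _ n] mult_smult_distrib[of _ n n _ n])

lemma minv_unique:
  assumes A: "A \<in> carrier_mat n n" "S \<in> carrier_mat n n" "S * A = 1\<^sub>m n" and "det A \<noteq> 0"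
  shows "minv A = S"
proof -
  note m = minv[OF A(1) assms(4)]
  have "minv A = S * A * minv A" by (simp only: A(3) left_mult_one_mat[OF m(1)])
  also have "\<dots> = S * (A * minv A)" by (rule assoc_mult_mat[OF A(2,1) m(1)])
  also have "\<dots> = S" by (simp only: m(3) right_mult_one_mat[OF A(2)])
  finally show ?thesis .
qed

text \<open>The inverse is the congruence \<open>S Y S\<close> of \<open>Y\<close>, hence positive
  semidefinite as soon as it is symmetric.\<close>

lemma pd_inverse:
  assumes Y: "pd n Y"
  obtains S where "psd n S" "S * Y = 1\<^sub>m n" "Y * S = 1\<^sub>m n"
proof -
  note c = pd_carrier[OF Y]
  note m = minv[OF c pd_det_nonzero[OF Y]]
  let ?S = "minv Y"
  have Yt: "Y\<^sup>T = Y" using Y by (simp add: pd_def symm_def)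
  have "?S\<^sup>T = ?S\<^sup>T * (Y * ?S)" using m by simp
  also have "\<dots> = (Y * ?S)\<^sup>T * ?S"
    using m(1) c Yt by (simp add: transpose_mult[of _ n n _ n] assoc_mult_mat[of _ n n _ n _ n])
  also have "\<dots> = ?S" using m(1,3) by simp
  finally have sym: "symm n ?S" using m(1) by (simp add: symm_def)
  have "psd n (?S * Y * ?S)"
    by (rule psd_congr[OF pd_imp_psd[OF Y] sym])
  hence "psd n ?S" using m by simp
  with m(2,3) that show ?thesis by blast
qed

lemma psd_smult:
  assumes "psd n A" "c \<ge> 0"
  shows "psd n (c \<cdot>\<^sub>m A)"
  unfolding psd_def
proof (intro conjI ballI)
  show "symm n (c \<cdot>\<^sub>m A)" using assms by (intro symm_smult psd_symm)
  fix v :: "real vec" assume v: "v \<in> carrier_vec n"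
  have "(c \<cdot>\<^sub>m A) *\<^sub>v v = c \<cdot>\<^sub>v (A *\<^sub>v v)"
    using v psd_carrier[OF assms(1)] by (intro eq_vecI) auto
  thus "0 \<le> v \<bullet> (c \<cdot>\<^sub>m A *\<^sub>v v)"
    using assms v psd_carrier[OF assms(1)] by (auto simp: psd_def)
qed

section \<open>Quadratic forms controlled by the local norm\<close>

lemma sform_eq_mtrace:
  assumes "S \<in> carrier_mat n n" "A \<in> carrier_mat n n" "B \<in> carrier_mat n n"
  shows "sform S A B = mtrace (S * A * S * B)"
  unfolding sform_def using assms by (simp add: assoc_mult_mat[of _ n n _ n _ n] mult_carrier_mat[of _ n n])

lemma mtrace_mult_sum:
  assumes "A \<in> carrier_mat n n" "B \<in> carrier_mat n n"
  shows "mtrace (A * B) = (\<Sum>i<n. \<Sum>j<n. A $$ (i, j) * B $$ (j, i))"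
  unfolding mtrace_def using assms
  by (auto simp del: index_mult_mat(1) simp: mult_mat_index[OF assms] intro!: sum.cong)

lemma symm_outer: "v \<in> carrier_vec n \<Longrightarrow> symm n (outer v v)"
  by (rule symmI) (auto simp: outer_def)

lemma outer_mult_vec:
  assumes "q \<in> carrier_vec n" "p \<in> carrier_vec n"
  shows "outer q q *\<^sub>v p = (q \<bullet> p) \<cdot>\<^sub>v q"
  using assms by (intro eq_vecI) (auto simp: outer_def scalar_prod_def sum_distrib_left mult_ac)

lemma mtrace_mult_outer:
  assumes "M \<in> carrier_mat n n" "q \<in> carrier_vec n"
  shows "mtrace (M * outer q q) = q \<bullet> (M *\<^sub>v q)"
proof -
  have "outer q q \<in> carrier_mat n n" using assms by (auto simp: outer_def)
  from mtrace_mult_sum[OF assms(1) this] show ?thesis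
    unfolding quad_form_sum[OF assms assms(2)] using assms
    by (auto simp: outer_def mult_ac intro!: sum.cong)
qed

text \<open>Cauchy--Schwarz for the trace form, applied to \<open>A\<close> and \<open>(Y p) (Y p)\<^sup>T\<close>.\<close>

lemma quad_form_le_sform:
  assumes Y: "pd n Y" and S: "psd n S" "S * Y = 1\<^sub>m n" and A: "symm n A"
    and p: "p \<in> carrier_vec n"
  shows "(p \<bullet> (A *\<^sub>v p))\<^sup>2 \<le> sform S A A * (p \<bullet> (Y *\<^sub>v p))\<^sup>2"
proof -
  note c = pd_carrier[OF Y] psd_carrier[OF S(1)] symm_carrier[OF A]
  define q where "q = Y *\<^sub>v p"
  have q: "q \<in> carrier_vec n" using c p by (simp add: q_def)
  let ?B = "outer q q"
  have B: "?B \<in> carrier_mat n n" using q by (auto simp: outer_def)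
  have Sq: "S *\<^sub>v q = p"
    unfolding q_def using c p S(2) by (simp add: assoc_mult_mat_vec[of _ n n _ n, symmetric])
  \<comment> \<open>The choice \<open>q = Y p\<close> gives \<open>S q = p\<close>, so pairing with
    the rank-one matrix evaluates the quadratic form of \<open>C\<close> at \<open>p\<close>. With
    \<open>C\<close> that matrix itself, the value is the square of \<open>p . Y p\<close>.\<close>
  have form: "sform S C ?B = p \<bullet> (C *\<^sub>v p)" if C: "C \<in> carrier_mat n n" for C
  proof -
    have "sform S C ?B = q \<bullet> (S * C * S *\<^sub>v q)"
      unfolding sform_eq_mtrace[OF c(2) C B] using c C q
      by (intro mtrace_mult_outer) auto
    also have "S * C * S *\<^sub>v q = S *\<^sub>v (C *\<^sub>v p)"
      using c C q by (simp add: assoc_mult_mat_vec[of _ n n _ n] Sq)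
    also have "q \<bullet> (S *\<^sub>v (C *\<^sub>v p)) = (C *\<^sub>v p) \<bullet> (S *\<^sub>v q)"
      using C p by (intro symm_form_comm[OF psd_symm[OF S(1)] q]) auto
    also have "\<dots> = p \<bullet> (C *\<^sub>v p)"
      using C p by (simp add: Sq comm_scalar_prod[of _ n])
    finally show ?thesis .
  qed
  have "(sform S A ?B)\<^sup>2 \<le> sform S A A * sform S ?B ?B"
    by (rule sform_cauchy_schwarz[OF S(1) A symm_outer[OF q]])
  also have "sform S ?B ?B = (p \<bullet> (Y *\<^sub>v p))\<^sup>2"
    unfolding form[OF B] outer_mult_vec[OF q p] using p q
    by (simp add: power2_eq_square comm_scalar_prod[of q n p] q_def[symmetric])
  finally show ?thesis unfolding form[OF c(3)] .
qed

text \<open>The closed Dikin ellipsoid: local norm at most 1 means that the form of \<open>A\<close>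
  is dominated in absolute value by that of \<open>Y\<close> at every vector.
  \<open>pd_perturb\<close> is the open version.\<close>

lemma psd_perturb:
  assumes Y: "pd n Y" and S: "psd n S" "S * Y = 1\<^sub>m n" and A: "symm n A"
    and le: "sform S A A \<le> 1"
  shows "psd n (Y + A)"
  unfolding psd_def
proof (intro conjI ballI)
  note c = pd_carrier[OF Y] psd_carrier[OF S(1)] symm_carrier[OF A]
  show "symm n (Y + A)" using A Y by (auto intro!: symm_add simp: pd_def)
  fix p :: "real vec" assume p: "p \<in> carrier_vec n"
  have Yp: "0 \<le> p \<bullet> (Y *\<^sub>v p)" using pd_imp_psd[OF Y] p by (simp add: psd_def)
  have "(p \<bullet> (A *\<^sub>v p))\<^sup>2 \<le> sform S A A * (p \<bullet> (Y *\<^sub>v p))\<^sup>2"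
    by (rule quad_form_le_sform[OF Y S A p])
  also have "\<dots> \<le> 1 * (p \<bullet> (Y *\<^sub>v p))\<^sup>2"
    using le by (intro mult_right_mono) auto
  finally have "\<bar>p \<bullet> (A *\<^sub>v p)\<bar> \<le> p \<bullet> (Y *\<^sub>v p)"
    using Yp by (simp add: abs_le_square_iff[symmetric])
  thus "0 \<le> p \<bullet> ((Y + A) *\<^sub>v p)"
    using c p by (simp add: add_mult_distrib_mat_vec[of _ n n] scalar_prod_add_distrib[of _ n])
qed

lemma pd_perturb:
  assumes Y: "pd n Y" and S: "psd n S" "S * Y = 1\<^sub>m n" and A: "symm n A"
    and less: "sform S A A < 1"
  shows "pd n (Y + A)"
  unfolding pd_def
proof (intro conjI ballI impI)
  note c = pd_carrier[OF Y] psd_carrier[OF S(1)] symm_carrier[OF A]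
  show "symm n (Y + A)" using A Y by (auto intro!: symm_add simp: pd_def)
  fix p :: "real vec" assume p: "p \<in> carrier_vec n" "p \<noteq> 0\<^sub>v n"
  have Yp: "0 < p \<bullet> (Y *\<^sub>v p)" using Y p by (simp add: pd_def)
  have "(p \<bullet> (A *\<^sub>v p))\<^sup>2 \<le> sform S A A * (p \<bullet> (Y *\<^sub>v p))\<^sup>2"
    by (rule quad_form_le_sform[OF Y S A p(1)])
  also have "\<dots> < 1 * (p \<bullet> (Y *\<^sub>v p))\<^sup>2"
    using less Yp by (intro mult_strict_right_mono) auto
  finally have "\<bar>p \<bullet> (A *\<^sub>v p)\<bar> < p \<bullet> (Y *\<^sub>v p)"
    using Yp power_less_imp_less_base[of "\<bar>p \<bullet> (A *\<^sub>v p)\<bar>" 2 "p \<bullet> (Y *\<^sub>v p)"] by simp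
  thus "0 < p \<bullet> ((Y + A) *\<^sub>v p)"
    using c p by (simp add: add_mult_distrib_mat_vec[of _ n n] scalar_prod_add_distrib[of _ n])
qed

section \<open>Derivatives of determinant and inverse along a line\<close>

text \<open>In the Leibniz expansion a permutation other than the identity moves two different
  indices \<open>a\<close> and \<open>p a\<close>. The product rule removes only one factor, so a
  factor vanishing at 0 survives; the identity alone contributes, and it gives the trace.\<close>

lemma det_one_add_deriv:
  fixes M :: "real mat"
  assumes M: "M \<in> carrier_mat n n"
  shows "((\<lambda>s. det (1\<^sub>m n + s \<cdot>\<^sub>m M)) has_real_derivative mtrace M) (at 0)"
proof -
  let ?d = "\<lambda>p i. (if i = p i then 1 else 0) :: real"
  let ?P = "{p. p permutes {0..<n}}"
  let ?f = "\<lambda>p s. signof p * (\<Prod>i<n. ?d p i + s * M $$ (i, p i))"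
  have less: "p i < n" if "p permutes {0..<n}" "i < n" for p i
    using permutes_in_image[OF that(1), of i] that(2) by simp
  have det: "det (1\<^sub>m n + s \<cdot>\<^sub>m M) = (\<Sum>p\<in>?P. ?f p s)" for s
    using M less
    by (subst det_def'[of _ n]) (auto simp: atLeast0LessThan intro!: sum.cong prod.cong)
  have prod: "((\<lambda>s. \<Prod>i<n. ?d p i + s * M $$ (i, p i)) has_real_derivative
      (\<Sum>i<n. M $$ (i, p i) * (\<Prod>j\<in>{..<n} - {i}. ?d p j + 0 * M $$ (j, p j)))) (at 0)" for p
    by (rule has_field_derivative_prod) (auto intro!: derivative_eq_intros)
  have "((\<lambda>s. \<Sum>p\<in>?P. ?f p s) has_real_derivative
      (\<Sum>p\<in>?P. signof p * (\<Sum>i<n. M $$ (i, p i) * (\<Prod>j\<in>{..<n} - {i}. ?d p j)))) (at 0)"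
    using prod by (intro DERIV_sum DERIV_cmult) simp_all
  moreover have "(\<Sum>p\<in>?P. signof p * (\<Sum>i<n. M $$ (i, p i) * (\<Prod>j\<in>{..<n} - {i}. ?d p j)))
      = (\<Sum>p\<in>{id}. signof p * (\<Sum>i<n. M $$ (i, p i) * (\<Prod>j\<in>{..<n} - {i}. ?d p j)))"
  proof (rule sum.mono_neutral_right)
    show "finite ?P" by (simp add: finite_permutations)
    show "{id} \<subseteq> ?P" by (simp add: permutes_id)
    show "\<forall>p\<in>?P - {id}. signof p * (\<Sum>i<n. M $$ (i, p i) * (\<Prod>j\<in>{..<n} - {i}. ?d p j)) = 0"
    proof
      fix p assume "p \<in> ?P - {id}"
      hence p: "p permutes {0..<n}" and "p \<noteq> id" by auto
      then obtain a where a: "p a \<noteq> a" by (auto simp: fun_eq_iff)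
      have an: "a < n" using p a unfolding permutes_def by force
      have pa: "p (p a) \<noteq> p a" using permutes_inj[OF p] a by (auto dest: injD)
      have z: "(\<Prod>j\<in>{..<n} - {i}. ?d p j) = 0" if "i < n" for i
      proof (cases "i = a")
        case True
        thus ?thesis using a pa less[OF p an] by (intro prod_zero bexI[of _ "p a"]) auto
      next
        case False
        thus ?thesis using a an by (intro prod_zero bexI[of _ a]) auto
      qed
      have "(\<Sum>i<n. M $$ (i, p i) * (\<Prod>j\<in>{..<n} - {i}. ?d p j)) = 0"
        by (intro sum.neutral ballI) (simp only: z lessThan_iff mult_zero_right)
      thus "signof p * (\<Sum>i<n. M $$ (i, p i) * (\<Prod>j\<in>{..<n} - {i}. ?d p j)) = 0"
        by (simp only: mult_zero_right)
    qed
  qed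
  moreover have "\<dots> = mtrace M" using M by (auto simp: mtrace_def)
  ultimately show ?thesis unfolding det by simp
qed

lemma det_add_deriv:
  assumes X: "X \<in> carrier_mat n n" and E: "E \<in> carrier_mat n n" and S: "S \<in> carrier_mat n n"
    and XS: "X * S = 1\<^sub>m n"
  shows "((\<lambda>s. det (X + s \<cdot>\<^sub>m E)) has_real_derivative det X * mtrace (S * E)) (at 0)"
proof -
  have "det (X + s \<cdot>\<^sub>m E) = det X * det (1\<^sub>m n + s \<cdot>\<^sub>m (S * E))" for s
  proof -
    have "X * (s \<cdot>\<^sub>m (S * E)) = s \<cdot>\<^sub>m (X * S * E)"
      using X E S by (simp add: assoc_mult_mat[of _ n n _ n _ n] mult_smult_distrib[of _ n n _ n])
    hence "X + s \<cdot>\<^sub>m E = X * (1\<^sub>m n + s \<cdot>\<^sub>m (S * E))"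
      using X E S XS by (simp add: mult_add_distrib_mat[of _ n n _ n])
    thus ?thesis using X E S by (simp add: det_mult[of _ n])
  qed
  thus ?thesis
    using DERIV_cmult[OF det_one_add_deriv[of "S * E" n], of "det X"] E S by simp
qed

lemma isCont_minv:
  assumes X: "X \<in> carrier_mat n n" and E: "E \<in> carrier_mat n n" and "det X \<noteq> 0"
    and ij: "i < n" "j < n"
  shows "isCont (\<lambda>s. minv (X + s \<cdot>\<^sub>m E) $$ (i, j)) 0"
proof -
  have "continuous_on UNIV (\<lambda>s. det (X + s \<cdot>\<^sub>m E))"
    using X E by (intro continuous_on_det[of _ n]) (auto intro!: continuous_intros)
  hence 1: "isCont (\<lambda>s. det (X + s \<cdot>\<^sub>m E)) 0"
    by (simp add: continuous_on_eq_continuous_at)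
  have "continuous_on UNIV (\<lambda>s. det (mat_delete (X + s \<cdot>\<^sub>m E) j i))"
    using X E ij
    by (intro continuous_on_det[of _ "n - 1"]) (auto simp: mat_delete_def intro!: continuous_intros)
  hence 2: "isCont (\<lambda>s. det (mat_delete (X + s \<cdot>\<^sub>m E) j i)) 0"
    by (simp add: continuous_on_eq_continuous_at)
  have "X + 0 \<cdot>\<^sub>m E = X" using X E by (intro eq_matI) auto
  hence "isCont (\<lambda>s. 1 / det (X + s \<cdot>\<^sub>m E) * ((- 1) ^ (j + i) * det (mat_delete (X + s \<cdot>\<^sub>m E) j i))) 0"
    using assms by (intro isCont_mult isCont_divide continuous_const 1 2) auto
  moreover have "(\<lambda>s. 1 / det (X + s \<cdot>\<^sub>m E) * ((- 1) ^ (j + i) * det (mat_delete (X + s \<cdot>\<^sub>m E) j i)))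
      = (\<lambda>s. minv (X + s \<cdot>\<^sub>m E) $$ (i, j))"
    using X E ij by (auto simp: minv_def adj_mat_def cofactor_def)
  ultimately show ?thesis by simp
qed

lemma eventually_det_pos:
  fixes X E :: "real mat"
  assumes X: "X \<in> carrier_mat n n" and E: "E \<in> carrier_mat n n" and "det X > 0"
  shows "\<forall>\<^sub>F s in nhds 0. det (X + s \<cdot>\<^sub>m E) > 0"
proof -
  have "continuous_on UNIV (\<lambda>s. det (X + s \<cdot>\<^sub>m E))"
    using X E by (intro continuous_on_det[of _ n]) (auto intro!: continuous_intros)
  hence "isCont (\<lambda>s. det (X + s \<cdot>\<^sub>m E)) 0"
    by (simp add: continuous_on_eq_continuous_at)
  hence "((\<lambda>s. det (X + s \<cdot>\<^sub>m E)) \<longlongrightarrow> det (X + 0 \<cdot>\<^sub>m E)) (nhds 0)"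
    by (simp add: isCont_def tendsto_nhds_iff)
  moreover have "X + 0 \<cdot>\<^sub>m E = X" using X E by (intro eq_matI) auto
  ultimately show ?thesis using assms(3) by (auto elim: order_tendstoD)
qed

text \<open>By the resolvent identity \<open>S - M = s M E S\<close>, with \<open>M\<close> the
  inverse at parameter \<open>s\<close>, the difference quotient equals
  \<open>- tr (M E S F)\<close> exactly. Continuity of the inverse at 0 therefore suffices to
  compute the derivative.\<close>

lemma mtrace_minv_deriv:
  assumes X: "X \<in> carrier_mat n n" and E: "E \<in> carrier_mat n n" and F: "F \<in> carrier_mat n n"
    and S: "S \<in> carrier_mat n n" "S * X = 1\<^sub>m n" "X * S = 1\<^sub>m n" and det: "det X > 0"
  shows "((\<lambda>s. mtrace (minv (X + s \<cdot>\<^sub>m E) * F)) has_real_derivative - sform S E F) (at 0)"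
proof -
  let ?Z = "\<lambda>s. X + s \<cdot>\<^sub>m E"
  have Z: "?Z s \<in> carrier_mat n n" for s using X E by simp
  have Z0: "?Z 0 = X" using X E by (intro eq_matI) auto
  have mX: "minv X = S" using minv_unique[OF X S(1,2)] det by simp
  define C where "C = E * S * F"
  have C: "C \<in> carrier_mat n n" using E S F by (simp add: C_def)
  let ?g = "\<lambda>s. \<Sum>i<n. \<Sum>j<n. minv (?Z s) $$ (i, j) * C $$ (j, i)"
  have cont: "isCont ?g 0"
    using X E det by (intro continuous_intros isCont_minv[of _ n]) auto
  have quot: "(mtrace (minv (?Z s) * F) - mtrace (minv (?Z 0) * F)) / (s - 0) = - ?g s"
    if pos: "det (?Z s) > 0" and s: "s \<noteq> 0" for s
  proof -
    have "det (?Z s) \<noteq> 0" using pos by simp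
    note m = minv[OF Z this]
    let ?M = "minv (?Z s)"
    have 1: "?M * ?Z s * S = ?M * X * S + s \<cdot>\<^sub>m (?M * E * S)"
    proof -
      have "?M * ?Z s = ?M * X + s \<cdot>\<^sub>m (?M * E)"
        using m(1) X E by (simp add: mult_add_distrib_mat[of _ n n _ n] mult_smult_distrib[of _ n n _ n])
      thus ?thesis
        using m(1) X E S(1) by (simp add: add_mult_distrib_mat[of _ n n _ _ n] mult_smult_assoc_mat[of _ n n _ n])
    qed
    have "?M * X * S = ?M"
      using m(1) X S by (simp add: assoc_mult_mat[of _ n n _ n _ n])
    hence SM: "S = ?M + s \<cdot>\<^sub>m (?M * E * S)" using 1 m S(1) by simp
    have "S * F = ?M * F + s \<cdot>\<^sub>m (?M * E * S) * F"
      by (subst SM) (use m(1) E F S(1) in \<open>simp add: add_mult_distrib_mat[of _ n n _ _ n]\<close>)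
    also have "s \<cdot>\<^sub>m (?M * E * S) * F = s \<cdot>\<^sub>m (?M * C)"
      using m(1) E F S(1) unfolding C_def
      by (simp add: mult_smult_assoc_mat[of _ n n _ n] assoc_mult_mat[of _ n n _ n _ n] mult_carrier_mat[of _ n n])
    finally have "mtrace (S * F) = mtrace (?M * F) + s * mtrace (?M * C)"
      using m(1) E F S(1) C by (simp add: mtrace_add[of _ n] mtrace_smult[of _ n] mult_carrier_mat[of _ n n])
    thus ?thesis
      using s unfolding Z0 mX mtrace_mult_sum[OF m(1) C] by (simp add: field_simps)
  qed
  have "\<forall>\<^sub>F s in at 0. det (?Z s) > 0"
    using eventually_det_pos[OF X E det] by (simp add: eventually_nhds_conv_at)
  moreover have "\<forall>\<^sub>F s in at 0. s \<noteq> (0::real)"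
    by (simp add: eventually_at_filter)
  ultimately have ev: "\<forall>\<^sub>F s in at 0. - ?g s =
      (mtrace (minv (?Z s) * F) - mtrace (minv (?Z 0) * F)) / (s - 0)"
    by eventually_elim (rule quot[symmetric])
  have "((\<lambda>s. - ?g s) \<longlongrightarrow> - ?g 0) (at 0)"
    using cont by (intro tendsto_minus) (simp add: isCont_def)
  hence "((\<lambda>s. (mtrace (minv (?Z s) * F) - mtrace (minv (?Z 0) * F)) / (s - 0)) \<longlongrightarrow> - ?g 0) (at 0)"
    by (rule Lim_transform_eventually) (rule ev)
  moreover have "sform S E F = mtrace (S * C)"
    unfolding sform_def C_def using E F S(1)
    by (simp add: assoc_mult_mat[of _ n n _ n _ n] mult_carrier_mat[of _ n n])
  hence "?g 0 = sform S E F"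
    unfolding Z0 mX mtrace_mult_sum[OF S(1) C] by simp
  ultimately show ?thesis by (simp add: has_field_derivative_iff)
qed

section \<open>The log-determinant barrier of a linear matrix map\<close>

text \<open>The certificate argument uses of the operator only that it is linear with symmetric
  values; polynomials return with \<open>wsos_bases\<close>. The matrices \<open>G l\<close> are the
  images of the unit vectors.\<close>

locale sym_pencil =
  fixes N m :: nat and G :: "nat \<Rightarrow> real mat"
  assumes symm_G: "l < N \<Longrightarrow> symm m (G l)"
begin

definition L :: "real vec \<Rightarrow> real mat" where
  "L x = mat m m (\<lambda>(i, j). \<Sum>l<N. G l $$ (i, j) * x $ l)"

lemma L_carrier [simp]: "L x \<in> carrier_mat m m"
  by (simp add: L_def)

lemma L_index: "i < m \<Longrightarrow> j < m \<Longrightarrow> L x $$ (i, j) = (\<Sum>l<N. G l $$ (i, j) * x $ l)"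
  by (simp add: L_def)

lemma L_symm [simp]: "symm m (L x)"
proof (rule symmI)
  fix i j assume "i < m" "j < m"
  thus "L x $$ (i, j) = L x $$ (j, i)"
    using symm_index[OF symm_G] by (auto simp: L_index intro!: sum.cong)
qed simp

lemma L_dims [simp]: "dim_row (L x) = m" "dim_col (L x) = m"
  by (simp_all add: L_def)

lemma G_carrier: "l < N \<Longrightarrow> G l \<in> carrier_mat m m"
  by (rule symm_carrier[OF symm_G])

lemma L_add: "x \<in> carrier_vec N \<Longrightarrow> y \<in> carrier_vec N \<Longrightarrow> L (x + y) = L x + L y"
  by (rule eq_matI) (auto simp: L_index algebra_simps sum.distrib[symmetric] intro!: sum.cong)

lemma L_diff: "x \<in> carrier_vec N \<Longrightarrow> y \<in> carrier_vec N \<Longrightarrow> L (x - y) = L x - L y"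
  by (rule eq_matI) (auto simp: L_index algebra_simps sum_subtractf[symmetric] intro!: sum.cong)

lemma L_smult: "x \<in> carrier_vec N \<Longrightarrow> L (c \<cdot>\<^sub>v x) = c \<cdot>\<^sub>m L x"
  by (rule eq_matI) (auto simp: L_index sum_distrib_left intro!: sum.cong)

lemma L_unit: "l < N \<Longrightarrow> L (unit_vec N l) = G l"
proof (rule eq_matI)
  fix i j assume l: "l < N" and "i < dim_row (G l)" "j < dim_col (G l)"
  hence ij: "i < m" "j < m" using G_carrier by auto
  have "(\<Sum>k<N. G k $$ (i, j) * unit_vec N l $ k) = (\<Sum>k<N. if k = l then G k $$ (i, j) else 0)"
    by (intro sum.cong) (auto simp: unit_vec_def)
  thus "L (unit_vec N l) $$ (i, j) = G l $$ (i, j)" using l ij by (simp add: L_index)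
qed (use G_carrier in auto)

lemma mtrace_mult_L:
  assumes A: "A \<in> carrier_mat m m"
  shows "mtrace (A * L v) = (\<Sum>l<N. v $ l * mtrace (A * G l))"
proof -
  have "mtrace (A * L v) = (\<Sum>i<m. \<Sum>j<m. \<Sum>l<N. v $ l * (A $$ (i, j) * G l $$ (j, i)))"
    unfolding mtrace_mult_sum[OF A L_carrier]
    by (intro sum.cong refl) (simp add: L_index sum_distrib_left mult_ac)
  also have "\<dots> = (\<Sum>l<N. \<Sum>i<m. \<Sum>j<m. v $ l * (A $$ (i, j) * G l $$ (j, i)))"
    by (subst sum.swap[of _ "{..<N}"], subst sum.swap) simp
  also have "\<dots> = (\<Sum>l<N. v $ l * mtrace (A * G l))"
    by (intro sum.cong refl) (simp add: mtrace_mult_sum[OF A G_carrier] sum_distrib_left)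
  finally show ?thesis .
qed

lemma sform_L:
  assumes "S \<in> carrier_mat m m" "A \<in> carrier_mat m m"
  shows "sform S A (L v) = (\<Sum>l<N. v $ l * sform S A (G l))"
  using assms mtrace_mult_L[of "S * A * S" v]
  by (simp add: sform_eq_mtrace[of _ m] G_carrier)

definition hess :: "real mat \<Rightarrow> real mat" where
  "hess S = mat N N (\<lambda>(i, j). sform S (G i) (G j))"

lemma hess_mult_vec:
  assumes "S \<in> carrier_mat m m" "v \<in> carrier_vec N" "i < N"
  shows "(hess S *\<^sub>v v) $ i = sform S (G i) (L v)"
  using assms
  by (simp add: hess_def sform_L G_carrier scalar_prod_def atLeast0LessThan mult_ac)

lemma hess_quad_form:
  assumes "S \<in> carrier_mat m m" "v \<in> carrier_vec N"
  shows "v \<bullet> (hess S *\<^sub>v v) = sform S (L v) (L v)"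
proof -
  have "v \<bullet> (hess S *\<^sub>v v) = (\<Sum>l<N. v $ l * sform S (L v) (G l))"
    using assms hess_mult_vec[OF assms] sform_comm[OF assms(1) L_carrier G_carrier]
    by (auto simp: scalar_prod_def atLeast0LessThan hess_def simp del: index_mult_mat_vec intro!: sum.cong)
  thus ?thesis using sform_L[OF assms(1) L_carrier] by simp
qed

text \<open>A property of a function rather than a function, since the barrier of the statement is
  prescribed only through \<open>Lambda\<close>, which agrees with \<open>L\<close> on the
  carrier.\<close>

definition neg_log_det :: "(real vec \<Rightarrow> real) \<Rightarrow> bool" where
  "neg_log_det f \<longleftrightarrow> (\<forall>x\<in>carrier_vec N. f x = - ln (det (L x)))"

lemma L_line: "x \<in> carrier_vec N \<Longrightarrow> i < N \<Longrightarrow> L (x + s \<cdot>\<^sub>v unit_vec N i) = L x + s \<cdot>\<^sub>m G i"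
  by (simp add: L_add L_smult L_unit)

lemma partial_deriv_neg_log_det:
  assumes f: "neg_log_det f" and x: "x \<in> carrier_vec N" and i: "i < N" and pos: "det (L x) > 0"
  shows "partial_deriv N f i x = - mtrace (minv (L x) * G i)"
proof -
  have "det (L x) \<noteq> 0" using pos by simp
  note m = minv[OF L_carrier this]
  have zero: "L x + 0 \<cdot>\<^sub>m G i = L x" using G_carrier[OF i] by (intro eq_matI) auto
  have "((\<lambda>s. ln (det (L x + s \<cdot>\<^sub>m G i))) has_real_derivative
      1 / det (L x + 0 \<cdot>\<^sub>m G i) * (det (L x) * mtrace (minv (L x) * G i))) (at 0)"
  proof (rule DERIV_chain2[where f = ln])
    show "(ln has_real_derivative 1 / det (L x + 0 \<cdot>\<^sub>m G i)) (at (det (L x + 0 \<cdot>\<^sub>m G i)))"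
      unfolding zero using pos by (rule DERIV_ln_divide)
  qed (rule det_add_deriv[OF L_carrier G_carrier[OF i] m(1,3)])
  from DERIV_minus[OF this]
  have "((\<lambda>s. - ln (det (L x + s \<cdot>\<^sub>m G i))) has_real_derivative
      - (1 / det (L x + 0 \<cdot>\<^sub>m G i) * (det (L x) * mtrace (minv (L x) * G i)))) (at 0)" .
  hence "((\<lambda>s. f (x + s \<cdot>\<^sub>v unit_vec N i)) has_real_derivative - mtrace (minv (L x) * G i)) (at 0)"
    using f x i pos by (simp add: neg_log_det_def L_line zero)
  thus ?thesis unfolding partial_deriv_def by (rule DERIV_imp_deriv)
qed

text \<open>The entries are iterated values of \<open>deriv\<close>, so the gradient formula must
  hold on a neighbourhood of the point on each coordinate line. It does, because the determinant
  stays positive near \<open>x\<close>.\<close>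

lemma hessian_neg_log_det:
  assumes f: "neg_log_det f" and x: "x \<in> carrier_vec N" and pos: "det (L x) > 0"
    and S: "S \<in> carrier_mat m m" "S * L x = 1\<^sub>m m" "L x * S = 1\<^sub>m m"
  shows "hessian N f x = hess S"
proof (rule eq_matI)
  fix i j assume "i < dim_row (hess S)" "j < dim_col (hess S)"
  hence ij: "i < N" "j < N" by (simp_all add: hess_def)
  have "\<forall>\<^sub>F s in nhds 0. - mtrace (minv (L x + s \<cdot>\<^sub>m G i) * G j)
      = partial_deriv N f j (x + s \<cdot>\<^sub>v unit_vec N i)"
    using eventually_det_pos[OF L_carrier G_carrier[OF ij(1)] pos]
  proof eventually_elim
    case (elim s)
    thus ?case
      using partial_deriv_neg_log_det[OF f _ ij(2), of "x + s \<cdot>\<^sub>v unit_vec N i"] x ij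
      by (simp add: L_line)
  qed
  moreover have "((\<lambda>s. - mtrace (minv (L x + s \<cdot>\<^sub>m G i) * G j)) has_real_derivative
      - (- sform S (G i) (G j))) (at 0)"
    by (intro DERIV_minus mtrace_minv_deriv[OF L_carrier G_carrier G_carrier S pos] ij)
  ultimately have "((\<lambda>s. partial_deriv N f j (x + s \<cdot>\<^sub>v unit_vec N i)) has_real_derivative
      sform S (G i) (G j)) (at 0)"
    using DERIV_cong_ev[OF refl, of "\<lambda>s. - mtrace (minv (L x + s \<cdot>\<^sub>m G i) * G j)"
      "\<lambda>s. partial_deriv N f j (x + s \<cdot>\<^sub>v unit_vec N i)" 0] by simp
  hence "partial_deriv N (partial_deriv N f j) i x = sform S (G i) (G j)"
    unfolding partial_deriv_def[of N "partial_deriv N f j"] by (rule DERIV_imp_deriv)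
  thus "hessian N f x $$ (i, j) = hess S $$ (i, j)"
    using ij by (simp add: hessian_def hess_def)
qed (simp_all add: hessian_def hess_def)

text \<open>Passes from the local norm to the Euclidean metric of \<open>vec_topology\<close>: the
  squared local norm is at most \<open>h r^2\<close>. The \<open>+ 1\<close> in the radius covers
  \<open>h = 0\<close> and makes both \<open>r\<close> and \<open>r h\<close> at most 1.\<close>

lemma pd_neighbourhood:
  assumes y: "y \<in> carrier_vec N" and Y: "pd m (L y)"
  shows "\<exists>r>0. \<forall>x\<in>carrier_vec N. vec_dist N y x < r \<longrightarrow> psd m (L x)"
proof -
  obtain S where S: "psd m S" "S * L y = 1\<^sub>m m" "L y * S = 1\<^sub>m m" using pd_inverse[OF Y] .
  define h where "h = (\<Sum>i<N. \<Sum>j<N. \<bar>hess S $$ (i, j)\<bar>)"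
  have h: "h \<ge> 0" unfolding h_def by (intro sum_nonneg) auto
  show ?thesis
  proof (intro exI[of _ "1 / (h + 1)"] conjI ballI impI)
    show "0 < 1 / (h + 1)" using h by simp
    fix x assume x: "x \<in> carrier_vec N" and d: "vec_dist N y x < 1 / (h + 1)"
    let ?u = "x - y"
    define r where "r = vec_dist N y x"
    have u: "?u \<in> carrier_vec N" using x y by simp
    have r0: "r \<ge> 0" by (simp add: r_def vec_dist_def)
    have ui: "\<bar>?u $ i\<bar> \<le> r" if "i < N" for i
    proof -
      have "r = L2_set (\<lambda>i. \<bar>x $ i - y $ i\<bar>) {..<N}"
        by (simp add: r_def vec_dist_def L2_set_def power2_commute[of "y $ _"])
      thus ?thesis
        using member_le_L2_set[of "{..<N}" i "\<lambda>i. \<bar>x $ i - y $ i\<bar>"] that x y by simp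
    qed
    have "sform S (L ?u) (L ?u) = (\<Sum>i<N. \<Sum>j<N. ?u $ i * ?u $ j * hess S $$ (i, j))"
      using hess_quad_form[OF psd_carrier[OF S(1)] u] quad_form_sum[OF _ u u, of "hess S"]
      by (simp add: hess_def)
    also have "\<dots> \<le> (\<Sum>i<N. \<Sum>j<N. r * r * \<bar>hess S $$ (i, j)\<bar>)"
    proof (intro sum_mono)
      fix i j assume "i \<in> {..<N}" "j \<in> {..<N}"
      hence "\<bar>?u $ i\<bar> * \<bar>?u $ j\<bar> \<le> r * r" using ui r0 by (intro mult_mono) auto
      hence "\<bar>?u $ i\<bar> * \<bar>?u $ j\<bar> * \<bar>hess S $$ (i, j)\<bar> \<le> r * r * \<bar>hess S $$ (i, j)\<bar>"
        by (rule mult_right_mono) simp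
      thus "?u $ i * ?u $ j * hess S $$ (i, j) \<le> r * r * \<bar>hess S $$ (i, j)\<bar>"
        using abs_ge_self[of "?u $ i * ?u $ j * hess S $$ (i, j)"] unfolding abs_mult by (rule order_trans[rotated])
    qed
    also have "\<dots> = r * (r * h)" by (simp add: h_def sum_distrib_left mult_ac)
    also have "\<dots> \<le> 1 * 1"
    proof (intro mult_mono)
      have "r * (h + 1) < 1" using d h by (simp add: r_def field_simps)
      thus "r * h \<le> 1" "r \<le> 1"
        using r0 mult_nonneg_nonneg[OF r0 h] unfolding distrib_left mult_1_right by linarith+
      show "0 \<le> r * h" using r0 h by simp
    qed simp
    finally have le: "sform S (L ?u) (L ?u) \<le> 1" by simp
    have "psd m (L y + L ?u)" by (rule psd_perturb[OF Y S(1,2) L_symm le])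
    moreover have "L y + L ?u = L x"
    proof -
      have "y + ?u = x" using x y by (intro eq_vecI) auto
      thus ?thesis using L_add[OF y u] by simp
    qed
    ultimately show "psd m (L x)" by simp
  qed
qed

text \<open>A kernel vector \<open>v\<close> has local length 0, so the quadratic form of
  \<open>L v\<close> vanishes identically and both \<open>L v\<close> and \<open>- L v\<close> are
  positive semidefinite. Injectivity of \<open>L\<close> is asked for in the form of pointedness,
  which is what a bound on the coordinates delivers.\<close>

lemma hess_invertible:
  assumes pointed: "\<And>v. v \<in> carrier_vec N \<Longrightarrow> psd m (L v) \<Longrightarrow> psd m (- L v) \<Longrightarrow> v = 0\<^sub>v N"
    and Y: "pd m Y" and S: "psd m S" "S * Y = 1\<^sub>m m"
  shows "\<exists>B\<in>carrier_mat N N. inverts_mat (hess S) B \<and> inverts_mat B (hess S)"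
proof -
  have c: "hess S \<in> carrier_mat N N" by (simp add: hess_def)
  have "det (hess S) \<noteq> 0"
  proof
    assume "det (hess S) = 0"
    then obtain v where v: "v \<in> carrier_vec N" "v \<noteq> 0\<^sub>v N" "hess S *\<^sub>v v = 0\<^sub>v N"
      using det_0_iff_vec_prod_zero_field[OF c] by blast
    have "sform S (L v) (L v) = 0"
      using hess_quad_form[OF psd_carrier[OF S(1)] v(1)] v by simp
    hence zero: "p \<bullet> (L v *\<^sub>v p) = 0" if "p \<in> carrier_vec m" for p
      using quad_form_le_sform[OF Y S L_symm that, of v] by simp
    have "psd m (L v)" using zero by (simp add: psd_def)
    moreover have "psd m (- L v)"
      unfolding psd_def
    proof (intro conjI ballI)
      have "- L v = (-1) \<cdot>\<^sub>m L v" by (intro eq_matI) auto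
      thus "symm m (- L v)" using symm_smult[OF L_symm, of "-1" v] by simp
      fix p :: "real vec" assume p: "p \<in> carrier_vec m"
      have "(- L v) *\<^sub>v p = - (L v *\<^sub>v p)" using p by (intro eq_vecI) auto
      thus "0 \<le> p \<bullet> (- L v *\<^sub>v p)" using zero[OF p] p by simp
    qed
    ultimately show False using pointed v by blast
  qed
  from minv[OF c this] show ?thesis
    by (intro bexI[of _ "minv (hess S)"]) (auto simp: inverts_mat_def hess_def)
qed

text \<open>With \<open>w = \<tau>z - y\<close> one has \<open>\<langle>L v, L w\<rangle> = tr ((X\<^sup>-\<^sup>1 - Y\<^sup>-\<^sup>1) L v)\<close> in the trace form at \<open>Y = L y\<close>, and
  Cauchy--Schwarz bounds the local norm of \<open>w\<close> at \<open>y\<close> by that of \<open>y - x\<close> at \<open>x\<close>.\<close>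

lemma psd_of_newton_step:
  assumes y: "y \<in> carrier_vec N" and z: "z \<in> carrier_vec N" and E: "symm m E"
    and X: "pd m X" and S0: "psd m S0" "S0 * X = 1\<^sub>m m"
    and Ly: "L y = X + E" and less: "sform S0 E E < 1"
    and Y: "pd m (L y)" and S: "psd m S" "S * L y = 1\<^sub>m m" "L y * S = 1\<^sub>m m"
    and \<tau>: "\<tau> > 0" and grad: "\<And>i. i < N \<Longrightarrow> mtrace (S0 * G i) = \<tau> * t $ i"
    and Hz: "\<And>i. i < N \<Longrightarrow> sform S (G i) (L z) = t $ i"
  shows "psd m (L z)"
proof -
  note c = pd_carrier[OF X] psd_carrier[OF S0(1)] psd_carrier[OF S(1)] symm_carrier[OF E]
  define w where "w = \<tau> \<cdot>\<^sub>v z - y"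
  have w: "w \<in> carrier_vec N" using y z by (simp add: w_def)
  have Lw: "L w = \<tau> \<cdot>\<^sub>m L z - L y" using y z by (simp add: w_def L_diff L_smult)
  \<comment> \<open>The Hessian at \<open>y\<close> maps \<open>y\<close> to the vector of traces
    \<open>tr (S G i)\<close>, because \<open>S\<close> inverts \<open>L y\<close>, and maps
    \<open>\<tau> z\<close> to \<open>\<tau> t\<close>, which is the vector of traces at
    \<open>S0\<close>.\<close>
  have wi: "sform S (G i) (L w) = mtrace (S0 * G i) - mtrace (S * G i)" if i: "i < N" for i
  proof -
    note g = G_carrier[OF i]
    have "sform S (G i) (L y) = mtrace (S * G i)"
      unfolding sform_def using S c g by (simp add: mult_carrier_mat[of _ m m])
    thus ?thesis
      unfolding Lw using c g Hz[OF i] grad[OF i]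
      by (simp add: sform_linear_right[of _ m])
  qed
  have self: "sform S (L w) (L w) = mtrace (S0 * L w) - mtrace (S * L w)"
  proof -
    have "sform S (L w) (L w) = (\<Sum>l<N. w $ l * sform S (G l) (L w))"
      unfolding sform_L[OF c(3) L_carrier, of w w]
      by (intro sum.cong refl) (simp add: sform_comm[OF c(3) L_carrier G_carrier])
    also have "\<dots> = mtrace (S0 * L w) - mtrace (S * L w)"
      unfolding mtrace_mult_L[OF c(2)] mtrace_mult_L[OF c(3)]
      by (simp add: wi algebra_simps sum_subtractf)
    finally show ?thesis .
  qed
  \<comment> \<open>Chosen so that \<open>S B S = S0 - S\<close>: pairing with \<open>B\<close> at
    \<open>S\<close> yields the difference of the two gradients, and \<open>S B = S0 E\<close>
    identifies the length of \<open>B\<close> at \<open>S\<close> with that of \<open>E\<close> at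
    \<open>S0\<close>.\<close>
  define B where "B = L y * S0 * L y - L y"
  have sy: "symm m B"
    unfolding B_def by (intro symm_diff symm_congr psd_symm[OF S0(1)]) simp_all
  note Bc = symm_carrier[OF sy]
  have S0Y: "S0 * L y = 1\<^sub>m m + S0 * E"
    unfolding Ly using c S0(2) by (simp add: mult_add_distrib_mat[of _ m m _ m])
  have SB: "S * B = S0 * E"
  proof -
    have "S * B = S * (L y * S0 * L y) - S * L y"
      unfolding B_def using c by (simp add: mult_minus_distrib_mat[of _ m m _ m] mult_carrier_mat[of _ m m])
    also have "S * (L y * S0 * L y) = S * L y * S0 * L y"
      using c by (simp add: assoc_mult_mat[of _ m m _ m _ m] mult_carrier_mat[of _ m m])
    also have "\<dots> - S * L y = S0 * L y - 1\<^sub>m m"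
      unfolding S(2) using c by simp
    also have "\<dots> = S0 * E"
      unfolding S0Y using c by (intro eq_matI) auto
    finally show ?thesis .
  qed
  have BB: "sform S B B = sform S0 E E"
    unfolding sform_def SB by simp
  have wB: "sform S (L w) B = sform S (L w) (L w)"
  proof -
    have E0: "S0 * E = S0 * L y - 1\<^sub>m m"
      unfolding S0Y using c by (intro eq_matI) auto
    have "sform S (L w) B = mtrace (S * L w * (S0 * L y) - S * L w)"
      unfolding sform_def SB E0 using c
      by (simp add: mult_minus_distrib_mat[of _ m m _ m] mult_carrier_mat[of _ m m])
    also have "\<dots> = mtrace (S * L w * (S0 * L y)) - mtrace (S * L w)"
      using c by (simp add: mtrace_diff[of _ m] mult_carrier_mat[of _ m m])
    also have "mtrace (S * L w * (S0 * L y)) = mtrace (S0 * L y * (S * L w))"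
      using c by (intro mtrace_comm[of _ m m]) auto
    also have "S0 * L y * (S * L w) = S0 * (L y * S) * L w"
      using c by (simp add: assoc_mult_mat[of _ m m _ m _ m] mult_carrier_mat[of _ m m])
    also have "\<dots> = S0 * L w" using S(3) c by simp
    finally show ?thesis unfolding self .
  qed
  have n0: "0 \<le> sform S (L w) (L w)" by (rule sform_self_nonneg[OF S(1) L_symm])
  \<comment> \<open>Cancelling one factor leaves the squared local norm of \<open>w\<close> at
    \<open>y\<close> below that of \<open>E\<close> at \<open>X\<close>. Then
    \<open>y + w = \<tau> z\<close> lies in the Dikin ellipsoid of \<open>y\<close>.\<close>
  have "(sform S (L w) (L w))\<^sup>2 \<le> sform S (L w) (L w) * sform S0 E E"
    using sform_cauchy_schwarz[OF S(1) L_symm sy, of w] unfolding wB BB .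
  hence "sform S (L w) (L w) \<le> 1"
    using n0 less by (cases "sform S (L w) (L w) = 0") (auto simp: power2_eq_square)
  hence "psd m (L y + L w)" by (intro psd_perturb[OF Y S(1,2) L_symm])
  moreover have "L y + L w = \<tau> \<cdot>\<^sub>m L z" unfolding Lw by (intro eq_matI) auto
  ultimately have p: "psd m (\<tau> \<cdot>\<^sub>m L z)" by simp
  show ?thesis
    unfolding psd_def
  proof (intro conjI ballI)
    fix v :: "real vec" assume v: "v \<in> carrier_vec m"
    have "(\<tau> \<cdot>\<^sub>m L z) *\<^sub>v v = \<tau> \<cdot>\<^sub>v (L z *\<^sub>v v)" using v by (intro eq_vecI) auto
    hence "0 \<le> \<tau> * (v \<bullet> (L z *\<^sub>v v))" using p v by (auto simp: psd_def)
    thus "0 \<le> v \<bullet> (L z *\<^sub>v v)" using \<tau> by (simp add: zero_le_mult_iff)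
  qed simp
qed

section \<open>The determinant maximizer and its rounding\<close>

lemma continuous_on_L_vec:
  assumes "i < m" "j < m"
  shows "continuous_on UNIV (\<lambda>f. L (vec N f) $$ (i, j))"
  using assms
  by (auto simp: L_index intro!: continuous_intros)

lemma closed_psd_L: "closed {f. psd m (L (vec N f))}"
proof -
  have eq: "{f. psd m (L (vec N f))} = (\<Inter>v\<in>carrier_vec m.
      {f. 0 \<le> (\<Sum>i<m. \<Sum>j<m. v $ i * v $ j * L (vec N f) $$ (i, j))})"
    by (auto simp: psd_def quad_form_sum[OF L_carrier])
  show ?thesis
    unfolding eq
    by (intro closed_INT ballI closed_Collect_le continuous_intros continuous_on_L_vec) auto
qed

text \<open>Vectors are represented by functions \<open>nat => real\<close> with the product
  topology. The coordinates from \<open>N\<close> on are pinned to 0, so that Tychonoff applies to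
  the product over all indices.\<close>

lemma compact_box: "compact {f :: nat \<Rightarrow> real. \<forall>i. f i \<in> (if i < N then {- R..R} else {0})}"
proof -
  have "compactin (product_topology (\<lambda>i. euclidean) UNIV)
      (PiE UNIV (\<lambda>i. if i < N then {- R..R} else {0 :: real}))"
    by (subst compactin_PiE) auto
  moreover have "PiE UNIV (\<lambda>i. if i < N then {- R..R} else {0 :: real})
      = {f :: nat \<Rightarrow> real. \<forall>i. f i \<in> (if i < N then {- R..R} else {0})}"
    by (simp add: PiE_UNIV_domain Pi_def)
  ultimately show ?thesis
    by (simp add: euclidean_product_topology)
qed

text \<open>\<open>bound\<close> confines the slice to a box. Maximizing \<open>det\<close> instead
  of its logarithm keeps the objective continuous up to the boundary. Stationarity is tested on
  directions orthogonal to \<open>t\<close>, which makes the gradient a multiple of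
  \<open>t\<close>; pairing with \<open>x\<close> itself, where the trace is \<open>m\<close>, fixes
  the multiplier. The level \<open>c * real m\<close> is what makes it \<open>1 / c\<close>.\<close>

lemma critical_point:
  assumes t: "t \<in> carrier_vec N" and m: "m > 0" and c: "c > 0"
    and bound: "\<And>x i. x \<in> carrier_vec N \<Longrightarrow> psd m (L x) \<Longrightarrow> i < N \<Longrightarrow> \<bar>x $ i\<bar> \<le> B * (t \<bullet> x)"
    and e: "e \<in> carrier_vec N" "pd m (L e)" "t \<bullet> e > 0"
  obtains x S where "x \<in> carrier_vec N" "pd m (L x)" "t \<bullet> x = c * real m"
    "psd m S" "S * L x = 1\<^sub>m m" "L x * S = 1\<^sub>m m"
    "\<And>i. i < N \<Longrightarrow> mtrace (S * G i) = 1 / c * t $ i"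
proof -
  define R where "R = B * (c * real m)"
  define K where "K = {f :: nat \<Rightarrow> real. \<forall>i. f i \<in> (if i < N then {- R..R} else {0})}
      \<inter> ({f. psd m (L (vec N f))} \<inter> {f. (\<Sum>i<N. t $ i * f i) = c * real m})"
  have tx: "t \<bullet> x = (\<Sum>i<N. t $ i * x $ i)" if "x \<in> carrier_vec N" for x
    using that by (auto simp: scalar_prod_def atLeast0LessThan)
  define fn where "fn x i = (if i < N then x $ i else 0)" for x :: "real vec" and i :: nat
  have vec_fn: "vec N (fn x) = x" if "x \<in> carrier_vec N" for x
    using that by (intro eq_vecI) (auto simp: fn_def)
  have fnK: "fn x \<in> K" if x: "x \<in> carrier_vec N" "psd m (L x)" "t \<bullet> x = c * real m" for x
  proof -
    have le: "\<bar>x $ i\<bar> \<le> R" if "i < N" for i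
      using bound[OF x(1,2) that] x(3) by (simp add: R_def)
    have "x $ i \<in> {- R..R}" if "i < N" for i
      using le[OF that] unfolding atLeastAtMost_iff by linarith
    moreover have "(\<Sum>i<N. t $ i * fn x i) = c * real m"
      using x tx[OF x(1)] by (simp add: fn_def)
    ultimately show ?thesis
      using x(2) vec_fn[OF x(1)] by (auto simp: K_def fn_def)
  qed
  have cK: "compact K"
    unfolding K_def by (intro compact_Int_closed closed_Int compact_box closed_psd_L
      closed_Collect_eq continuous_intros continuous_on_product_coordinates)
  have cont: "continuous_on K (\<lambda>f. det (L (vec N f)))"
    by (rule continuous_on_subset[of UNIV])
      (auto intro!: continuous_on_det[of _ m] continuous_on_L_vec)
  \<comment> \<open>The interior point \<open>e\<close>, rescaled to the slice: it shows that the
    slice is nonempty and that the maximum of \<open>det\<close> is positive.\<close>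
  define e' where "e' = (c * real m / (t \<bullet> e)) \<cdot>\<^sub>v e"
  have e': "e' \<in> carrier_vec N" using e by (simp add: e'_def)
  have fac: "c * real m / (t \<bullet> e) > 0" using c m e by simp
  have psd_e': "psd m (L e')"
    unfolding e'_def L_smult[OF e(1)] by (rule psd_smult[OF pd_imp_psd[OF e(2)]]) (use fac in simp)
  have "det (L e') = (c * real m / (t \<bullet> e)) ^ m * det (L e)"
    by (simp add: e'_def L_smult[OF e(1)] det_smult)
  hence det_e': "det (L e') > 0" using pd_det_pos[OF e(2)] fac by simp
  have "t \<bullet> e' = c * real m"
    using e t unfolding e'_def by (simp add: scalar_prod_smult_distrib[of _ N])
  from fnK[OF e' psd_e' this] have e'K: "fn e' \<in> K" .
  hence "K \<noteq> {}" by blast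
  then obtain f where f: "f \<in> K" and max: "\<And>g. g \<in> K \<Longrightarrow> det (L (vec N g)) \<le> det (L (vec N f))"
    using continuous_attains_sup[OF cK _ cont] by blast
  define x where "x = vec N f"
  have x: "x \<in> carrier_vec N" by (simp add: x_def)
  have "det (L x) > 0" using max[OF e'K] vec_fn[OF e'] det_e' by (simp add: x_def)
  hence X: "pd m (L x)" using f by (intro psd_det_nonzero_imp_pd) (auto simp: K_def x_def)
  obtain S where S: "psd m S" "S * L x = 1\<^sub>m m" "L x * S = 1\<^sub>m m" using pd_inverse[OF X] .
  note Sc = psd_carrier[OF S(1)]
  have txc: "t \<bullet> x = c * real m"
    using f tx[OF x] by (simp add: K_def x_def)
  have ortho: "mtrace (S * L v) = 0" if v: "v \<in> carrier_vec N" "t \<bullet> v = 0" for v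
  proof -
    define q where "q = sform S (L v) (L v)"
    have q: "q \<ge> 0" unfolding q_def by (rule sform_self_nonneg[OF S(1) L_symm])
    have line: "L (x + s \<cdot>\<^sub>v v) = L x + s \<cdot>\<^sub>m L v" for s
      using x v by (simp add: L_add L_smult)
    \<comment> \<open>For such \<open>s\<close> the squared local norm of the step is at most 1, so
      the moved point is still feasible and Fermat's criterion applies to the maximum at
      \<open>s = 0\<close>.\<close>
    have "det (L x + s \<cdot>\<^sub>m L v) \<le> det (L x + 0 \<cdot>\<^sub>m L v)" if s: "\<bar>0 - s\<bar> < 1 / (q + 1)" for s
    proof -
      have "sform S (s \<cdot>\<^sub>m L v) (s \<cdot>\<^sub>m L v) = s * sform S (s \<cdot>\<^sub>m L v) (L v)"
        by (rule sform_smult_right[OF Sc]) auto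
      also have "sform S (s \<cdot>\<^sub>m L v) (L v) = sform S (L v) (s \<cdot>\<^sub>m L v)"
        by (rule sform_comm[OF Sc]) auto
      also have "\<dots> = s * q"
        unfolding q_def by (rule sform_smult_right[OF Sc]) auto
      finally have "sform S (s \<cdot>\<^sub>m L v) (s \<cdot>\<^sub>m L v) = \<bar>s\<bar> * (\<bar>s\<bar> * q)" by simp
      also have "\<dots> \<le> 1 * 1"
      proof (intro mult_mono)
        have "\<bar>s\<bar> * (q + 1) < 1" using s q by (simp add: field_simps)
        moreover have "0 \<le> \<bar>s\<bar> * q" using q by simp
        ultimately show "\<bar>s\<bar> \<le> 1" "\<bar>s\<bar> * q \<le> 1"
          unfolding distrib_left mult_1_right using abs_ge_zero[of s] by linarith+
      qed (use q in auto)
      finally have "psd m (L x + s \<cdot>\<^sub>m L v)"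
        by (intro psd_perturb[OF X S(1,2) symm_smult[OF L_symm]]) simp
      hence p: "psd m (L (x + s \<cdot>\<^sub>v v))" by (simp add: line)
      have xs: "x + s \<cdot>\<^sub>v v \<in> carrier_vec N" using x v by simp
      have "t \<bullet> (x + s \<cdot>\<^sub>v v) = c * real m"
        using t x v txc by (simp add: scalar_prod_add_distrib[of _ N])
      from max[OF fnK[OF xs p this]] have "det (L (x + s \<cdot>\<^sub>v v)) \<le> det (L x)"
        unfolding vec_fn[OF xs] by (simp add: x_def)
      moreover have "L x + 0 \<cdot>\<^sub>m L v = L x" by (intro eq_matI) auto
      ultimately show ?thesis by (simp add: line)
    qed
    hence "det (L x) * mtrace (S * L v) = 0"
      using DERIV_local_max[OF det_add_deriv[OF L_carrier L_carrier Sc S(3)], of "1 / (q + 1)"] q by simp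
    thus ?thesis using \<open>det (L x) > 0\<close> by simp
  qed
  have "mtrace (S * G i) = 1 / c * t $ i" if i: "i < N" for i
  proof -
    \<comment> \<open>Subtracting \<open>a x\<close> projects the unit vector along \<open>x\<close>
      onto the directions orthogonal to \<open>t\<close>.\<close>
    define a where "a = t $ i / (c * real m)"
    define v where "v = unit_vec N i - a \<cdot>\<^sub>v x"
    have v: "v \<in> carrier_vec N" using x by (simp add: v_def)
    have "t \<bullet> v = t $ i - a * (t \<bullet> x)"
      unfolding v_def using t x i by (simp add: scalar_prod_minus_distrib[of _ N])
    also have "\<dots> = 0" using c m by (simp add: txc a_def)
    finally have "mtrace (S * L v) = 0" by (rule ortho[OF v])
    moreover have "S * L v = S * G i - a \<cdot>\<^sub>m (S * L x)"
      unfolding v_def using x i Sc G_carrier[OF i]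
      by (simp add: L_diff L_smult L_unit mult_minus_distrib_mat[of _ m m _ m] mult_smult_distrib[of _ m m _ m])
    ultimately have "mtrace (S * G i) - a * real m = 0"
      using Sc G_carrier[OF i] by (simp add: S(2) mtrace_diff[of _ m] mtrace_smult[of _ m] mtrace_one)
    thus ?thesis using c m by (simp add: a_def field_simps)
  qed
  with x X txc S that show ?thesis by blast
qed

text \<open>\<open>dom\<close> says that \<open>k e\<close> dominates every possible rounding error,
  and \<open>bound\<close> that \<open>t\<close> controls the coordinates of dual vectors. In the
  estimate, \<open>2 k (t . e)\<close> is the level \<open>c\<close>, \<open>B c m\<close> bounds
  the maximizer, and \<open>1 / 2\<close> is the rounding error.\<close>

theorem integer_certificate:
  assumes t: "t \<in> carrier_vec N" and m: "m > 0"
    and bound: "\<And>x i. x \<in> carrier_vec N \<Longrightarrow> psd m (L x) \<Longrightarrow> i < N \<Longrightarrow> \<bar>x $ i\<bar> \<le> B * (t \<bullet> x)"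
    and e: "e \<in> carrier_vec N" "pd m (L e)" and k: "k > 0" and B: "B > 0"
    and dom: "\<And>u. u \<in> carrier_vec N \<Longrightarrow> (\<And>i. i < N \<Longrightarrow> \<bar>u $ i\<bar> \<le> 1 / 2) \<Longrightarrow> psd m (L (k \<cdot>\<^sub>v e + u))"
    and f: "neg_log_det f"
  shows "\<exists>y\<in>carrier_vec N. (\<forall>i<N. y $ i \<in> \<int> \<and> \<bar>y $ i\<bar> \<le> 2 * k * B * real m * (t \<bullet> e) + 1 / 2) \<and>
    pd m (L y) \<and> (\<exists>H\<in>carrier_mat N N. inverts_mat (hessian N f y) H \<and>
      inverts_mat H (hessian N f y) \<and> psd m (L (H *\<^sub>v t)))"
proof -
  \<comment> \<open>Otherwise \<open>bound\<close> would force \<open>e = 0\<close>, which is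
    impossible for a positive definite matrix of size \<open>m > 0\<close>.\<close>
  have te: "t \<bullet> e > 0"
  proof (rule ccontr)
    assume "\<not> t \<bullet> e > 0"
    hence "B * (t \<bullet> e) \<le> 0" using B by (simp add: mult_nonneg_nonpos)
    hence "e $ i = 0" if "i < N" for i
      using bound[OF e(1) pd_imp_psd[OF e(2)] that] by simp
    hence "L e = 0\<^sub>m m m" by (intro eq_matI) (simp_all add: L_index)
    hence "unit_vec m 0 \<bullet> (L e *\<^sub>v unit_vec m 0) = 0"
      unfolding quad_form_sum[OF L_carrier unit_vec_carrier unit_vec_carrier] by simp
    moreover have "unit_vec m 0 \<noteq> (0\<^sub>v m :: real vec)"
      using m by (metis index_unit_vec(1) index_zero_vec(1) zero_neq_one)
    ultimately show False using e(2) unfolding pd_def by (metis less_irrefl unit_vec_carrier)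
  qed
  \<comment> \<open>With this level, \<open>k tr (S (L e)) = k (t . e) / c = 1 / 2\<close>, so the
    squared local norm of the rounding error is at most \<open>1 / 4\<close>.\<close>
  define c where "c = 2 * k * (t \<bullet> e)"
  have c: "c > 0" using k te by (simp add: c_def)
  obtain x S where x: "x \<in> carrier_vec N" and X: "pd m (L x)" and tx: "t \<bullet> x = c * real m"
    and S: "psd m S" "S * L x = 1\<^sub>m m" "L x * S = 1\<^sub>m m"
    and grad: "\<And>i. i < N \<Longrightarrow> mtrace (S * G i) = 1 / c * t $ i"
    using critical_point[OF t m c bound e te] by blast
  note Sc = psd_carrier[OF S(1)]
  have grad': "mtrace (S * L v) = 1 / c * (t \<bullet> v)" if "v \<in> carrier_vec N" for v
    using that t
    by (simp add: mtrace_mult_L[OF Sc] grad scalar_prod_def atLeast0LessThan sum_divide_distrib mult_ac)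
  define y where "y = vec N (\<lambda>i. of_int (round (x $ i)) :: real)"
  define u where "u = y - x"
  have y: "y \<in> carrier_vec N" and u: "u \<in> carrier_vec N" using x by (simp_all add: y_def u_def)
  have ui: "\<bar>u $ i\<bar> \<le> 1 / 2" if "i < N" for i
    using that x of_int_round_abs_le[of "x $ i"] by (simp add: u_def y_def)
  have "y = x + u" using x y by (intro eq_vecI) (auto simp: u_def)
  hence Ly: "L y = L x + L u" using L_add[OF x u] by simp
  have hi: "psd m (k \<cdot>\<^sub>m L e + L u)"
    using dom[OF u ui] e u by (simp add: L_add L_smult)
  \<comment> \<open>The box of rounding errors is symmetric, so \<open>dom\<close> at
    \<open>- u\<close> supplies the other side of the sandwich.\<close>
  have mu: "- u \<in> carrier_vec N" "\<And>i. i < N \<Longrightarrow> \<bar>(- u) $ i\<bar> \<le> 1 / 2" using u ui by auto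
  have "k \<cdot>\<^sub>v e + - u = k \<cdot>\<^sub>v e - u" using e u by (intro eq_vecI) auto
  hence lo: "psd m (k \<cdot>\<^sub>m L e - L u)"
    using dom[OF mu] e u by (simp add: L_diff L_smult)
  have "sform S (L u) (L u) \<le> (k * mtrace (S * L e))\<^sup>2"
    by (rule sform_le_of_sandwich[OF S(1) pd_imp_psd[OF e(2)] L_symm lo hi])
  also have "k * mtrace (S * L e) = 1 / 2"
    using k te by (simp add: grad'[OF e(1)] c_def)
  finally have less: "sform S (L u) (L u) < 1" by (simp add: power2_eq_square)
  have Y: "pd m (L y)" unfolding Ly by (rule pd_perturb[OF X S(1,2) L_symm less])
  obtain S' where S': "psd m S'" "S' * L y = 1\<^sub>m m" "L y * S' = 1\<^sub>m m" using pd_inverse[OF Y] .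
  have H: "hessian N f y = hess S'"
    by (rule hessian_neg_log_det[OF f y pd_det_pos[OF Y] psd_carrier[OF S'(1)] S'(2,3)])
  \<comment> \<open>Bounding the coordinates of \<open>v\<close> and of \<open>- v\<close> by
    opposite multiples of \<open>t . v\<close> makes both vanish.\<close>
  have pointed: "v = 0\<^sub>v N" if v: "v \<in> carrier_vec N" "psd m (L v)" "psd m (- L v)" for v
  proof (rule eq_vecI)
    fix i assume i: "i < dim_vec (0\<^sub>v N :: real vec)"
    have mv: "- v \<in> carrier_vec N" using v by simp
    have "L (- v) = - L v" by (intro eq_matI) (auto simp: L_index sum_negf v(1)[THEN carrier_vecD])
    hence "psd m (L (- v))" using v by simp
    from bound[OF mv this, of i] bound[OF v(1,2), of i] show "v $ i = 0\<^sub>v N $ i"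
      using i v(1) t by simp
  qed (use v in simp)
  obtain M where M: "M \<in> carrier_mat N N" "inverts_mat (hess S') M" "inverts_mat M (hess S')"
    using hess_invertible[OF pointed Y S'(1,2)] by blast
  define z where "z = M *\<^sub>v t"
  have z: "z \<in> carrier_vec N" using M t by (simp add: z_def)
  have hc: "hess S' \<in> carrier_mat N N" by (simp add: hess_def)
  have "hess S' *\<^sub>v z = (hess S' * M) *\<^sub>v t"
    unfolding z_def using M t hc by (simp add: assoc_mult_mat_vec[of _ N N _ N])
  also have "\<dots> = t" using M(2) t by (simp add: inverts_mat_def hess_def)
  finally have Hz: "sform S' (G i) (L z) = t $ i" if "i < N" for i
    using hess_mult_vec[OF psd_carrier[OF S'(1)] z that] by simp
  have Lz: "psd m (L z)"
    by (rule psd_of_newton_step[OF y z L_symm X S(1,2) Ly less Y S' _ grad Hz]) (use c in auto)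
  have "y $ i \<in> \<int> \<and> \<bar>y $ i\<bar> \<le> 2 * k * B * real m * (t \<bullet> e) + 1 / 2" if i: "i < N" for i
  proof -
    have "\<bar>x $ i\<bar> \<le> B * (c * real m)"
      using bound[OF x pd_imp_psd[OF X] i] tx by simp
    moreover have "y $ i = x $ i + u $ i" using x i by (simp add: u_def y_def)
    ultimately have "\<bar>y $ i\<bar> \<le> B * (c * real m) + 1 / 2" using ui[OF i] by linarith
    moreover have "y $ i \<in> \<int>" using i by (simp add: y_def)
    ultimately show ?thesis by (simp add: c_def mult_ac)
  qed
  moreover have "\<exists>H\<in>carrier_mat N N. inverts_mat (hessian N f y) H \<and>
      inverts_mat H (hessian N f y) \<and> psd m (L (H *\<^sub>v t))"
    unfolding H using M Lz unfolding z_def by blast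
  ultimately show ?thesis using y Y by blast
qed

end

section \<open>Coefficient bounds and weighted sums of squares\<close>

text \<open>Truncation at \<open>n\<close> gives a submultiplicative seminorm on all polynomials,
  because it only drops nonnegative terms; products then require no degree bookkeeping.\<close>

definition l1 :: "nat \<Rightarrow> real poly \<Rightarrow> real" where
  "l1 n p = (\<Sum>i\<le>n. \<bar>coeff p i\<bar>)"

lemma l1_nonneg: "0 \<le> l1 n p"
  by (simp add: l1_def sum_nonneg)

lemma l1_add: "l1 n (p + q) \<le> l1 n p + l1 n q"
  by (auto simp: l1_def sum.distrib[symmetric] intro!: sum_mono)

lemma l1_smult: "l1 n (smult c p) = \<bar>c\<bar> * l1 n p"
  by (simp add: l1_def sum_distrib_left abs_mult)

lemma l1_sum: "l1 n (\<Sum>j\<in>A. p j) \<le> (\<Sum>j\<in>A. l1 n (p j))"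
proof (induction A rule: infinite_finite_induct)
  case (insert a A)
  thus ?case using l1_add[of n "p a" "\<Sum>j\<in>A. p j"] by simp
qed (simp_all add: l1_def)

lemma l1_mult: "l1 n (p * q) \<le> l1 n p * l1 n q"
proof -
  have "l1 n (p * q) \<le> (\<Sum>k\<le>n. \<Sum>i\<le>k. \<bar>coeff p i\<bar> * \<bar>coeff q (k - i)\<bar>)"
    unfolding l1_def coeff_mult
    by (intro sum_mono order_trans[OF sum_abs]) (simp add: abs_mult)
  also have "\<dots> = (\<Sum>(i, j)\<in>{(i, j). i + j \<le> n}. \<bar>coeff p i\<bar> * \<bar>coeff q j\<bar>)"
    by (rule sum.triangle_reindex_eq[symmetric])
  also have "\<dots> \<le> (\<Sum>(i, j)\<in>{..n} \<times> {..n}. \<bar>coeff p i\<bar> * \<bar>coeff q j\<bar>)"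
    by (intro sum_mono2) auto
  also have "\<dots> = l1 n p * l1 n q"
    by (simp add: l1_def sum_product sum.cartesian_product)
  finally show ?thesis .
qed

lemma l1_prod:
  assumes "\<And>j. j \<in> A \<Longrightarrow> l1 n (p j) \<le> b j"
  shows "l1 n (\<Prod>j\<in>A. p j) \<le> (\<Prod>j\<in>A. b j)"
  using assms
proof (induction A rule: infinite_finite_induct)
  case (insert a A)
  have "l1 n (p a * (\<Prod>j\<in>A. p j)) \<le> l1 n (p a) * l1 n (\<Prod>j\<in>A. p j)" by (rule l1_mult)
  also have "\<dots> \<le> b a * (\<Prod>j\<in>A. b j)"
    using insert l1_nonneg order_trans[OF l1_nonneg insert.prems[of a]] by (intro mult_mono) auto
  finally show ?case using insert by simp
qed (simp_all add: l1_def sum.atMost_shift del: sum.atMost_Suc)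

lemma l1_linear: "l1 n [:a, b:] \<le> \<bar>a\<bar> + \<bar>b\<bar>"
proof (cases n)
  case (Suc k)
  have "(\<Sum>i<k. \<bar>coeff [:a, b:] (Suc (Suc i))\<bar>) = 0" by simp
  thus ?thesis using Suc by (simp add: l1_def sum.atMost_shift lessThan_Suc_atMost[symmetric] sum.lessThan_Suc_shift del: sum.lessThan_Suc)
qed (simp add: l1_def)

section \<open>Lagrange interpolation at equispaced nodes\<close>

definition node :: "nat \<Rightarrow> nat \<Rightarrow> real" where
  "node D j = - 1 + 2 * real j / real D"

lemma node_in: "D > 0 \<Longrightarrow> j \<le> D \<Longrightarrow> node D j \<in> {- 1..1}"
  by (simp add: node_def field_simps)

lemma node_diff: "D > 0 \<Longrightarrow> node D j - node D k = 2 * (real j - real k) / real D"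
  by (simp add: node_def field_simps)

lemma node_eq_iff: "D > 0 \<Longrightarrow> node D j = node D k \<longleftrightarrow> j = k"
  by (simp add: node_def)

definition lagrange_poly :: "nat \<Rightarrow> nat \<Rightarrow> real poly" where
  "lagrange_poly D j = (\<Prod>k\<in>{..D} - {j}.
     smult (1 / (node D j - node D k)) [:- node D k, 1:])"

lemma poly_lagrange_poly:
  assumes "D > 0" "i \<le> D" "j \<le> D"
  shows "poly (lagrange_poly D j) (node D i) = (if i = j then 1 else 0)"
proof (cases "i = j")
  case True
  have "poly (lagrange_poly D j) (node D j) = 1"
    unfolding lagrange_poly_def poly_prod
  proof (intro prod.neutral ballI)
    fix k assume "k \<in> {..D} - {j}"
    hence "node D j - node D k \<noteq> 0" using assms by (simp add: node_eq_iff)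
    thus "poly (smult (1 / (node D j - node D k)) [:- node D k, 1:]) (node D j) = 1"
      by (simp add: diff_divide_distrib[symmetric])
  qed
  thus ?thesis using True by simp
next
  case False
  thus ?thesis using assms by (auto simp: lagrange_poly_def poly_prod intro!: prod_zero)
qed

lemma degree_lagrange_poly: "j \<le> D \<Longrightarrow> degree (lagrange_poly D j) \<le> D"
proof -
  assume "j \<le> D"
  have "degree (smult c [:a, 1 :: real:]) \<le> 1" for a c
    by (rule order_trans[OF degree_smult_le]) simp
  hence "degree (lagrange_poly D j) \<le> (\<Sum>k\<in>{..D} - {j}. 1)"
    unfolding lagrange_poly_def
    by (intro order_trans[OF degree_prod_sum_le] sum_mono) auto
  thus ?thesis using \<open>j \<le> D\<close> by simp
qed

lemma lagrange_interpolation: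
  assumes "D > 0" "degree p \<le> D"
  shows "p = (\<Sum>j\<le>D. smult (poly p (node D j)) (lagrange_poly D j))" (is "p = ?q")
proof (rule poly_eqI_degree[of "node D ` {..D}"])
  have card: "card (node D ` {..D}) = D + 1"
    using assms by (subst card_image) (auto simp: inj_on_def node_eq_iff)
  show "degree p < card (node D ` {..D})" using assms card by simp
  have "degree ?q \<le> D"
    by (intro degree_sum_le order_trans[OF degree_smult_le degree_lagrange_poly]) auto
  thus "degree ?q < card (node D ` {..D})" using card by simp
  fix x assume "x \<in> node D ` {..D}"
  then obtain i where i: "i \<le> D" "x = node D i" by auto
  have "poly ?q x = (\<Sum>j\<le>D. if j = i then poly p (node D j) else 0)"
    unfolding poly_sum i(2)
    by (intro sum.cong refl) (auto simp: poly_lagrange_poly[OF assms(1) i(1)])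
  thus "poly p x = poly ?q x" using i by simp
qed

text \<open>The left side is a single term of the exponential series; this is the source of
  \<open>e\<close> in \<open>interp_const\<close>.\<close>

lemma power_div_fact_le_exp: "real n ^ n / fact n \<le> exp (real n)"
proof -
  have "(\<Sum>k\<in>{n}. real n ^ k /\<^sub>R fact k) \<le> (\<Sum>k. real n ^ k /\<^sub>R fact k)"
    by (intro sum_le_suminf summable_exp_generic) auto
  thus ?thesis by (simp add: exp_def divide_inverse mult.commute)
qed

lemma prod_abs_diff: "j \<le> D \<Longrightarrow> (\<Prod>k\<in>{..D} - {j}. \<bar>real j - real k\<bar>) = fact j * fact (D - j)"
proof -
  assume j: "j \<le> D"
  have "(\<Prod>k\<in>{..<j}. \<bar>real j - real k\<bar>) = (\<Prod>k\<in>{1..j}. real k)"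
    by (rule prod.reindex_bij_witness[of _ "\<lambda>k. j - k" "\<lambda>k. j - k"]) auto
  hence 1: "(\<Prod>k\<in>{..<j}. \<bar>real j - real k\<bar>) = fact j" by (simp add: fact_prod)
  have "(\<Prod>k\<in>{j<..D}. \<bar>real j - real k\<bar>) = (\<Prod>k\<in>{1..D - j}. real k)"
    by (rule prod.reindex_bij_witness[of _ "\<lambda>k. j + k" "\<lambda>k. k - j"]) auto
  hence 2: "(\<Prod>k\<in>{j<..D}. \<bar>real j - real k\<bar>) = fact (D - j)" by (simp add: fact_prod)
  have "{..D} - {j} = {..<j} \<union> {j<..D}" using j by auto
  moreover have "(\<Prod>k\<in>{..<j} \<union> {j<..D}. \<bar>real j - real k\<bar>) = fact j * fact (D - j)"
    unfolding 1[symmetric] 2[symmetric] by (rule prod.union_disjoint) auto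
  ultimately show ?thesis by simp
qed

definition interp_const :: "nat \<Rightarrow> real" where
  "interp_const D = (2 * exp 1) ^ D"

text \<open>A factor \<open>z - z_k\<close> has coefficient sum at most 2 and the nodes are
  \<open>2 / D\<close> apart, so each normalized factor contributes \<open>D / |j - k|\<close>. The
  product is \<open>D^D / D!\<close> times the binomial coefficient of \<open>D\<close> over
  \<open>j\<close>, at most \<open>e^D 2^D\<close>.\<close>

lemma l1_lagrange_poly:
  assumes D: "D > 0" and j: "j \<le> D"
  shows "l1 n (lagrange_poly D j) \<le> interp_const D"
proof -
  have "l1 n (smult (1 / (node D j - node D k)) [:- node D k, 1:]) \<le> real D / \<bar>real j - real k\<bar>"
    if "k \<in> {..D} - {j}" for k
  proof -
    have "\<bar>node D k\<bar> \<le> 1" using node_in[OF D, of k] that by (auto simp: abs_le_iff)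
    hence "l1 n [:- node D k, 1:] \<le> 2" using l1_linear[of n "- node D k" 1] by simp
    hence "l1 n (smult (1 / (node D j - node D k)) [:- node D k, 1:]) \<le> \<bar>1 / (node D j - node D k)\<bar> * 2"
      unfolding l1_smult by (intro mult_left_mono) auto
    also have "\<dots> = real D / \<bar>real j - real k\<bar>"
      unfolding node_diff[OF D] abs_divide abs_mult by simp
    finally show ?thesis .
  qed
  hence "l1 n (lagrange_poly D j) \<le> (\<Prod>k\<in>{..D} - {j}. real D / \<bar>real j - real k\<bar>)"
    unfolding lagrange_poly_def by (intro l1_prod)
  also have "\<dots> = real D ^ D / (fact j * fact (D - j))"
    using j by (simp add: prod_dividef prod_abs_diff)
  also have "\<dots> = real D ^ D / fact D * real (D choose j)"
    using j by (simp add: binomial_fact)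
  also have "\<dots> \<le> exp (real D) * 2 ^ D"
  proof (intro mult_mono power_div_fact_le_exp)
    have "real (D choose j) \<le> real (2 ^ D)" using binomial_le_pow2 of_nat_le_iff by blast
    thus "real (D choose j) \<le> 2 ^ D" by simp
  qed auto
  also have "\<dots> = interp_const D"
    by (simp add: interp_const_def power_mult_distrib exp_of_nat_mult[of D 1, simplified] mult.commute)
  finally show ?thesis .
qed

lemma l1_le_node_values:
  assumes D: "D > 0" and p: "degree p \<le> D"
  shows "l1 n p \<le> interp_const D * (\<Sum>j\<le>D. \<bar>poly p (node D j)\<bar>)"
proof -
  have "l1 n p \<le> (\<Sum>j\<le>D. l1 n (smult (poly p (node D j)) (lagrange_poly D j)))"
    by (subst lagrange_interpolation[OF assms]) (rule l1_sum)
  also have "\<dots> \<le> (\<Sum>j\<le>D. \<bar>poly p (node D j)\<bar> * interp_const D)"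
    unfolding l1_smult using l1_lagrange_poly[OF D] by (intro sum_mono mult_left_mono) auto
  finally show ?thesis by (simp add: sum_distrib_left mult_ac)
qed

lemma interp_const_pos: "interp_const D > 0"
  by (simp add: interp_const_def)

section \<open>Dual vectors as functionals on polynomials, and the cone of weighted sums of
  squares\<close>

text \<open>A vector \<open>x\<close> is read as the linear functional sending \<open>z^l\<close> to
  \<open>x $ l\<close>, that is, as a moment sequence.\<close>

definition pairing :: "nat \<Rightarrow> real vec \<Rightarrow> real poly \<Rightarrow> real" where
  "pairing D x p = (\<Sum>l\<le>D. coeff p l * x $ l)"

lemma coeff_vec_carrier [simp]: "coeff_vec D p \<in> carrier_vec (D + 1)"
  by (simp add: coeff_vec_def)

lemma coeff_vec_scalar_prod:
  assumes "x \<in> carrier_vec (D + 1)"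
  shows "coeff_vec D p \<bullet> x = pairing D x p"
  using assms
  by (auto simp: coeff_vec_def scalar_prod_def pairing_def atLeast0LessThan lessThan_Suc_atMost)

lemma pairing_add: "pairing D x (p + q) = pairing D x p + pairing D x q"
  by (simp add: pairing_def algebra_simps sum.distrib)

lemma pairing_zero: "pairing D x 0 = 0"
  by (simp add: pairing_def)

lemma pairing_smult: "pairing D x (smult c p) = c * pairing D x p"
  by (simp add: pairing_def sum_distrib_left mult_ac)

lemma pairing_sum: "pairing D x (\<Sum>i\<in>A. p i) = (\<Sum>i\<in>A. pairing D x (p i))"
  by (induction A rule: infinite_finite_induct) (auto simp: pairing_add pairing_zero)

lemma pairing_one: "pairing D x 1 = x $ 0"
proof -
  have "pairing D x 1 = (\<Sum>l\<le>D. if l = 0 then x $ l else 0)"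
    unfolding pairing_def by (intro sum.cong) auto
  thus ?thesis by simp
qed

lemma pairing_monom_vec:
  assumes "degree p \<le> D"
  shows "pairing D (monom_vec D z) p = poly p z"
proof -
  have "pairing D (monom_vec D z) p = (\<Sum>l\<le>D. coeff p l * z ^ l)"
    by (simp add: pairing_def monom_vec_def)
  also have "\<dots> = (\<Sum>l\<le>degree p. coeff p l * z ^ l)"
    using assms by (intro sum.mono_neutral_right) (auto simp: coeff_eq_0)
  finally show ?thesis by (simp add: poly_altdef)
qed

definition wsos :: "nat \<Rightarrow> real poly \<Rightarrow> bool" where
  "wsos D p \<longleftrightarrow> (\<exists>s\<in>sos (deg1 D). \<exists>s'\<in>sos (deg2 D). p = weight1 D * s + weight2 D * s')"

lemma wsos_cone_eq: "wsos_cone D = coeff_vec D ` {p. wsos D p}"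
  by (auto simp: wsos_cone_def wsos_def)

lemma dual_cone_iff:
  "x \<in> dual_cone D \<longleftrightarrow> x \<in> carrier_vec (D + 1) \<and> (\<forall>p. wsos D p \<longrightarrow> 0 \<le> pairing D x p)"
  by (auto simp: dual_cone_def wsos_cone_eq coeff_vec_scalar_prod)

lemma sos_add: "p \<in> sos k \<Longrightarrow> q \<in> sos k \<Longrightarrow> p + q \<in> sos k"
  unfolding sos_def
proof clarify
  fix ps qs :: "real poly list"
  assume "\<forall>q\<in>set ps. degree q \<le> k" "\<forall>q\<in>set qs. degree q \<le> k"
  thus "\<exists>rs. (\<forall>q\<in>set rs. degree q \<le> k) \<and> (\<Sum>q\<leftarrow>ps. q\<^sup>2) + (\<Sum>q\<leftarrow>qs. q\<^sup>2) = (\<Sum>q\<leftarrow>rs. q\<^sup>2)"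
    by (intro exI[of _ "ps @ qs"]) auto
qed

lemma sos_zero: "0 \<in> sos k"
  unfolding sos_def by (auto intro!: exI[of _ "[]"])

lemma sos_square: "degree q \<le> k \<Longrightarrow> q\<^sup>2 \<in> sos k"
  unfolding sos_def by (auto intro!: exI[of _ "[q]"])

lemma sos_smult:
  assumes "c \<ge> 0" "p \<in> sos k"
  shows "smult c p \<in> sos k"
proof -
  obtain qs where qs: "\<forall>q\<in>set qs. degree q \<le> k" "p = (\<Sum>q\<leftarrow>qs. q\<^sup>2)"
    using assms(2) by (auto simp: sos_def)
  have "smult c (\<Sum>q\<leftarrow>qs. q\<^sup>2) = (\<Sum>q\<leftarrow>map (smult (sqrt c)) qs. q\<^sup>2)"
    using assms(1) by (induction qs) (auto simp: smult_add_right power2_eq_square)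
  thus ?thesis
    unfolding sos_def using qs by (auto intro!: exI[of _ "map (smult (sqrt c)) qs"])
qed

lemma sos_nonneg: "p \<in> sos k \<Longrightarrow> 0 \<le> poly p z"
proof -
  assume "p \<in> sos k"
  then obtain qs where "p = (\<Sum>q\<leftarrow>qs. q\<^sup>2)" by (auto simp: sos_def)
  moreover have "0 \<le> poly (\<Sum>q\<leftarrow>qs. q\<^sup>2) z" by (induction qs) auto
  ultimately show ?thesis by simp
qed

lemma degree_sos: "p \<in> sos k \<Longrightarrow> degree p \<le> 2 * k"
proof -
  assume "p \<in> sos k"
  then obtain qs where qs: "\<forall>q\<in>set qs. degree q \<le> k" "p = (\<Sum>q\<leftarrow>qs. q\<^sup>2)" by (auto simp: sos_def)
  from qs(1) have "degree (\<Sum>q\<leftarrow>qs. q\<^sup>2) \<le> 2 * k"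
  proof (induction qs)
    case (Cons q qs)
    have "degree (q\<^sup>2) \<le> 2 * k" using Cons.prems degree_power_le[of q 2] by simp
    thus ?case using Cons by (auto intro!: degree_add_le)
  qed simp
  thus ?thesis using qs by simp
qed

lemma wsos_add: "wsos D p \<Longrightarrow> wsos D q \<Longrightarrow> wsos D (p + q)"
proof -
  assume "wsos D p" "wsos D q"
  then obtain s s' r r' where *: "s \<in> sos (deg1 D)" "s' \<in> sos (deg2 D)" "r \<in> sos (deg1 D)" "r' \<in> sos (deg2 D)"
    "p = weight1 D * s + weight2 D * s'" "q = weight1 D * r + weight2 D * r'"
    by (auto simp: wsos_def)
  show ?thesis
    unfolding wsos_def
    by (rule bexI[of _ "s + r"], rule bexI[of _ "s' + r'"])
      (auto simp: * algebra_simps intro!: sos_add *)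
qed

lemma wsos_smult: "c \<ge> 0 \<Longrightarrow> wsos D p \<Longrightarrow> wsos D (smult c p)"
proof -
  assume c: "c \<ge> 0" and "wsos D p"
  then obtain s s' where *: "s \<in> sos (deg1 D)" "s' \<in> sos (deg2 D)" "p = weight1 D * s + weight2 D * s'"
    by (auto simp: wsos_def)
  show ?thesis
    unfolding wsos_def
    by (rule bexI[of _ "smult c s"], rule bexI[of _ "smult c s'"])
      (auto simp: * smult_add_right intro!: sos_smult c *)
qed

lemma wsos_weighted1: "s \<in> sos (deg1 D) \<Longrightarrow> wsos D (weight1 D * s)"
  unfolding wsos_def by (rule bexI[of _ s], rule bexI[of _ 0]) (auto simp: sos_zero)

lemma wsos_weighted2: "s \<in> sos (deg2 D) \<Longrightarrow> wsos D (weight2 D * s)"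
  unfolding wsos_def by (rule bexI[of _ 0], rule bexI[of _ s]) (auto simp: sos_zero)

lemma weight_nonneg: "z \<in> {- 1..1} \<Longrightarrow> 0 \<le> poly (weight1 D) z" "z \<in> {- 1..1} \<Longrightarrow> 0 \<le> poly (weight2 D) z"
  by (auto simp: weight1_def weight2_def abs_square_le_1 abs_le_iff power2_eq_square[symmetric])

lemma wsos_nonneg:
  assumes "wsos D p" "z \<in> {- 1..1}"
  shows "0 \<le> poly p z"
proof -
  obtain s s' where *: "s \<in> sos (deg1 D)" "s' \<in> sos (deg2 D)" "p = weight1 D * s + weight2 D * s'"
    using assms(1) by (auto simp: wsos_def)
  have "0 \<le> poly (weight1 D) z * poly s z" "0 \<le> poly (weight2 D) z * poly s' z"
    by (intro mult_nonneg_nonneg weight_nonneg[OF assms(2)] sos_nonneg[OF *(1)] sos_nonneg[OF *(2)])+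
  thus ?thesis by (simp add: *(3))
qed

lemma degree_wsos:
  assumes "D > 0" "wsos D p"
  shows "degree p \<le> D"
proof -
  obtain s s' where *: "s \<in> sos (deg1 D)" "s' \<in> sos (deg2 D)" "p = weight1 D * s + weight2 D * s'"
    using assms(2) by (auto simp: wsos_def)
  have "degree (weight1 D * s) \<le> D" "degree (weight2 D * s') \<le> D"
    using degree_mult_le[of "weight1 D" s] degree_sos[OF *(1)] degree_weights(1)[of D]
      degree_mult_le[of "weight2 D" s'] degree_sos[OF *(2)] degree_weights(2)[OF assms(1)] by linarith+
  thus ?thesis using * by (auto intro: degree_add_le)
qed

section \<open>Explicit weighted sums of squares\<close>

abbreviation "X \<equiv> [:0, 1 :: real:]"

text \<open>For odd \<open>D\<close> the constant 1 is half the sum of the two weights.\<close>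

lemma wsos_square:
  assumes "degree q \<le> D div 2"
  shows "wsos D (q\<^sup>2)"
proof (cases "even D")
  case True
  thus ?thesis using wsos_weighted1[OF sos_square, of q D] assms by (simp add: deg1_def weight1_def)
next
  case False
  have "wsos D (smult (1 / 2) (weight1 D * q\<^sup>2 + weight2 D * q\<^sup>2))"
    using False assms
    by (intro wsos_smult wsos_add wsos_weighted1 wsos_weighted2 sos_square) (auto simp: deg1_def deg2_def)
  also have "smult (1 / 2) (weight1 D * q\<^sup>2 + weight2 D * q\<^sup>2)
      = smult (1 / 2) (weight1 D + weight2 D) * q\<^sup>2"
    by (simp add: distrib_right)
  also have "smult (1 / 2) (weight1 D + weight2 D) = 1"
    using False by (simp add: weight1_def weight2_def one_pCons)
  also have "1 * q\<^sup>2 = q\<^sup>2" by simp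
  finally show ?thesis .
qed

text \<open>For even \<open>D\<close> this is the second weight. For odd \<open>D\<close> it is half
  of \<open>(1 - z)(1 + z)^2 + (1 + z)(1 - z)^2\<close>; the degree hypothesis leaves room for the
  extra linear factor.\<close>

lemma wsos_one_minus_square:
  assumes "degree q + 1 \<le> D div 2"
  shows "wsos D ((1 - X\<^sup>2) * q\<^sup>2)"
proof (cases "even D")
  case True
  hence "wsos D (weight2 D * q\<^sup>2)"
    using assms by (intro wsos_weighted2 sos_square) (auto simp: deg2_def)
  moreover have "1 - X\<^sup>2 = weight2 D"
    using True by (simp add: weight2_def power2_eq_square one_pCons)
  ultimately show ?thesis by simp
next
  case False
  have "degree ([:1, c:] * q) \<le> D div 2" for c
    using degree_mult_le[of "[:1, c:]" q] assms by (auto split: if_splits)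
  hence deg: "degree ([:1, c:] * q) \<le> deg1 D" "degree ([:1, c:] * q) \<le> deg2 D" for c
    using False unfolding deg1_def deg2_def by presburger+
  have "wsos D (smult (1 / 2) (weight1 D * ([:1, 1:] * q)\<^sup>2 + weight2 D * ([:1, -1:] * q)\<^sup>2))"
    by (intro wsos_smult wsos_add wsos_weighted1 wsos_weighted2 sos_square deg) simp
  also have "smult (1 / 2) (weight1 D * ([:1, 1:] * q)\<^sup>2 + weight2 D * ([:1, -1:] * q)\<^sup>2)
      = smult (1 / 2) ([:1, -1:] * [:1, 1:]\<^sup>2 + [:1, 1:] * [:1, -1:]\<^sup>2) * q\<^sup>2"
    using False by (simp add: weight1_def weight2_def power_mult_distrib algebra_simps del: mult_pCons_left mult_pCons_right)
  also have "smult (1 / 2) ([:1, -1:] * [:1, 1:]\<^sup>2 + [:1, 1:] * [:1, -1:]\<^sup>2) = 1 - X\<^sup>2"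
    by (simp add: power2_eq_square one_pCons)
  finally show ?thesis .
qed

text \<open>Telescoping: consecutive cases differ by \<open>(1 - z^2) z^(2 k)\<close>.\<close>

lemma wsos_one_minus_even_power: "2 * k \<le> D \<Longrightarrow> wsos D (1 - X ^ (2 * k))"
proof (induction k)
  case 0
  thus ?case using wsos_square[of 0 D] by simp
next
  case (Suc k)
  have "wsos D ((1 - X ^ (2 * k)) + (1 - X\<^sup>2) * (X ^ k)\<^sup>2)"
    using Suc degree_power_le[of X k] by (intro wsos_add wsos_one_minus_square) auto
  also have "(1 - X ^ (2 * k)) + (1 - X\<^sup>2) * (X ^ k)\<^sup>2 = 1 - X ^ (2 * Suc k)"
    by (simp only: left_diff_distrib mult_1_left power_mult[symmetric] power_add[symmetric] mult.commute) (simp add: mult.commute)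
  finally show ?case .
qed

text \<open>For \<open>i = 2 k + 1\<close> the polynomial is
  \<open>(1 - z^(2 k)) + (1 + c z) z^(2 k)\<close>. If \<open>D\<close> is odd,
  \<open>1 + c z\<close> is one of the weights; if \<open>D\<close> is even, it is half of
  \<open>(1 + c z)^2 + (1 - z^2)\<close>, and the odd \<open>i\<close> is at most
  \<open>D - 1\<close>, so the degrees fit.\<close>

lemma wsos_one_plus_power:
  assumes "i \<le> D" and c: "c = 1 \<or> c = - 1"
  shows "wsos D (1 + smult c (X ^ i))"
proof (cases "even i")
  case True
  then obtain k where k: "i = 2 * k" by (elim evenE)
  have "wsos D (1\<^sup>2 + (X ^ k)\<^sup>2)"
    using degree_power_le[of X k] assms k by (intro wsos_add wsos_square) auto
  thus ?thesis using wsos_one_minus_even_power[of k D] assms k by (auto simp: power_mult[symmetric] mult.commute)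
next
  case False
  then obtain k where k: "i = 2 * k + 1" by (elim oddE)
  have Xk: "degree (X ^ k) \<le> k" using degree_power_le[of X k] by simp
  have "wsos D ([:1, c:] * (X ^ k)\<^sup>2)"
  proof (cases "even D")
    case True
    hence D: "k + 1 \<le> D div 2" using assms k by (auto elim!: evenE)
    have "degree ([:1, c:] * X ^ k) \<le> D div 2"
      using degree_mult_le[of "[:1, c:]" "X ^ k"] Xk D by (auto split: if_splits)
    hence "wsos D (smult (1 / 2) (([:1, c:] * X ^ k)\<^sup>2 + (1 - X\<^sup>2) * (X ^ k)\<^sup>2))"
      using Xk D by (intro wsos_smult wsos_add wsos_square wsos_one_minus_square) auto
    also have "smult (1 / 2) (([:1, c:] * X ^ k)\<^sup>2 + (1 - X\<^sup>2) * (X ^ k)\<^sup>2)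
        = smult (1 / 2) ([:1, c:]\<^sup>2 + (1 - X\<^sup>2)) * (X ^ k)\<^sup>2"
      by (simp add: power_mult_distrib distrib_right del: mult_pCons_left mult_pCons_right)
    also have "smult (1 / 2) ([:1, c:]\<^sup>2 + (1 - X\<^sup>2)) = [:1, c:]"
      using c by (auto simp: power2_eq_square one_pCons)
    finally show ?thesis .
  next
    case False
    have "degree (X ^ k) \<le> D div 2" using Xk assms k by simp
    thus ?thesis
      using wsos_weighted1[OF sos_square, of "X ^ k" D] wsos_weighted2[OF sos_square, of "X ^ k" D] c False
      by (auto simp: deg1_def deg2_def weight1_def weight2_def)
  qed
  hence "wsos D ((1 - X ^ (2 * k)) + [:1, c:] * (X ^ k)\<^sup>2)"
    using wsos_one_minus_even_power[of k D] assms k by (intro wsos_add) auto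
  also have "[:1, c:] = 1 + smult c X" by (simp add: one_pCons)
  also have "(1 - X ^ (2 * k)) + (1 + smult c X) * (X ^ k)\<^sup>2 = 1 + smult c (X ^ i)"
  proof -
    have "(X ^ k)\<^sup>2 = X ^ (2 * k)" by (simp add: power_mult[symmetric] mult.commute)
    moreover have "X ^ i = X * X ^ (2 * k)" unfolding k by (simp only: Suc_eq_plus1[symmetric] power_Suc)
    ultimately show ?thesis by (simp only: distrib_right mult_smult_left)
  qed
  finally show ?thesis .
qed

lemma dual_cone_abs_le:
  assumes x: "x \<in> dual_cone D" and i: "i \<le> D"
  shows "\<bar>x $ i\<bar> \<le> x $ 0"
proof -
  have "pairing D x (1 + smult c (X ^ i)) = x $ 0 + c * x $ i" for c
  proof -
    have "X ^ i = monom 1 i" by (simp add: monom_altdef)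
    moreover have pm: "pairing D x (monom 1 j) = x $ j" if "j \<le> D" for j
    proof -
      have "pairing D x (monom 1 j) = (\<Sum>l\<le>D. if l = j then x $ l else 0)"
        unfolding pairing_def by (intro sum.cong) auto
      thus ?thesis using that by simp
    qed
    ultimately show ?thesis using i by (simp add: pairing_add pairing_smult pairing_one)
  qed
  from this[of 1] this[of "-1"] show ?thesis
    using x wsos_one_plus_power[OF i, of 1] wsos_one_plus_power[OF i, of "-1"]
    unfolding dual_cone_iff by (auto simp: abs_le_iff)
qed

lemma monom_vec_dual: "D > 0 \<Longrightarrow> z \<in> {- 1..1} \<Longrightarrow> monom_vec D z \<in> dual_cone D"
  unfolding dual_cone_iff
  by (intro conjI allI impI monom_vec_carrier, subst pairing_monom_vec)
    (auto intro: degree_wsos wsos_nonneg)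

section \<open>The sum of node evaluations as a dominating dual vector\<close>

definition node_functional :: "nat \<Rightarrow> real vec" where
  "node_functional D = vec (D + 1) (\<lambda>i. \<Sum>j\<le>D. node D j ^ i)"

lemma pairing_node_functional:
  assumes "degree p \<le> D"
  shows "pairing D (node_functional D) p = (\<Sum>j\<le>D. poly p (node D j))"
proof -
  have "pairing D (node_functional D) p = (\<Sum>j\<le>D. pairing D (monom_vec D (node D j)) p)"
    unfolding pairing_def by (subst sum.swap) (simp add: node_functional_def monom_vec_def sum_distrib_left)
  thus ?thesis by (simp add: pairing_monom_vec[OF assms])
qed

text \<open>On the cone the node values are nonnegative, so the absolute values in the interpolation
  bound disappear and its right side becomes linear in \<open>p\<close>.\<close>

lemma l1_le_pairing_node:
  assumes "D > 0" "wsos D p"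
  shows "l1 D p \<le> interp_const D * pairing D (node_functional D) p"
proof -
  have "\<bar>poly p (node D j)\<bar> = poly p (node D j)" if "j \<le> D" for j
    using wsos_nonneg[OF assms(2) node_in[OF assms(1) that]] by simp
  thus ?thesis
    using l1_le_node_values[OF assms(1) degree_wsos[OF assms], of D]
    by (simp add: pairing_node_functional degree_wsos[OF assms])
qed

text \<open>Rounding errors are bounded in the maximum norm, whose dual norm is the coefficient sum
  \<open>l1\<close>; the pairing of \<open>u\<close> with \<open>p\<close> is thus at most half of
  \<open>l1 D p\<close> in absolute value.\<close>

lemma node_functional_dominates:
  assumes D: "D > 0" and u: "u \<in> carrier_vec (D + 1)" "\<And>i. i < D + 1 \<Longrightarrow> \<bar>u $ i\<bar> \<le> 1 / 2"
  shows "interp_const D \<cdot>\<^sub>v node_functional D + u \<in> dual_cone D"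
  unfolding dual_cone_iff
proof (intro conjI allI impI)
  show c: "interp_const D \<cdot>\<^sub>v node_functional D + u \<in> carrier_vec (D + 1)"
    using u by (simp add: node_functional_def)
  fix p assume p: "wsos D p"
  have "\<bar>coeff p l * u $ l\<bar> \<le> \<bar>coeff p l\<bar> * (1 / 2)" if "l \<in> {..D}" for l
    unfolding abs_mult using that by (intro mult_left_mono u(2)) auto
  hence "\<bar>pairing D u p\<bar> \<le> (\<Sum>l\<le>D. \<bar>coeff p l\<bar> * (1 / 2))"
    unfolding pairing_def by (rule order_trans[OF sum_abs sum_mono])
  also have "\<dots> = l1 D p / 2" by (simp add: l1_def sum_divide_distrib)
  finally have "- pairing D u p \<le> interp_const D * pairing D (node_functional D) p"
    using l1_le_pairing_node[OF D p] l1_nonneg[of D p] by linarith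
  moreover have "pairing D (interp_const D \<cdot>\<^sub>v node_functional D + u) p
      = interp_const D * pairing D (node_functional D) p + pairing D u p"
    using u(1) unfolding pairing_def
    by (simp add: node_functional_def sum_distrib_left sum.distrib[symmetric] algebra_simps)
  ultimately show "0 \<le> pairing D (interp_const D \<cdot>\<^sub>v node_functional D + u) p" by simp
qed

section \<open>The operator Lambda as a linear matrix map\<close>

lemma poly_basis_span:
  assumes ps: "poly_basis k ps" and q: "degree q \<le> k"
  obtains c where "q = (\<Sum>i<length ps. smult (c i) (ps ! i))"
proof -
  interpret vs: Vector_Spaces.vector_space "smult :: real \<Rightarrow> real poly \<Rightarrow> real poly"
    by (rule vector_space_smult)
  have "q \<in> vs.span (set ps)" using ps q by (simp add: poly_basis_def)
  then obtain u where u: "q = (\<Sum>p\<in>set ps. smult (u p) p)"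
    by (auto simp: vs.span_finite)
  have "bij_betw ((!) ps) {..<length ps} (set ps)"
    using ps by (intro bij_betw_nth) (auto simp: poly_basis_def)
  hence "q = (\<Sum>i<length ps. smult (u (ps ! i)) (ps ! i))"
    unfolding u by (rule sum.reindex_bij_betw[symmetric])
  thus ?thesis by (rule that)
qed

lemma poly_basis_independent:
  assumes ps: "poly_basis k ps" and zero: "(\<Sum>i<length ps. smult (c i) (ps ! i)) = 0"
    and i: "i < length ps"
  shows "c i = 0"
proof -
  interpret vs: Vector_Spaces.vector_space "smult :: real \<Rightarrow> real poly \<Rightarrow> real poly"
    by (rule vector_space_smult)
  have b: "bij_betw ((!) ps) {..<length ps} (set ps)"
    using ps by (intro bij_betw_nth) (auto simp: poly_basis_def)
  define u where "u p = c (the_inv_into {..<length ps} ((!) ps) p)" for p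
  have u: "u (ps ! j) = c j" if "j < length ps" for j
    using b that by (simp add: u_def bij_betw_def the_inv_into_f_f)
  have "(\<Sum>p\<in>set ps. smult (u p) p) = (\<Sum>i<length ps. smult (u (ps ! i)) (ps ! i))"
    by (rule sum.reindex_bij_betw[OF b, symmetric])
  also have "\<dots> = 0" using u zero by simp
  finally have "\<forall>p\<in>set ps. u p = 0"
    using ps vs.dependent_finite[of "set ps"] by (auto simp: poly_basis_def)
  thus ?thesis using i u[OF i] by simp
qed

lemma poly_basis_length:
  assumes ps: "poly_basis k ps"
  shows "length ps \<le> k + 1" "0 < length ps"
proof -
  interpret vs: Vector_Spaces.vector_space "smult :: real \<Rightarrow> real poly \<Rightarrow> real poly"
    by (rule vector_space_smult)
  have "p \<in> vs.span (monom 1 ` {..k})" if "degree p \<le> k" for p :: "real poly"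
  proof -
    have "p = (\<Sum>i\<le>k. smult (coeff p i) (monom 1 i))"
      using poly_as_sum_of_monoms'[OF that] by (simp add: smult_monom)
    thus ?thesis
      by (metis (no_types, lifting) vs.span_sum vs.span_scale vs.span_base imageI)
  qed
  hence "set ps \<subseteq> vs.span (monom 1 ` {..k})"
    using poly_basis_degree[OF ps] by (auto simp: in_set_conv_nth)
  hence "card (set ps) \<le> card (monom (1 :: real) ` {..k})"
    using ps by (intro conjunct2[OF vs.independent_span_bound]) (auto simp: poly_basis_def)
  also have "\<dots> \<le> card {..k}" by (rule card_image_le) simp
  finally show "length ps \<le> k + 1"
    using ps by (simp add: poly_basis_def distinct_card)
  show "0 < length ps"
  proof (rule ccontr)
    assume "\<not> 0 < length ps"
    hence "{p. degree p \<le> k} = {0 :: real poly}" using ps by (auto simp: poly_basis_def)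
    moreover have "(1 :: real poly) \<in> {p. degree p \<le> k}" by simp
    ultimately show False by auto
  qed
qed

section \<open>The block-diagonal pencil of the two weights\<close>

text \<open>Both bases are indexed by the rows of the block-diagonal matrix and padded with 0 on the
  foreign block, so that mixed products vanish in \<open>gram_poly\<close> without a case
  distinction.\<close>

definition block1 :: "real poly list \<Rightarrow> nat \<Rightarrow> real poly" where
  "block1 ps1 i = (if i < length ps1 then ps1 ! i else 0)"

definition block2 :: "real poly list \<Rightarrow> real poly list \<Rightarrow> nat \<Rightarrow> real poly" where
  "block2 ps1 ps2 i = (if i < length ps1 then 0 else ps2 ! (i - length ps1))"

definition gram_poly :: "nat \<Rightarrow> real poly list \<Rightarrow> real poly list \<Rightarrow> nat \<Rightarrow> nat \<Rightarrow> real poly" where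
  "gram_poly D ps1 ps2 i j = weight1 D * (block1 ps1 i * block1 ps1 j)
     + weight2 D * (block2 ps1 ps2 i * block2 ps1 ps2 j)"

definition gram :: "nat \<Rightarrow> real poly list \<Rightarrow> real poly list \<Rightarrow> nat \<Rightarrow> real mat" where
  "gram D ps1 ps2 l = mat (length ps1 + length ps2) (length ps1 + length ps2)
     (\<lambda>(i, j). coeff (gram_poly D ps1 ps2 i j) l)"

locale wsos_bases =
  fixes D :: nat and ps1 ps2 :: "real poly list"
  assumes D: "D > 0" and basis1: "poly_basis (deg1 D) ps1" and basis2: "poly_basis (deg2 D) ps2"
begin

abbreviation "m \<equiv> length ps1 + length ps2"

sublocale sym_pencil "Suc D" m "gram D ps1 ps2"
  by unfold_locales (auto intro!: symmI simp: gram_def gram_poly_def mult.commute)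

lemma L_pairing:
  assumes "i < m" "j < m"
  shows "L x $$ (i, j) = pairing D x (gram_poly D ps1 ps2 i j)"
  using assms by (simp add: L_index gram_def pairing_def lessThan_Suc_atMost)

lemma Lambda_eq_L:
  assumes x: "x \<in> carrier_vec (Suc D)"
  shows "Lambda D ps1 ps2 x = L x"
proof -
  have x': "x \<in> carrier_vec (D + 1)" using x by simp
  note e1 = Lambda_map_eq_explicit[OF basis1 degree_weights(1)]
  note e2 = Lambda_map_eq_explicit[OF basis2 degree_weights(2)[OF D]]
  show ?thesis
    unfolding Lambda_def e1 e2 Lambda_explicit_def restrict_apply'[OF x']
  proof (rule eq_matI)
    fix i j assume "i < dim_row (L x)" "j < dim_col (L x)"
    hence ij: "i < m" "j < m" by simp_all
    show "diag_block_mat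
      [mat (length ps1) (length ps1) (\<lambda>(j, k). \<Sum>l\<le>D. coeff (weight1 D * ps1 ! j * ps1 ! k) l * x $ l),
       mat (length ps2) (length ps2) (\<lambda>(j, k). \<Sum>l\<le>D. coeff (weight2 D * ps2 ! j * ps2 ! k) l * x $ l)] $$ (i, j)
      = L x $$ (i, j)"
      unfolding L_pairing[OF ij] using ij
      by (auto simp: Let_def pairing_def gram_poly_def block1_def block2_def mult.assoc)
  qed (simp_all add: Let_def)
qed

text \<open>A vector of length \<open>m\<close> encodes a pair of polynomials, one for each weight;
  \<open>comb1\<close> and \<open>comb2\<close> decode it.\<close>

definition comb1 :: "real vec \<Rightarrow> real poly" where
  "comb1 v = (\<Sum>i<m. smult (v $ i) (block1 ps1 i))"

definition comb2 :: "real vec \<Rightarrow> real poly" where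
  "comb2 v = (\<Sum>i<m. smult (v $ i) (block2 ps1 ps2 i))"

lemma sum_split: "(\<Sum>i<m. f i) = (\<Sum>i<length ps1. f i) + (\<Sum>i<length ps2. f (length ps1 + i))"
proof -
  have "(\<Sum>i<m. f i) = (\<Sum>i<length ps1. f i) + (\<Sum>i=length ps1..<m. f i)"
    using sum.atLeastLessThan_concat[of 0 "length ps1" m f] by (simp add: atLeast0LessThan)
  also have "(\<Sum>i=length ps1..<m. f i) = (\<Sum>i<length ps2. f (length ps1 + i))"
    using sum.shift_bounds_nat_ivl[of f 0 "length ps1" "length ps2"]
    by (simp add: atLeast0LessThan add.commute)
  finally show ?thesis .
qed

lemma comb1_eq: "comb1 v = (\<Sum>i<length ps1. smult (v $ i) (ps1 ! i))"
  by (simp add: comb1_def sum_split block1_def)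

lemma comb2_eq: "comb2 v = (\<Sum>i<length ps2. smult (v $ (length ps1 + i)) (ps2 ! i))"
  by (simp add: comb2_def sum_split block2_def)

lemma degree_comb: "degree (comb1 v) \<le> deg1 D" "degree (comb2 v) \<le> deg2 D"
  unfolding comb1_eq comb2_eq
  by (intro degree_sum_le order_trans[OF degree_smult_le] poly_basis_degree[OF basis1]
      poly_basis_degree[OF basis2]; simp)+

lemma quad_form_L:
  assumes v: "v \<in> carrier_vec m"
  shows "v \<bullet> (L x *\<^sub>v v) = pairing D x (weight1 D * (comb1 v)\<^sup>2 + weight2 D * (comb2 v)\<^sup>2)"
proof -
  have sq: "w * (\<Sum>i<m. smult (v $ i) (b i))\<^sup>2 = (\<Sum>i<m. \<Sum>j<m. smult (v $ i * v $ j) (w * (b i * b j)))"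
    for w :: "real poly" and b
    by (simp add: power2_eq_square sum_product sum_distrib_left mult_ac)
  have "weight1 D * (comb1 v)\<^sup>2 + weight2 D * (comb2 v)\<^sup>2
      = (\<Sum>i<m. \<Sum>j<m. smult (v $ i * v $ j) (gram_poly D ps1 ps2 i j))"
    unfolding comb1_def comb2_def sq gram_poly_def by (simp add: sum.distrib smult_add_right)
  moreover have "v \<bullet> (L x *\<^sub>v v) = (\<Sum>i<m. \<Sum>j<m. v $ i * v $ j * pairing D x (gram_poly D ps1 ps2 i j))"
    unfolding quad_form_sum[OF L_carrier v v] by (intro sum.cong refl) (simp add: L_pairing)
  ultimately show ?thesis by (simp only: pairing_sum pairing_smult)
qed

lemma wsos_comb: "wsos D (weight1 D * (comb1 v)\<^sup>2 + weight2 D * (comb2 v)\<^sup>2)"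
  by (intro wsos_add wsos_weighted1 wsos_weighted2 sos_square degree_comb)

lemma comb_surj:
  assumes "degree q1 \<le> deg1 D" "degree q2 \<le> deg2 D"
  obtains v where "v \<in> carrier_vec m" "comb1 v = q1" "comb2 v = q2"
proof -
  obtain c1 where c1: "q1 = (\<Sum>i<length ps1. smult (c1 i) (ps1 ! i))"
    using poly_basis_span[OF basis1 assms(1)] .
  obtain c2 where c2: "q2 = (\<Sum>i<length ps2. smult (c2 i) (ps2 ! i))"
    using poly_basis_span[OF basis2 assms(2)] .
  show ?thesis
    by (rule that[of "vec m (\<lambda>i. if i < length ps1 then c1 i else c2 (i - length ps1))"])
      (auto simp: comb1_eq comb2_eq c1 c2 intro!: sum.cong)
qed

text \<open>The quadratic form of \<open>L x\<close> at \<open>v\<close> is the pairing of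
  \<open>x\<close> with a weighted sum of two squares, and every admissible pair of polynomials is
  decoded from some \<open>v\<close>. Positivity on these generators extends to the cone by
  additivity.\<close>

lemma psd_L_iff:
  assumes x: "x \<in> carrier_vec (Suc D)"
  shows "psd m (L x) \<longleftrightarrow> x \<in> dual_cone D"
proof
  assume "x \<in> dual_cone D"
  thus "psd m (L x)"
    unfolding psd_def using quad_form_L wsos_comb by (auto simp: dual_cone_iff)
next
  assume psd: "psd m (L x)"
  have sq: "0 \<le> pairing D x (weight1 D * q1\<^sup>2 + weight2 D * q2\<^sup>2)"
    if deg: "degree q1 \<le> deg1 D" "degree q2 \<le> deg2 D" for q1 q2
  proof -
    obtain v where v: "v \<in> carrier_vec m" "comb1 v = q1" "comb2 v = q2" using comb_surj[OF deg] .
    have "0 \<le> v \<bullet> (L x *\<^sub>v v)" using psd v by (simp add: psd_def)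
    thus ?thesis using quad_form_L[OF v(1)] v by simp
  qed
  have 1: "0 \<le> pairing D x (weight1 D * s)" if s: "s \<in> sos (deg1 D)" for s
  proof -
    obtain qs where qs: "\<forall>q\<in>set qs. degree q \<le> deg1 D" "s = (\<Sum>q\<leftarrow>qs. q\<^sup>2)"
      using s by (auto simp: sos_def)
    from qs(1) have "0 \<le> pairing D x (weight1 D * (\<Sum>q\<leftarrow>qs. q\<^sup>2))"
    proof (induction qs)
      case (Cons q qs)
      thus ?case using sq[of q 0] by (simp add: distrib_left pairing_add)
    qed (simp add: pairing_zero)
    thus ?thesis using qs by simp
  qed
  have 2: "0 \<le> pairing D x (weight2 D * s)" if s: "s \<in> sos (deg2 D)" for s
  proof -
    obtain qs where qs: "\<forall>q\<in>set qs. degree q \<le> deg2 D" "s = (\<Sum>q\<leftarrow>qs. q\<^sup>2)"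
      using s by (auto simp: sos_def)
    from qs(1) have "0 \<le> pairing D x (weight2 D * (\<Sum>q\<leftarrow>qs. q\<^sup>2))"
    proof (induction qs)
      case (Cons q qs)
      thus ?case using sq[of 0 q] by (simp add: distrib_left pairing_add)
    qed (simp add: pairing_zero)
    thus ?thesis using qs by simp
  qed
  show "x \<in> dual_cone D"
    unfolding dual_cone_iff
  proof (intro conjI allI impI)
    show "x \<in> carrier_vec (D + 1)" using x by simp
    fix p assume "wsos D p"
    then obtain s s' where "s \<in> sos (deg1 D)" "s' \<in> sos (deg2 D)" "p = weight1 D * s + weight2 D * s'"
      by (auto simp: wsos_def)
    thus "0 \<le> pairing D x p" using 1 2 by (simp add: pairing_add)
  qed
qed

text \<open>If the polynomial of \<open>v\<close> were 0, both weighted squares would vanish on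
  [-1, 1], hence identically, and independence of the bases would give \<open>v = 0\<close>. For a
  nonzero polynomial the coefficient sum is positive, and the interpolation bound transfers this to
  the pairing.\<close>

lemma pd_node_functional: "pd m (L (node_functional D))"
  unfolding pd_def
proof (intro conjI ballI impI)
  fix v :: "real vec" assume v: "v \<in> carrier_vec m" "v \<noteq> 0\<^sub>v m"
  define p where "p = weight1 D * (comb1 v)\<^sup>2 + weight2 D * (comb2 v)\<^sup>2"
  have p: "wsos D p" unfolding p_def by (rule wsos_comb)
  have "p \<noteq> 0"
  proof
    assume "p = 0"
    hence "poly p z = 0" for z by simp
    hence z: "poly (weight1 D) z * (poly (comb1 v) z)\<^sup>2 + poly (weight2 D) z * (poly (comb2 v) z)\<^sup>2 = 0" for z
      unfolding p_def by simp
    have zz: "poly (weight1 D * (comb1 v)\<^sup>2) z = 0 \<and> poly (weight2 D * (comb2 v)\<^sup>2) z = 0"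
      if "z \<in> {- 1..1}" for z
    proof -
      have "0 \<le> poly (weight1 D) z * (poly (comb1 v) z)\<^sup>2" "0 \<le> poly (weight2 D) z * (poly (comb2 v) z)\<^sup>2"
        by (intro mult_nonneg_nonneg weight_nonneg that zero_le_power2)+
      hence "poly (weight1 D) z * (poly (comb1 v) z)\<^sup>2 = 0 \<and> poly (weight2 D) z * (poly (comb2 v) z)\<^sup>2 = 0"
        using z[of z] by linarith
      thus ?thesis by simp
    qed
    have inf: "infinite {- 1..1 :: real}" by simp
    have "weight1 D * (comb1 v)\<^sup>2 = 0" "weight2 D * (comb2 v)\<^sup>2 = 0"
      using zz poly_roots_finite[of "weight1 D * (comb1 v)\<^sup>2"] poly_roots_finite[of "weight2 D * (comb2 v)\<^sup>2"]
        inf finite_subset[of "{- 1..1 :: real}" "{z. poly (weight1 D * (comb1 v)\<^sup>2) z = 0}"]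
        finite_subset[of "{- 1..1 :: real}" "{z. poly (weight2 D * (comb2 v)\<^sup>2) z = 0}"] by blast+
    moreover have "weight1 D \<noteq> 0" "weight2 D \<noteq> 0" by (auto simp: weight1_def weight2_def)
    ultimately have "comb1 v = 0" "comb2 v = 0" by auto
    hence c: "v $ i = 0" if "i < length ps1" for i
      using poly_basis_independent[OF basis1, of "\<lambda>i. v $ i"] that by (simp add: comb1_eq)
    have c': "v $ (length ps1 + i) = 0" if "i < length ps2" for i
      using poly_basis_independent[OF basis2, of "\<lambda>i. v $ (length ps1 + i)"] \<open>comb2 v = 0\<close> that
      by (simp add: comb2_eq)
    have "v $ i = 0" if "i < m" for i
      using c[of i] c'[of "i - length ps1"] that by (cases "i < length ps1") auto
    hence "v = 0\<^sub>v m" using v(1) by (intro eq_vecI) auto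
    thus False using v(2) by simp
  qed
  then obtain i where i: "coeff p i \<noteq> 0" by (auto simp: poly_eq_iff)
  hence "i \<le> D" using degree_wsos[OF D p] by (meson le_degree order_trans)
  hence "0 < l1 D p" unfolding l1_def using i by (intro sum_pos2[of _ i]) auto
  also have "\<dots> \<le> interp_const D * pairing D (node_functional D) p"
    by (rule l1_le_pairing_node[OF D p])
  finally show "0 < v \<bullet> (L (node_functional D) *\<^sub>v v)"
    unfolding quad_form_L[OF v(1)] p_def[symmetric]
    using interp_const_pos[of D] by (simp add: zero_less_mult_iff)
qed simp

lemma neg_log_det_barrier: "neg_log_det (barrier D ps1 ps2)"
  unfolding neg_log_det_def barrier_def by (auto simp: Lambda_eq_L)

lemma dimension_bounds: "0 < m" "m \<le> D + 1"
  using poly_basis_length[OF basis1] poly_basis_length[OF basis2] D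
  by (auto simp: deg1_def deg2_def elim!: evenE oddE split: if_splits)

end

section \<open>Closure and interior of the cones in the vector topology\<close>

lemma abs_le_L2_set: "i < n \<Longrightarrow> \<bar>x i\<bar> \<le> L2_set x {..<n}" for i n :: nat
  using member_le_L2_set[of "{..<n}" i "\<lambda>i. \<bar>x i\<bar>"] by (simp add: L2_set_def)

text \<open>A frontier point is known a priori only as a limit of elements of the cone;
  nonnegativity of a continuous functional passes to such limits.\<close>

lemma dual_nonneg_on_closure:
  assumes s: "s \<in> vec_topology (D + 1) closure_of wsos_cone D" and x: "x \<in> dual_cone D"
  shows "0 \<le> s \<bullet> x"
proof (rule ccontr)
  assume "\<not> 0 \<le> s \<bullet> x"
  hence neg: "s \<bullet> x < 0" by simp
  have xc: "x \<in> carrier_vec (D + 1)" using x by (simp add: dual_cone_iff)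
  define B where "B = (\<Sum>i<D + 1. \<bar>x $ i\<bar>)"
  have B: "B \<ge> 0" by (simp add: B_def sum_nonneg)
  \<comment> \<open>Within this radius the functional changes by less than \<open>- (s . x)\<close>;
    the \<open>+ 1\<close> covers \<open>B = 0\<close>.\<close>
  define r where "r = - (s \<bullet> x) / (B + 1)"
  have "r > 0" using neg B by (simp add: r_def divide_neg_pos)
  interpret M: Metric_space "carrier_vec (D + 1)" "vec_dist (D + 1)" by (rule Metric_space_vec)
  from s obtain w where w: "w \<in> wsos_cone D" "w \<in> M.mball s r" and sc: "s \<in> carrier_vec (D + 1)"
    unfolding vec_topology_def M.metric_closure_of using \<open>r > 0\<close> by blast
  have wc: "w \<in> carrier_vec (D + 1)" and dist: "vec_dist (D + 1) s w < r"
    using w(2) unfolding M.in_mball by blast+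
  have di: "\<bar>s $ i - w $ i\<bar> \<le> r" if "i < D + 1" for i
    using abs_le_L2_set[OF that, of "\<lambda>i. s $ i - w $ i"] dist by (simp add: vec_dist_def)
  have "0 \<le> w \<bullet> x" using w(1) x by (simp add: dual_cone_def)
  moreover have "w \<bullet> x - s \<bullet> x = (\<Sum>i<D + 1. (w $ i - s $ i) * x $ i)"
    using wc sc xc by (simp add: scalar_prod_def atLeast0LessThan sum_subtractf[symmetric] algebra_simps del: sum.lessThan_Suc)
  moreover have "\<dots> \<le> (\<Sum>i<D + 1. r * \<bar>x $ i\<bar>)"
  proof (rule sum_mono)
    fix i assume "i \<in> {..<D + 1}"
    hence "\<bar>w $ i - s $ i\<bar> * \<bar>x $ i\<bar> \<le> r * \<bar>x $ i\<bar>"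
      using di[of i] by (intro mult_right_mono) (auto simp: abs_minus_commute)
    thus "(w $ i - s $ i) * x $ i \<le> r * \<bar>x $ i\<bar>"
      using abs_ge_self[of "(w $ i - s $ i) * x $ i"] unfolding abs_mult by linarith
  qed
  moreover have "\<dots> = r * B" unfolding B_def by (rule sum_distrib_left[symmetric])
  moreover have "r * B < - (s \<bullet> x)"
  proof -
    have "r * (B + 1) = - (s \<bullet> x)" using B by (simp add: r_def)
    thus ?thesis using \<open>r > 0\<close> by (simp add: distrib_left)
  qed
  ultimately show False by linarith
qed

lemma interior_of_dual_coneI:
  assumes y: "y \<in> carrier_vec (D + 1)" and r: "r > 0"
    and ball: "\<And>x. x \<in> carrier_vec (D + 1) \<Longrightarrow> vec_dist (D + 1) y x < r \<Longrightarrow> x \<in> dual_cone D"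
  shows "y \<in> vec_topology (D + 1) interior_of dual_cone D"
proof -
  interpret M: Metric_space "carrier_vec (D + 1)" "vec_dist (D + 1)" by (rule Metric_space_vec)
  have "M.mball y r \<subseteq> dual_cone D" using ball unfolding M.mball_def by blast
  moreover have "y \<in> M.mball y r" using y r by (simp only: M.centre_in_mball_iff)
  ultimately show ?thesis
    unfolding vec_topology_def interior_of_def using M.openin_mball by blast
qed

section \<open>Condition number, certificates and constants\<close>

text \<open>\<open>cond_num\<close> takes \<open>Max\<close> and \<open>Min\<close> over the real
  eigenvalues, so this set must be shown nonempty. For a complex eigenvector with real and imaginary
  parts \<open>a\<close> and \<open>b\<close>, symmetry gives
  \<open>Im \<mu> (a . a + b . b) = 0\<close>; the eigenvalue is real, and a nonzero one of
  \<open>a\<close>, \<open>b\<close> is a real eigenvector.\<close>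

lemma symm_has_eigenvalue:
  assumes A: "symm n A" and n: "n > 0"
  shows "\<exists>k. eigenvalue A k"
proof -
  note c = symm_carrier[OF A]
  let ?C = "map_mat complex_of_real A"
  have C: "?C \<in> carrier_mat n n" using c by simp
  have "degree (char_poly ?C) \<noteq> 0" using degree_monic_char_poly[OF C] n by simp
  hence "\<not> constant (poly (char_poly ?C))" by (simp add: constant_degree)
  then obtain \<mu> where "poly (char_poly ?C) \<mu> = 0" using fundamental_theorem_of_algebra by blast
  hence "eigenvalue ?C \<mu>" using eigenvalue_root_char_poly[OF C] by blast
  then obtain v where v: "v \<in> carrier_vec n" "v \<noteq> 0\<^sub>v n" "?C *\<^sub>v v = \<mu> \<cdot>\<^sub>v v"
    using C by (auto simp: eigenvalue_def eigenvector_def)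
  define a b where "a = map_vec Re v" and "b = map_vec Im v"
  have ab: "a \<in> carrier_vec n" "b \<in> carrier_vec n" using v by (simp_all add: a_def b_def)
  have row: "(\<Sum>j<n. complex_of_real (A $$ (i, j)) * v $ j) = \<mu> * v $ i" if "i < n" for i
  proof -
    have "(?C *\<^sub>v v) $ i = (\<Sum>j<n. complex_of_real (A $$ (i, j)) * v $ j)"
      using that c v(1) by (simp add: scalar_prod_def atLeast0LessThan)
    thus ?thesis using v that by simp
  qed
  have Aa: "A *\<^sub>v a = Re \<mu> \<cdot>\<^sub>v a - Im \<mu> \<cdot>\<^sub>v b"
  proof (rule eq_vecI)
    fix i assume "i < dim_vec (Re \<mu> \<cdot>\<^sub>v a - Im \<mu> \<cdot>\<^sub>v b)"
    hence i: "i < n" using ab by simp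
    have "(A *\<^sub>v a) $ i = Re (\<Sum>j<n. complex_of_real (A $$ (i, j)) * v $ j)"
      using i c v(1) by (simp add: scalar_prod_def atLeast0LessThan a_def)
    thus "(A *\<^sub>v a) $ i = (Re \<mu> \<cdot>\<^sub>v a - Im \<mu> \<cdot>\<^sub>v b) $ i"
      using i v(1) by (simp add: row a_def b_def)
  qed (use c ab in simp)
  have Ab: "A *\<^sub>v b = Im \<mu> \<cdot>\<^sub>v a + Re \<mu> \<cdot>\<^sub>v b"
  proof (rule eq_vecI)
    fix i assume "i < dim_vec (Im \<mu> \<cdot>\<^sub>v a + Re \<mu> \<cdot>\<^sub>v b)"
    hence i: "i < n" using ab by simp
    have "(A *\<^sub>v b) $ i = Im (\<Sum>j<n. complex_of_real (A $$ (i, j)) * v $ j)"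
      using i c v(1) by (simp add: scalar_prod_def atLeast0LessThan b_def)
    thus "(A *\<^sub>v b) $ i = (Im \<mu> \<cdot>\<^sub>v a + Re \<mu> \<cdot>\<^sub>v b) $ i"
      using i v(1) by (simp add: row a_def b_def)
  qed (use c ab in simp)
  have nz: "a \<noteq> 0\<^sub>v n \<or> b \<noteq> 0\<^sub>v n"
  proof (rule ccontr)
    assume *: "\<not> (a \<noteq> 0\<^sub>v n \<or> b \<noteq> 0\<^sub>v n)"
    have "v $ i = 0" if "i < n" for i
    proof -
      have "a $ i = 0" "b $ i = 0" using * that by simp_all
      thus ?thesis using that v(1) by (simp add: a_def b_def complex_eq_iff)
    qed
    thus False using v by (auto intro: eq_vecI)
  qed
  have "b \<bullet> (A *\<^sub>v a) = a \<bullet> (A *\<^sub>v b)" by (rule symm_form_comm[OF A ab(2,1)])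
  hence "Im \<mu> * (a \<bullet> a + b \<bullet> b) = 0"
    unfolding Aa Ab using ab comm_scalar_prod[OF ab]
    by (simp add: scalar_prod_add_distrib[of _ n] scalar_prod_minus_distrib[of _ n] algebra_simps)
  moreover have "a \<bullet> a + b \<bullet> b > 0"
  proof -
    have "u \<bullet> u \<ge> 0" if "u \<in> carrier_vec n" for u :: "real vec"
      using that by (auto simp: scalar_prod_def intro!: sum_nonneg)
    thus ?thesis using nz scalar_prod_self_pos ab by (metis add_nonneg_pos add_pos_nonneg)
  qed
  ultimately have "Im \<mu> = 0" by simp
  hence "A *\<^sub>v a = Re \<mu> \<cdot>\<^sub>v a" "A *\<^sub>v b = Re \<mu> \<cdot>\<^sub>v b"
    unfolding Aa Ab using ab by auto
  thus ?thesis using nz ab c unfolding eigenvalue_def eigenvector_def by auto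
qed

lemma cond_num_le:
  assumes A: "symm n A" and n: "n > 0" and l: "l > 0"
    and bounds: "\<And>k v. v \<in> carrier_vec n \<Longrightarrow> v \<noteq> 0\<^sub>v n \<Longrightarrow> A *\<^sub>v v = k \<cdot>\<^sub>v v \<Longrightarrow> l \<le> k \<and> k \<le> u"
  shows "cond_num A \<le> u / l"
proof -
  note c = symm_carrier[OF A]
  let ?S = "{k. eigenvalue A k}"
  have "char_poly A \<noteq> 0" using degree_monic_char_poly[OF c] by auto
  hence "finite {k. poly (char_poly A) k = 0}" by (rule poly_roots_finite)
  hence fin: "finite ?S" by (simp add: eigenvalue_root_char_poly[OF c])
  have ne: "?S \<noteq> {}" using symm_has_eigenvalue[OF A n] by blast
  have b: "l \<le> k \<and> k \<le> u" if "k \<in> ?S" for k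
    using that bounds c by (auto simp: eigenvalue_def eigenvector_def)
  have "l \<le> Min ?S" "Max ?S \<le> u" using fin ne b by simp_all
  moreover have "0 \<le> u" using ne b l by (metis all_not_in_conv less_le_trans order_trans less_imp_le)
  ultimately show ?thesis unfolding cond_num_def using l by (intro frac_le) auto
qed

text \<open>The matrix of part 2 for unit weights; the literal factor \<open>1\<close> makes the
  body agree with the instantiated statement.\<close>

definition node_gram :: "nat \<Rightarrow> real mat" where
  "node_gram D = mat (D + 1) (D + 1)
     (\<lambda>ij. \<Sum>z\<in>node D ` {..D}. 1 * outer (monom_vec D z) (monom_vec D z) $$ ij)"

lemma node_gram_quad_form:
  assumes D: "D > 0" and v: "v \<in> carrier_vec (D + 1)"
  shows "v \<bullet> (node_gram D *\<^sub>v v) = (\<Sum>j\<le>D. (\<Sum>i\<le>D. v $ i * node D j ^ i)\<^sup>2)"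
proof -
  have inj: "inj_on (node D) {..D}" using D by (auto simp: inj_on_def node_eq_iff)
  have c: "node_gram D \<in> carrier_mat (D + 1) (D + 1)" by (simp add: node_gram_def)
  have e: "node_gram D $$ (i, k) = (\<Sum>j\<le>D. node D j ^ i * node D j ^ k)" if "i \<le> D" "k \<le> D" for i k
    using that by (simp add: node_gram_def sum.reindex[OF inj] outer_def monom_vec_def)
  have "v \<bullet> (node_gram D *\<^sub>v v) = (\<Sum>i\<le>D. \<Sum>k\<le>D. \<Sum>j\<le>D. (v $ i * node D j ^ i) * (v $ k * node D j ^ k))"
    unfolding quad_form_sum[OF c v v] Suc_eq_plus1[symmetric] lessThan_Suc_atMost
    by (intro sum.cong refl) (simp add: e sum_distrib_left mult_ac)
  also have "\<dots> = (\<Sum>j\<le>D. \<Sum>i\<le>D. \<Sum>k\<le>D. (v $ i * node D j ^ i) * (v $ k * node D j ^ k))"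
    by (subst sum.swap[of _ "{..D}" "{..D}"], subst sum.swap[of "\<lambda>k j. sum (_ k j) _"]) simp
  also have "\<dots> = (\<Sum>j\<le>D. (\<Sum>i\<le>D. v $ i * node D j ^ i)\<^sup>2)"
    by (simp add: power2_eq_square sum_product)
  finally show ?thesis .
qed

text \<open>For an eigenvector \<open>v\<close> with eigenvalue \<open>k\<close>,
  \<open>k (v . v)\<close> is the sum of the squared node values of the polynomial with coefficients
  \<open>v\<close>. Each value is at most the coefficient sum \<open>s\<close>, and
  \<open>s^2\<close> is at most \<open>n (v . v)\<close>, so \<open>k\<close> is at most
  \<open>n^2\<close>. Conversely \<open>s\<close> is at most \<open>K\<close> times the sum of the
  absolute node values, and \<open>v . v\<close> is at most \<open>s^2\<close>, so \<open>k\<close>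
  is at least \<open>1 / (K^2 n)\<close>.\<close>

lemma node_gram_cond:
  assumes D: "D > 0"
  shows "cond_num (node_gram D) \<le> real (D + 1) ^ 3 * (interp_const D)\<^sup>2"
proof -
  let ?n = "real (D + 1)"
  let ?K = "interp_const D"
  have K: "?K > 0" by (rule interp_const_pos)
  have "cond_num (node_gram D) \<le> ?n\<^sup>2 / (1 / (?K\<^sup>2 * ?n))"
  proof (rule cond_num_le[of "D + 1"])
    show "symm (D + 1) (node_gram D)"
      by (rule symmI) (auto simp: node_gram_def outer_def monom_vec_def mult.commute)
    show "0 < 1 / (?K\<^sup>2 * ?n)" using K by simp
    fix k and v :: "real vec"
    assume v: "v \<in> carrier_vec (D + 1)" "v \<noteq> 0\<^sub>v (D + 1)" "node_gram D *\<^sub>v v = k \<cdot>\<^sub>v v"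
    define N where "N = v \<bullet> v"
    have N: "N > 0" unfolding N_def by (rule scalar_prod_self_pos[OF v(1,2)])
    have N_eq: "N = (\<Sum>i\<le>D. (v $ i)\<^sup>2)"
      using v(1) by (simp add: N_def scalar_prod_def power2_eq_square atLeast0LessThan lessThan_Suc_atMost)
    define q where "q j = (\<Sum>i\<le>D. v $ i * node D j ^ i)" for j
    have kN: "k * N = (\<Sum>j\<le>D. (q j)\<^sup>2)"
      using node_gram_quad_form[OF D v(1)] v by (simp add: N_def q_def)
    define s where "s = (\<Sum>i\<le>D. \<bar>v $ i\<bar>)"
    have s0: "s \<ge> 0" by (simp add: s_def sum_nonneg)
    have s2: "s\<^sup>2 \<le> N * ?n"
      using sum_squared_le_sum_of_squares[of "\<lambda>i. \<bar>v $ i\<bar>" "{..D}"] by (simp add: s_def N_eq)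
    have Ns: "N \<le> s\<^sup>2"
    proof -
      have "N = (\<Sum>i\<le>D. \<bar>v $ i\<bar> * \<bar>v $ i\<bar>)" by (simp add: N_eq power2_eq_square)
      also have "\<dots> \<le> (\<Sum>i\<le>D. \<bar>v $ i\<bar> * s)"
        unfolding s_def by (intro sum_mono mult_left_mono member_le_sum) auto
      also have "\<dots> = s\<^sup>2" by (simp add: s_def sum_distrib_right[symmetric] power2_eq_square)
      finally show ?thesis .
    qed
    have qs: "\<bar>q j\<bar> \<le> s" if "j \<le> D" for j
      unfolding q_def s_def
    proof (intro order_trans[OF sum_abs] sum_mono)
      fix i assume "i \<in> {..D}"
      have "\<bar>node D j\<bar> \<le> 1" using node_in[OF D that] by (auto simp: abs_le_iff)
      hence "\<bar>node D j\<bar> ^ i \<le> 1" by (intro power_le_one) auto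
      thus "\<bar>v $ i * node D j ^ i\<bar> \<le> \<bar>v $ i\<bar>"
        by (simp add: abs_mult power_abs mult_left_le)
    qed
    have "k * N \<le> (\<Sum>j\<le>D. s\<^sup>2)"
      unfolding kN using qs s0 by (intro sum_mono) (simp add: abs_le_square_iff[symmetric])
    also have "\<dots> \<le> ?n * (N * ?n)"
      using mult_left_mono[OF s2, of ?n] by (simp del: of_nat_Suc)
    finally have upper: "k \<le> ?n\<^sup>2" using N by (simp add: power2_eq_square mult_ac)
    define p where "p = Poly (list_of_vec v)"
    have co: "coeff p i = (if i < D + 1 then v $ i else 0)" for i
      using v(1) by (auto simp: p_def coeff_Poly_eq nth_default_def list_of_vec_index)
    have deg: "degree p \<le> D" by (rule degree_le) (auto simp: co)
    have "poly p z = (\<Sum>i\<le>D. v $ i * z ^ i)" for z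
      using pairing_monom_vec[OF deg, of z] by (simp add: pairing_def co monom_vec_def)
    hence pq: "poly p (node D j) = q j" for j by (simp add: q_def)
    have "s \<le> ?K * (\<Sum>j\<le>D. \<bar>q j\<bar>)"
      using l1_le_node_values[OF D deg, of D] by (simp add: l1_def co s_def pq)
    hence "s\<^sup>2 \<le> (?K * (\<Sum>j\<le>D. \<bar>q j\<bar>))\<^sup>2" using s0 by (rule power_mono)
    also have "\<dots> = ?K\<^sup>2 * (\<Sum>j\<le>D. \<bar>q j\<bar>)\<^sup>2" by (rule power_mult_distrib)
    also have "\<dots> \<le> ?K\<^sup>2 * (k * N * ?n)"
      using sum_squared_le_sum_of_squares[of "\<lambda>j. \<bar>q j\<bar>" "{..D}"] by (intro mult_left_mono) (simp_all add: kN)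
    finally have "N \<le> ?K\<^sup>2 * ?n * k * N" using Ns by (simp add: mult_ac)
    hence "1 \<le> ?K\<^sup>2 * ?n * k" using N by simp
    moreover have "0 < ?K\<^sup>2 * ?n" using K by simp
    ultimately have "1 / (?K\<^sup>2 * ?n) \<le> k" by (simp only: pos_divide_le_eq mult.commute)
    with upper show "1 / (?K\<^sup>2 * ?n) \<le> k \<and> k \<le> ?n\<^sup>2" by blast
  qed simp
  also have "\<dots> = ?n ^ 3 * ?K\<^sup>2" by (simp add: power2_eq_square power3_eq_cube)
  finally show ?thesis .
qed

lemma unisolvent_nodes: "D > 0 \<Longrightarrow> unisolvent D (node D ` {..D})"
  unfolding unisolvent_def
proof (intro allI impI)
  fix p q :: "real poly"
  assume D: "D > 0" and pq: "degree p \<le> D \<and> degree q \<le> D \<and> (\<forall>z\<in>node D ` {..D}. poly p z = poly q z)"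
  have "card (node D ` {..D}) = D + 1"
    using D by (subst card_image) (auto simp: inj_on_def node_eq_iff)
  thus "p = q" using pq by (intro poly_eqI_degree[of "node D ` {..D}"]) auto
qed

section \<open>Absorbing polynomial factors into the geometric rate\<close>

text \<open>Numerically, \<open>2 e < 5.44 < 5.76 = 2.4^2\<close>; strictness is what pays for every
  polynomial factor.\<close>

lemma exp_1_less: "2 * exp 1 < (1 + sqrt 2 :: real)\<^sup>2"
proof -
  have "1.4 \<le> sqrt 2" by (rule real_le_rsqrt) (simp add: power2_eq_square)
  thus ?thesis using e_less_272 by (simp add: power2_eq_square algebra_simps)
qed

text \<open>The fourth power covers both uses: \<open>n^3\<close> from the condition number times
  \<open>sqrt n\<close>, and \<open>n^3\<close> from the certificate. The constant exists because
  \<open>n^4 r^n\<close> tends to 0 for a ratio \<open>r < 1\<close>.\<close>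

lemma growth_bound:
  obtains C :: real where "C \<ge> 1" "\<And>n :: nat. real n ^ 4 * (2 * exp 1) ^ n \<le> C * (1 + sqrt 2) ^ (2 * n)"
proof -
  define r where "r = 2 * exp 1 / (1 + sqrt 2 :: real)\<^sup>2"
  have pos: "(1 + sqrt 2 :: real)\<^sup>2 > 0" by (intro zero_less_power add_pos_nonneg) auto
  have r: "0 < r" "r < 1" using exp_1_less pos by (auto simp: r_def)
  have "(\<lambda>n. real n ^ 4 * r ^ n) \<longlonglongrightarrow> 0" using r by real_asymp
  hence "Bseq (\<lambda>n. real n ^ 4 * r ^ n)" by (intro convergent_imp_Bseq) (auto simp: convergent_def)
  then obtain B where B: "\<And>n. norm (real n ^ 4 * r ^ n) \<le> B" by (auto simp: Bseq_def)
  have "real n ^ 4 * (2 * exp 1) ^ n \<le> max 1 B * (1 + sqrt 2) ^ (2 * n)" for n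
  proof -
    have "(2 * exp 1) ^ n = r ^ n * (1 + sqrt 2) ^ (2 * n)"
      using pos by (simp add: r_def power_divide power_mult)
    moreover have "real n ^ 4 * r ^ n \<le> max 1 B" using B[of n] by (simp add: abs_le_iff le_max_iff_disj)
    ultimately show ?thesis
      using mult_right_mono[of "real n ^ 4 * r ^ n" "max 1 B" "(1 + sqrt 2) ^ (2 * n)"] by (simp add: mult_ac)
  qed
  thus ?thesis by (intro that[of "max 1 B"]) auto
qed

lemma linf_norm_le:
  assumes "v \<in> carrier_vec n" "n > 0" "\<And>i. i < n \<Longrightarrow> \<bar>v $ i\<bar> \<le> b"
  shows "linf_norm v \<le> b"
  unfolding linf_norm_def using assms by (subst Max_le_iff) (auto simp: lessThan_empty_iff)

lemma abs_le_linf_norm: "i < dim_vec v \<Longrightarrow> \<bar>v $ i\<bar> \<le> linf_norm v"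
  unfolding linf_norm_def by (intro Max_ge) auto

section \<open>The three assertions\<close>

lemma min_at_zero_evaluation:
  assumes D: "D > 0"
  shows "\<exists>v. is_arg_min (\<lambda>v. coeff_vec D 1 \<bullet> v) (\<lambda>v. v \<in> dual_cone D \<and> linf_norm v = 1) v \<and>
    coeff_vec D 1 \<bullet> v \<ge> 1"
proof -
  let ?v = "monom_vec D 0"
  have val: "coeff_vec D 1 \<bullet> v = v $ 0" if "v \<in> dual_cone D" for v
    using that by (simp add: dual_cone_iff coeff_vec_scalar_prod pairing_one)
  have le: "linf_norm v \<le> v $ 0" if "v \<in> dual_cone D" for v
    using that dual_cone_abs_le[OF that] by (intro linf_norm_le[of _ "D + 1"]) (auto simp: dual_cone_iff)
  have v: "?v \<in> dual_cone D" by (rule monom_vec_dual[OF D]) simp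
  have v0: "?v $ 0 = 1" by (simp add: monom_vec_def)
  have "1 \<le> linf_norm ?v" using abs_le_linf_norm[of 0 ?v] by (simp add: monom_vec_def)
  hence n: "linf_norm ?v = 1" using le[OF v] v0 by simp
  have "1 \<le> coeff_vec D 1 \<bullet> w" if "w \<in> dual_cone D" "linf_norm w = 1" for w
    using le[OF that(1)] val[OF that(1)] that(2) by simp
  thus ?thesis
    using v n v0 val[OF v] by (intro exI[of _ ?v]) (auto simp: is_arg_min_def not_less)
qed

lemma node_functional_carrier: "node_functional D \<in> carrier_vec (D + 1)"
  by (simp add: node_functional_def)

text \<open>\<open>n^3\<close> arises as the matrix size, at most \<open>n\<close>, times the bound
  \<open>n^2\<close> for the pairing with the node functional relative to the norm of
  \<open>t\<close>. The first claim turns the additive rounding error into part of the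
  multiplicative bound, and later makes the logarithm of the quotient nonnegative.\<close>

lemma integer_certificate_bound:
  assumes D: "D > 0" and ps: "poly_basis (deg1 D) ps1" "poly_basis (deg2 D) ps2"
    and t: "t \<in> vec_topology (D + 1) interior_of wsos_cone D" and \<epsilon>: "\<epsilon> > 0"
    and fr: "t - \<epsilon> \<cdot>\<^sub>v coeff_vec D 1 \<in> vec_topology (D + 1) frontier_of wsos_cone D"
  shows "1 \<le> l2_norm t / \<epsilon>"
    and "\<exists>y. dual_certificate D ps1 ps2 y t \<and> (\<forall>i<D + 1. y $ i \<in> \<int>) \<and>
      linf_norm y \<le> 3 * real (D + 1) ^ 3 * interp_const D * (l2_norm t / \<epsilon>)"
proof -
  interpret wsos_bases D ps1 ps2 by (rule wsos_bases.intro[OF D ps])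
  have tS: "t \<in> wsos_cone D" by (rule subsetD[OF interior_of_subset t])
  then obtain p where "t = coeff_vec D p" unfolding wsos_cone_eq by blast
  hence tc: "t \<in> carrier_vec (D + 1)" by (simp only: coeff_vec_carrier)
  hence t': "t \<in> carrier_vec (Suc D)" by simp
  have bound: "\<bar>x $ i\<bar> \<le> 1 / \<epsilon> * (t \<bullet> x)" if x: "x \<in> dual_cone D" and i: "i < Suc D" for x i
  proof -
    have xc: "x \<in> carrier_vec (D + 1)" using x by (simp add: dual_cone_iff)
    have "t - \<epsilon> \<cdot>\<^sub>v coeff_vec D 1 \<in> vec_topology (D + 1) closure_of wsos_cone D"
      using fr by (simp add: frontier_of_def)
    hence "0 \<le> (t - \<epsilon> \<cdot>\<^sub>v coeff_vec D 1) \<bullet> x" by (rule dual_nonneg_on_closure[OF _ x])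
    also have "\<dots> = t \<bullet> x - \<epsilon> * (coeff_vec D 1 \<bullet> x)"
      using t' xc coeff_vec_carrier[of D 1] by (subst minus_scalar_prod_distrib[of _ "Suc D"]) auto
    finally have "\<epsilon> * x $ 0 \<le> t \<bullet> x" using coeff_vec_scalar_prod[OF xc] by (simp add: pairing_one)
    hence "x $ 0 \<le> 1 / \<epsilon> * (t \<bullet> x)" using \<epsilon> by (simp add: field_simps)
    thus ?thesis using dual_cone_abs_le[OF x, of i] i by simp
  qed
  have l2: "\<bar>t $ i\<bar> \<le> l2_norm t" if "i < D + 1" for i
    using abs_le_L2_set[of i "D + 1"] that tc by (simp add: l2_norm_def)
  \<comment> \<open>Evaluation at 0 is a dual vector, so the constant coefficient of
    \<open>t\<close> is at least \<open>\<epsilon>\<close>.\<close>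
  show one: "1 \<le> l2_norm t / \<epsilon>"
  proof -
    have x: "monom_vec D 0 \<in> dual_cone D" by (rule monom_vec_dual[OF D]) simp
    have "t \<bullet> monom_vec D 0 = (\<Sum>i<D + 1. t $ i * 0 ^ i)"
      by (simp add: monom_vec_def scalar_prod_def atLeast0LessThan del: sum.lessThan_Suc)
    also have "\<dots> = (\<Sum>i<D + 1. if i = 0 then t $ i else 0)"
      by (intro sum.cong) auto
    also have "\<dots> = t $ 0" by (subst sum.delta) auto
    finally have "1 \<le> 1 / \<epsilon> * (t $ 0)" using bound[OF x, of 0] by (simp add: monom_vec_def)
    hence "\<epsilon> \<le> t $ 0" using \<epsilon> by (simp add: field_simps)
    hence "\<epsilon> \<le> l2_norm t" using l2[of 0] by simp
    thus ?thesis using \<epsilon> by simp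
  qed
  define n where "n = real (D + 1)"
  have n: "n \<ge> 1" by (simp add: n_def)
  let ?e = "node_functional D"
  let ?K = "interp_const D"
  have K: "?K \<ge> 1"
  proof -
    have "1 \<le> 2 * exp (1 :: real)" using exp_ge_add_one_self[of 1] by simp
    thus ?thesis unfolding interp_const_def by (rule one_le_power)
  qed
  have e: "?e \<in> carrier_vec (Suc D)" using node_functional_carrier[of D] by simp
  have te: "t \<bullet> ?e \<le> n ^ 2 * l2_norm t"
  proof -
    have en: "\<bar>?e $ i\<bar> \<le> n" if "i < D + 1" for i
    proof -
      have "\<bar>node D j ^ i\<bar> \<le> 1" if "j \<le> D" for j
      proof -
        have "\<bar>node D j\<bar> \<le> 1" using node_in[OF D that] by (auto simp: abs_le_iff)
        thus ?thesis unfolding power_abs by (intro power_le_one) auto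
      qed
      hence "(\<Sum>j\<le>D. \<bar>node D j ^ i\<bar>) \<le> (\<Sum>j\<le>D. 1)" by (intro sum_mono) auto
      thus ?thesis
        using that order_trans[OF sum_abs[of "\<lambda>j. node D j ^ i" "{..D}"]]
        by (simp add: node_functional_def n_def)
    qed
    have "t \<bullet> ?e = (\<Sum>i<D + 1. t $ i * ?e $ i)"
      using e by (simp add: scalar_prod_def atLeast0LessThan del: sum.lessThan_Suc)
    also have "\<dots> \<le> (\<Sum>i<D + 1. l2_norm t * n)"
    proof (rule sum_mono)
      fix i assume i: "i \<in> {..<D + 1}"
      have "\<bar>t $ i\<bar> * \<bar>?e $ i\<bar> \<le> l2_norm t * n"
        using i l2[of i] en[of i] by (intro mult_mono) auto
      thus "t $ i * ?e $ i \<le> l2_norm t * n"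
        using abs_ge_self[of "t $ i * ?e $ i"] unfolding abs_mult by linarith
    qed
    also have "\<dots> = n ^ 2 * l2_norm t" by (simp add: n_def power2_eq_square del: sum.lessThan_Suc of_nat_Suc)
    finally show ?thesis .
  qed
  have "\<exists>y\<in>carrier_vec (Suc D). (\<forall>i<Suc D. y $ i \<in> \<int> \<and>
      \<bar>y $ i\<bar> \<le> 2 * ?K * (1 / \<epsilon>) * real m * (t \<bullet> ?e) + 1 / 2) \<and> pd m (L y) \<and>
      (\<exists>H\<in>carrier_mat (Suc D) (Suc D). inverts_mat (hessian (Suc D) (barrier D ps1 ps2) y) H \<and>
        inverts_mat H (hessian (Suc D) (barrier D ps1 ps2) y) \<and> psd m (L (H *\<^sub>v t)))"
  \<comment> \<open>Here \<open>e\<close> is the node functional, \<open>k\<close> the interpolation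
    constant and \<open>B = 1 / \<epsilon>\<close>.\<close>
  proof (rule integer_certificate[OF t' dimension_bounds(1) _ e pd_node_functional _ _ _ neg_log_det_barrier])
    show "\<bar>x $ i\<bar> \<le> 1 / \<epsilon> * (t \<bullet> x)" if "x \<in> carrier_vec (Suc D)" "psd m (L x)" "i < Suc D" for x i
      using bound that psd_L_iff[OF that(1)] by blast
    show "psd m (L (?K \<cdot>\<^sub>v ?e + u))"
      if u: "u \<in> carrier_vec (Suc D)" "\<And>i. i < Suc D \<Longrightarrow> \<bar>u $ i\<bar> \<le> 1 / 2" for u
      using node_functional_dominates[OF D, of u] u e psd_L_iff[of "?K \<cdot>\<^sub>v ?e + u"] by simp
  qed (use K \<epsilon> in auto)
  then obtain y H where y: "y \<in> carrier_vec (Suc D)" and yi: "\<And>i. i < Suc D \<Longrightarrow> y $ i \<in> \<int>"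
      "\<And>i. i < Suc D \<Longrightarrow> \<bar>y $ i\<bar> \<le> 2 * ?K * (1 / \<epsilon>) * real m * (t \<bullet> ?e) + 1 / 2"
    and Y: "pd m (L y)" and H: "H \<in> carrier_mat (Suc D) (Suc D)"
      "inverts_mat (hessian (Suc D) (barrier D ps1 ps2) y) H"
      "inverts_mat H (hessian (Suc D) (barrier D ps1 ps2) y)" "psd m (L (H *\<^sub>v t))"
    by blast
  have "y \<in> vec_topology (D + 1) interior_of dual_cone D"
  proof -
    obtain r where "r > 0" "\<And>x. x \<in> carrier_vec (Suc D) \<Longrightarrow> vec_dist (Suc D) y x < r \<Longrightarrow> psd m (L x)"
      using pd_neighbourhood[OF y Y] by blast
    thus ?thesis using y psd_L_iff by (intro interior_of_dual_coneI[of y D r]) auto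
  qed
  moreover have "H *\<^sub>v t \<in> dual_cone D"
    using psd_L_iff[of "H *\<^sub>v t"] H(1,4) t' by simp
  ultimately have cert: "dual_certificate D ps1 ps2 y t"
    unfolding dual_certificate_def Let_def using tS H(1-3) by auto
  have "linf_norm y \<le> 3 * n ^ 3 * ?K * (l2_norm t / \<epsilon>)"
  proof (rule linf_norm_le[OF y])
    fix i assume "i < Suc D"
    hence "\<bar>y $ i\<bar> \<le> 2 * ?K * (1 / \<epsilon>) * (real m * (t \<bullet> ?e)) + 1 / 2" using yi(2) by (simp add: mult.assoc)
    also have "real m * (t \<bullet> ?e) \<le> n * (n ^ 2 * l2_norm t)"
    proof (rule order_trans[OF mult_left_mono[OF te] mult_right_mono])
      show "real m \<le> n" using dimension_bounds(2) by (simp add: n_def)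
      show "0 \<le> n\<^sup>2 * l2_norm t" by (simp add: l2_norm_def)
    qed simp
    hence "2 * ?K * (1 / \<epsilon>) * (real m * (t \<bullet> ?e)) \<le> 2 * ?K * (1 / \<epsilon>) * (n * (n ^ 2 * l2_norm t))"
      using K \<epsilon> by (intro mult_left_mono) auto
    also have "\<dots> = 2 * n ^ 3 * ?K * (l2_norm t / \<epsilon>)" by (simp add: power2_eq_square power3_eq_cube)
    finally have "\<bar>y $ i\<bar> \<le> 2 * n ^ 3 * ?K * (l2_norm t / \<epsilon>) + 1 / 2" by simp
    moreover have "1 \<le> n ^ 3 * ?K * (l2_norm t / \<epsilon>)"
    proof -
      have "1 \<le> n ^ 3" using n by (rule one_le_power)
      hence "1 * 1 \<le> n ^ 3 * ?K" using K n by (intro mult_mono) auto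
      hence "1 * 1 \<le> n ^ 3 * ?K * (l2_norm t / \<epsilon>)" using one by (intro mult_mono) auto
      thus ?thesis by simp
    qed
    ultimately show "\<bar>y $ i\<bar> \<le> 3 * n ^ 3 * ?K * (l2_norm t / \<epsilon>)" by linarith
  qed simp
  with cert yi(1) show "\<exists>y. dual_certificate D ps1 ps2 y t \<and> (\<forall>i<D + 1. y $ i \<in> \<int>) \<and>
      linf_norm y \<le> 3 * real (D + 1) ^ 3 * ?K * (l2_norm t / \<epsilon>)"
    unfolding n_def by (intro exI[of _ y]) simp
qed

text \<open>\<open>ln (1 + sqrt 2)\<close> is at most 2 and \<open>ln d\<close> at most
  \<open>d\<close>, so the terms in \<open>d\<close> add up to at most
  \<open>(5/4) d + 2 (4 d + 4)\<close>, which the constant 20 covers.\<close>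

lemma log_bound:
  fixes C q x :: real
  assumes C: "C \<ge> 1" and d: "d \<ge> (1 :: nat)" and q: "q \<ge> 1" and C': "C' \<ge> C + 20"
    and x: "x \<le> C * real d powr (5/4) * (1 + sqrt 2) ^ (4 * d + 4) * q" and x0: "0 \<le> x"
  shows "ln x \<le> C' * (1 + real d + ln q)"
\<comment> \<open>At 0 the convention \<open>ln 0 = 0\<close> applies, so monotonicity of the
  logarithm cannot be used there.\<close>
proof (cases "x = 0")
  case True
  have "0 \<le> C' * (1 + real d + ln q)" using C C' q by (intro mult_nonneg_nonneg add_nonneg_nonneg) auto
  thus ?thesis using True by simp
next
  case False
  have s: "0 < 1 + sqrt (2 :: real)" by (simp add: add_pos_nonneg)
  have s3: "ln (1 + sqrt 2 :: real) \<le> 2"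
  proof -
    have "ln (1 + sqrt 2 :: real) \<le> sqrt 2" by (rule ln_add_one_self_le_self) simp
    also have "\<dots> \<le> 2" by (rule real_le_lsqrt) auto
    finally show ?thesis .
  qed
  have pw: "real d powr (5/4) > 0" using d by simp
  have "ln x \<le> ln (C * real d powr (5/4) * (1 + sqrt 2) ^ (4 * d + 4) * q)"
    using x x0 False by simp
  also have "\<dots> = ln C + 5/4 * ln (real d) + real (4 * d + 4) * ln (1 + sqrt 2) + ln q"
    using C d q s pw by (simp add: ln_mult ln_powr ln_realpow)
  also have "\<dots> \<le> C + 5/4 * real d + real (4 * d + 4) * 2 + ln q"
    using ln_bound[of C] ln_bound[of "real d"] C d s3
    by (intro add_mono mult_left_mono order_refl) auto
  also have "\<dots> \<le> (C + 20) * (1 + real d + ln q)"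
  proof -
    have "0 \<le> ln q" using q by simp
    moreover have "0 \<le> C * real d" "0 \<le> C * ln q" using C \<open>0 \<le> ln q\<close> by simp_all
    ultimately show ?thesis by (simp add: algebra_simps)
  qed
  also have "\<dots> \<le> C' * (1 + real d + ln q)"
    using C' q by (intro mult_right_mono add_nonneg_nonneg) auto
  finally show ?thesis .
qed

theorem theorem3p6:
  shows "\<exists>C::real. C > 0 \<and> (\<forall>d D :: nat. d \<ge> 1 \<longrightarrow> D \<in> {2 * d, 2 * d + 1} \<longrightarrow>
    (\<exists>v. is_arg_min (\<lambda>v. coeff_vec D 1 \<bullet> v) (\<lambda>v. v \<in> dual_cone D \<and> linf_norm v = 1) v \<and>
         coeff_vec D 1 \<bullet> v \<ge> 1) \<and>
    (\<exists>Z \<alpha>. finite Z \<and> Z \<subseteq> {-1..1} \<and> unisolvent D Z \<and> (\<forall>z\<in>Z. \<alpha> z > 0) \<and>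
         cond_num (mat (D + 1) (D + 1) (\<lambda>ij. \<Sum>z\<in>Z. \<alpha> z * outer (monom_vec D z) (monom_vec D z) $$ ij))
           \<le> C * (1 + sqrt 2) ^ (4 * (D + 1)) / sqrt (real (D + 1))) \<and>
    (\<forall>ps1 ps2. poly_basis (deg1 D) ps1 \<longrightarrow> poly_basis (deg2 D) ps2 \<longrightarrow>
       (\<forall>t \<epsilon>. t \<in> vec_topology (D + 1) interior_of wsos_cone D \<longrightarrow> \<epsilon> > 0 \<longrightarrow>
          t - \<epsilon> \<cdot>\<^sub>v coeff_vec D 1 \<in> vec_topology (D + 1) frontier_of wsos_cone D \<longrightarrow>
          (\<exists>y. dual_certificate D ps1 ps2 y t \<and> (\<forall>i<D + 1. y $ i \<in> \<int>) \<and>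
             linf_norm y \<le> C * real d powr (5/4) * (1 + sqrt 2) ^ (4 * d + 4) * (l2_norm t / \<epsilon>) \<and>
             ln (linf_norm y) \<le> C * (1 + real d + ln (l2_norm t) + ln (1 / \<epsilon>))))))"
proof -
  obtain B :: real where B: "B \<ge> 1"
    and growth: "\<And>n :: nat. real n ^ 4 * (2 * exp 1) ^ n \<le> B * (1 + sqrt 2) ^ (2 * n)"
    using growth_bound by blast
  \<comment> \<open>The factor 3 comes from \<open>integer_certificate_bound\<close>, the summand 20
    from \<open>log_bound\<close>.\<close>
  define C where "C = 3 * B + 20"
  have K_le: "interp_const D \<le> (2 * exp 1) ^ k" if "D \<le> k" for D k
  proof -
    have "1 \<le> 2 * exp (1 :: real)" using exp_ge_add_one_self[of 1] by simp
    thus ?thesis unfolding interp_const_def using that by (rule power_increasing[rotated])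
  qed
  have s: "1 \<le> 1 + sqrt (2 :: real)" by simp
  have cond: "\<exists>Z \<alpha>. finite Z \<and> Z \<subseteq> {-1..1} \<and> unisolvent D Z \<and> (\<forall>z\<in>Z. \<alpha> z > 0) \<and>
      cond_num (mat (D + 1) (D + 1) (\<lambda>ij. \<Sum>z\<in>Z. \<alpha> z * outer (monom_vec D z) (monom_vec D z) $$ ij))
        \<le> C * (1 + sqrt 2) ^ (4 * (D + 1)) / sqrt (real (D + 1))" if D: "D > 0" for D
  proof (intro exI[of _ "node D ` {..D}"] exI[of _ "\<lambda>_. 1"] conjI)
    show "node D ` {..D} \<subseteq> {- 1..1}" using node_in[OF D] by auto
    show "unisolvent D (node D ` {..D})" by (rule unisolvent_nodes[OF D])
    let ?n = "real (D + 1)"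
    let ?a = "(2 * exp 1) ^ (D + 1) :: real"
    have sq: "sqrt ?n \<le> ?n" by (rule real_le_lsqrt) (auto simp: power2_eq_square)
    have "cond_num (node_gram D) * sqrt ?n \<le> ?n ^ 3 * (interp_const D)\<^sup>2 * ?n"
      using node_gram_cond[OF D] sq interp_const_pos[of D] by (intro mult_mono) auto
    also have "\<dots> \<le> ?n ^ 3 * ?a\<^sup>2 * ?n"
      using K_le[of D "D + 1"] interp_const_pos[of D] by (intro mult_left_mono mult_right_mono power_mono) auto
    \<comment> \<open>One factor \<open>?a\<close> absorbs \<open>?n ^ 4\<close> through
      \<open>growth\<close>; the other is bounded directly by \<open>exp_1_less\<close>. The
      exponents \<open>2 (D + 1)\<close> add up to \<open>4 (D + 1)\<close>.\<close>
    also have "\<dots> = (?n ^ 4 * ?a) * ?a" by (simp add: power2_eq_square power_numeral_reduce)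
    also have "\<dots> \<le> (B * (1 + sqrt 2) ^ (2 * (D + 1))) * (1 + sqrt 2) ^ (2 * (D + 1))"
    proof (rule mult_mono[OF growth])
      have "?a \<le> ((1 + sqrt 2)\<^sup>2) ^ (D + 1)" using exp_1_less by (intro power_mono) auto
      thus "?a \<le> (1 + sqrt 2) ^ (2 * (D + 1))" by (simp only: power_mult)
    qed (use B in auto)
    also have "\<dots> = B * (1 + sqrt 2) ^ (4 * (D + 1))"
    proof -
      have "4 * (D + 1) = 2 * (D + 1) + 2 * (D + 1)" by simp
      thus ?thesis by (simp only: power_add mult.assoc)
    qed
    also have "\<dots> \<le> C * (1 + sqrt 2) ^ (4 * (D + 1))"
      using B s by (intro mult_right_mono zero_le_power) (auto simp: C_def)
    finally show "cond_num (mat (D + 1) (D + 1) (\<lambda>ij. \<Sum>z\<in>node D ` {..D}. 1 *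
        outer (monom_vec D z) (monom_vec D z) $$ ij)) \<le> C * (1 + sqrt 2) ^ (4 * (D + 1)) / sqrt ?n"
      unfolding node_gram_def[symmetric] by (subst pos_le_divide_eq) auto
  qed auto
  have cert: "\<exists>y. dual_certificate D ps1 ps2 y t \<and> (\<forall>i<D + 1. y $ i \<in> \<int>) \<and>
      linf_norm y \<le> C * real d powr (5/4) * (1 + sqrt 2) ^ (4 * d + 4) * (l2_norm t / \<epsilon>) \<and>
      ln (linf_norm y) \<le> C * (1 + real d + ln (l2_norm t) + ln (1 / \<epsilon>))"
    if d: "d \<ge> 1" and D: "D \<in> {2 * d, 2 * d + 1}" and ps: "poly_basis (deg1 D) ps1" "poly_basis (deg2 D) ps2"
      and t: "t \<in> vec_topology (D + 1) interior_of wsos_cone D" and \<epsilon>: "\<epsilon> > 0"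
      and fr: "t - \<epsilon> \<cdot>\<^sub>v coeff_vec D 1 \<in> vec_topology (D + 1) frontier_of wsos_cone D"
    for d D ps1 ps2 t \<epsilon>
  proof -
    have D0: "D > 0" and Dk: "D + 1 \<le> 2 * d + 2" using d D by auto
    note cb = integer_certificate_bound[OF D0 ps t \<epsilon> fr]
    define q where "q = l2_norm t / \<epsilon>"
    have q: "q \<ge> 1" using cb(1) by (simp add: q_def)
    obtain y where y: "dual_certificate D ps1 ps2 y t" "\<forall>i<D + 1. y $ i \<in> \<int>"
      and le: "linf_norm y \<le> 3 * real (D + 1) ^ 3 * interp_const D * q"
      using cb(2) unfolding q_def by blast
    let ?k = "2 * d + 2"
    have "real (D + 1) ^ 3 \<le> real ?k ^ 3" using Dk by (intro power_mono) auto
    also have "\<dots> \<le> real ?k ^ 4" by (intro power_increasing) auto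
    finally have "real (D + 1) ^ 3 * interp_const D \<le> real ?k ^ 4 * (2 * exp 1) ^ ?k"
      using K_le[of D ?k] Dk interp_const_pos[of D] by (intro mult_mono) auto
    also have "\<dots> \<le> B * (1 + sqrt 2) ^ (2 * ?k)" by (rule growth)
    also have "2 * ?k = 4 * d + 4" by simp
    \<comment> \<open>\<open>D + 1\<close> is at most \<open>2 d + 2\<close>, whose double is the
      exponent \<open>4 d + 4\<close>. Since \<open>d\<close> is at least 1, inserting
      \<open>d powr (5/4)\<close> only weakens the bound to the stated shape.\<close>
    also have "B * (1 + sqrt 2) ^ (4 * d + 4) \<le> B * real d powr (5/4) * (1 + sqrt 2) ^ (4 * d + 4)"
      using B d ge_one_powr_ge_zero[of "real d" "5/4"] by (intro mult_right_mono) auto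
    finally have "3 * (real (D + 1) ^ 3 * interp_const D) \<le> 3 * (B * real d powr (5/4) * (1 + sqrt 2) ^ (4 * d + 4))"
      by (rule mult_left_mono) simp
    hence "3 * (real (D + 1) ^ 3 * interp_const D) * q \<le> 3 * (B * real d powr (5/4) * (1 + sqrt 2) ^ (4 * d + 4)) * q"
      using q by (intro mult_right_mono) auto
    hence b: "linf_norm y \<le> 3 * B * real d powr (5/4) * (1 + sqrt 2) ^ (4 * d + 4) * q"
      using le by (simp add: mult.assoc)
    also have "\<dots> \<le> C * real d powr (5/4) * (1 + sqrt 2) ^ (4 * d + 4) * q"
      using q s B by (intro mult_right_mono zero_le_power) (auto simp: C_def)
    finally have b': "linf_norm y \<le> C * real d powr (5/4) * (1 + sqrt 2) ^ (4 * d + 4) * q" .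
    have "y \<in> carrier_vec (D + 1)"
      using y(1) interior_of_subset_topspace[of "vec_topology (D + 1)"]
      by (auto simp: dual_certificate_def topspace_vec_topology)
    hence "0 \<le> linf_norm y" using abs_le_linf_norm[of 0 y] by simp
    hence "ln (linf_norm y) \<le> C * (1 + real d + ln q)"
      using B d q by (intro log_bound[OF _ d q _ b]) (auto simp: C_def)
    also have "ln q = ln (l2_norm t) + ln (1 / \<epsilon>)"
    proof -
      have "0 < l2_norm t" using q \<epsilon> by (simp add: q_def)
      thus ?thesis using \<epsilon> by (simp add: q_def ln_div)
    qed
    finally show ?thesis using y b' unfolding q_def by (intro exI[of _ y]) (simp add: add.assoc)
  qed
  show ?thesis
  proof (intro exI[of _ C] conjI allI impI)
    show "C > 0" using B by (simp add: C_def)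
  next
    fix d D :: nat assume "1 \<le> d" "D \<in> {2 * d, 2 * d + 1}"
    hence D: "D > 0" by auto
    show "\<exists>v. is_arg_min (\<lambda>v. coeff_vec D 1 \<bullet> v) (\<lambda>v. v \<in> dual_cone D \<and> linf_norm v = 1) v \<and>
         coeff_vec D 1 \<bullet> v \<ge> 1"
      by (rule min_at_zero_evaluation[OF D])
    show "\<exists>Z \<alpha>. finite Z \<and> Z \<subseteq> {-1..1} \<and> unisolvent D Z \<and> (\<forall>z\<in>Z. \<alpha> z > 0) \<and>
         cond_num (mat (D + 1) (D + 1) (\<lambda>ij. \<Sum>z\<in>Z. \<alpha> z * outer (monom_vec D z) (monom_vec D z) $$ ij))
           \<le> C * (1 + sqrt 2) ^ (4 * (D + 1)) / sqrt (real (D + 1))"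
      by (rule cond[OF D])
  qed (rule cert)
qed

end
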